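(* Let $x$ be a complex parameter independent of $\hbar$, and let $\xi=e^{x\hbar}$. Let $\mathcal T(\xi;z)$ be the operator defined in the context, written in the Heisenberg algebra $\mathcal H$ through the realization given there, with $q_1=e^\hbar$, $q_2=e^{(\beta-1)\hbar}$, $q_3=e^{-\beta\hbar}$ and $\beta$ fixed. Then the $\hbar$-expansion of $\mathcal T(\xi;z)$ is of the form $$\mathcal T(\xi;z)=2+\Big(2\beta\,\mathsf T(x;z)\,z^2+\frac{(\beta-1)^2}{4}\Big)\hbar^2+O(\hbar^3),$$ $$\mathsf T(x;z)\equiv T(z)+\Big(\frac{x^2}{\beta}-\frac12\Big)\,{}^{\bullet}_{\bullet}\widetilde\psi'(z)\widetilde\psi(z){}^{\bullet}_{\bullet}+\frac{x}{\sqrt{-\beta}}\,\widetilde\psi(z)G(z),$$ where $T(z)=\frac12:\widetilde\phi'(z)^2:+\sigma\widetilde\phi''(z)+\frac12\,{}^{\bullet}_{\bullet}\psi'(z)\psi(z){}^{\bullet}_{\bullet}$ and $G(z)=:\widetilde\phi'(z):\psi(z)+2\sigma\psi'(z)$ with $\sigma=\dfrac{1-\beta}{2\sqrt\beta}$.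
   Context: Heisenberg algebra $\mathcal H$: generators $a_n,Q,\widetilde a_n,\widetilde Q$ ($n\in\mathbb Z$) with $[a_n,a_m]=[\widetilde a_n,\widetilde a_m]=n\delta_{n+m,0}$, $[a_n,\widetilde a_m]=0$, $[a_n,Q]=[\widetilde a_n,\widetilde Q]=\delta_{n,0}$, $[a_n,\widetilde Q]=[\widetilde a_n,Q]=0$. $:\ast:$ is the usual normal ordering (modes with $n<0$ and $Q,\widetilde Q$ to the left, modes with $n\ge0$ to the right). $\phi(z)=Q+a_0\log z-\sum_{n\ne0}\frac1na_nz^{-n}$, $\widetilde\phi(z)=\widetilde Q+\widetilde a_0\log z-\sum_{n\ne0}\frac1n\widetilde a_nz^{-n}$; primes denote $\frac{d}{dz}$. Fermions: $\psi(z)=\frac1{\sqrt{-2}}(:e^{\phi(z)}:-:e^{-\phi(z)}:)=\sum_{\mu\in\mathbb Z+1/2}\psi_\mu z^{-\mu-1/2}$, $\widetilde\psi(z)=\frac1{\sqrt2}(:e^{\phi(z)}:+:e^{-\phi(z)}:)=\sum_{\mu\in\mathbb Z+1/2}\widetilde\psi_\mu z^{-\mu-1/2}$; their modes satisfy $\psi_\mu\psi_\nu+\psi_\nu\psi_\mu=\widetilde\psi_\mu\widetilde\psi_\nu+\widetilde\psi_\nu\widetilde\psi_\mu=\delta_{\mu+\nu,0}$ and $\psi,\widetilde\psi$ modes anticommute with each other. Fermionic normal ordering: ${}^{\bullet}_{\bullet}\psi_\mu\psi_\nu{}^{\bullet}_{\bullet}=\psi_\mu\psi_\nu$ if $\mu\le\nu$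 and $-\psi_\nu\psi_\mu$ if $\mu>\nu$ (equivalently ${}^{\bullet}_{\bullet}\psi(z)\psi(w){}^{\bullet}_{\bullet}=\psi(z)\psi(w)-\frac1{z-w}$), similarly for $\widetilde\psi$. Square roots are consistent: $\sqrt{-2}=\sqrt{-1}\sqrt2$, $\sqrt{-\beta}=\sqrt{-1}\sqrt\beta$. Operators: $q=e^{(\beta-1)\hbar/2}$. For $i=1,2$, $$\Lambda_i^+(z)=:\exp\Big(-\sum_{n\ne0}\frac{q^n}{n}h^\perp_{i,n}z^{-n}\Big):e^{Q_i^\perp}(q^{-1}z)^{h^\perp_{i,0}}q_1^{\mathsf a_0^\perp},\qquad \Lambda_i^-(z)=:\exp\Big(\sum_{n\ne0}\frac{q^{-n}}{n}h^\perp_{i,n}z^{-n}\Big):e^{-Q_i^\perp}(qz)^{-h^\perp_{i,0}}q_1^{-\mathsf a_0^\perp},$$ $$\mathcal T(\xi;z)=q:\Lambda_1^+(\xi z)\Lambda_2^+(z):+q^{-1}:\Lambda_1^-(\xi z)\Lambda_2^-(z):+z^2q(1-q_1\xi)(1-q_3\xi):\Lambda_1^+(\xi z)\Lambda_2^-(z):+z^2q^{-1}(1-q_1^{-1}\xi)(1-q_3^{-1}\xi):\Lambda_1^-(\xi z)\Lambda_2^+(z):.$$ Realization in $\mathcal H$ (for $n>0$): $$h^\perp_{1,n}=\tfrac{(1+q_1^n)(1+q_3^n)}{2(1+q_2^{-n})}a_n+\tfrac{\sqrt\beta}2(1-q_1^n)\widetilde a_n,\quad h^\perp_{1,-n}=a_{-n}+\tfrac{1-q_3^n}{\sqrt\beta(1+q_2^{-n})}\widetilde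 a_{-n},$$ $$h^\perp_{2,n}=-\tfrac{(1+q_1^n)(1+q_3^n)}{2(1+q_2^{-n})}a_n+\tfrac{\sqrt\beta}2(1-q_1^n)\widetilde a_n,\quad h^\perp_{2,-n}=-a_{-n}+\tfrac{1-q_3^n}{\sqrt\beta(1+q_2^{-n})}\widetilde a_{-n},$$ $h^\perp_{1,0}=-h^\perp_{2,0}=a_0$, $Q_1^\perp=-Q_2^\perp=Q$, $\mathsf a_0^\perp=\frac{\sqrt\beta}2\widetilde a_0$ (and its conjugate zero mode $\mathsf Q^\perp=\sqrt\beta\,\widetilde Q$). The $\hbar$-expansion is the expansion, with $\beta$ fixed, of the normally ordered expressions in the generators of $\mathcal H$. *)

theory Defs
  imports
    "HOL-Computational_Algebra.Formal_Power_Series"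
    "HOL-Library.Groups_Big_Fun"
    "HOL-Library.Poly_Mapping"
    "HOL-Library.Multiset"
    Complex_Main
begin

section \<open>Representations of the Heisenberg algebra\<close>

text \<open>
  \<open>A n\<close> stands for \<open>a\<^sub>n\<close>, and \<open>At n\<close> for \<open>a\<^sub>n\<close> with a tilde.
  Infinite sums of modes make sense as operators on a representation of the Heisenberg
  algebra, so all operators act on the vectors of an arbitrary representation \<open>M\<close>
  of the type specified in \<open>heisenberg_module\<close> below.
\<close>

datatype mode = A int | At int

fun deg :: "mode \<Rightarrow> int" where
  "deg (A n) = n"
| "deg (At n) = n"

text \<open>
  \<open>expQ M k\<close> is the operator \<open>e\<^bsup>kQ\<^esup>\<close>. The generator \<open>Q\<close> occurs only in this way: since the
  fields have integral powers of \<open>z\<close> only, \<open>z\<close> to the power \<open>a\<^sub>0\<close> forces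
  \<open>a\<^sub>0\<close> to be diagonalisable with integer eigenvalues, and then \<open>Q\<close> itself cannot act.
  The generator \<open>Q\<close> with a tilde enters only through the field \<open>\<phi>\<close> with a tilde,
  and only derivatives of that field are ever used. So no action of it is required: it may
  or may not act on the representation, and the mode \<open>At 0\<close> need not be a scalar.
\<close>

record 'v heis =
  smul :: "complex \<Rightarrow> 'v \<Rightarrow> 'v"
  act :: "mode \<Rightarrow> 'v \<Rightarrow> 'v"
  expQ :: "int \<Rightarrow> 'v \<Rightarrow> 'v"

definition word :: "('v, 'b) heis_scheme \<Rightarrow> mode list \<Rightarrow> 'v \<Rightarrow> 'v" where
  "word M ws = foldr (\<lambda>g f. act M g \<circ> f) ws id"

text \<open>
  The last two conditions are those under which the vertex operators are defined: every vector
  is a finite sum of eigenvectors of \<open>a\<^sub>0\<close> with integer eigenvalues (Neveu-Schwarz sector),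
  and every vector is annihilated by all products of annihilation operators and zero modes of
  sufficiently large total degree.
\<close>

locale heisenberg_module =
  fixes M :: "('v::ab_group_add, 'b) heis_scheme"
  assumes vector_space: "vector_space (smul M)"
    and linear_act: "Vector_Spaces.linear (smul M) (smul M) (act M g)"
    and linear_expQ: "Vector_Spaces.linear (smul M) (smul M) (expQ M k)"
    and comm_A_A: "act M (A n) (act M (A m) v) - act M (A m) (act M (A n) v)
           = (if n + m = 0 then smul M (of_int n) v else 0)"
    and comm_At_At: "act M (At n) (act M (At m) v) - act M (At m) (act M (At n) v)
           = (if n + m = 0 then smul M (of_int n) v else 0)"
    and comm_A_At: "act M (A n) (act M (At m) v) = act M (At m) (act M (A n) v)"
    and expQ_0: "expQ M 0 v = v"
    and expQ_add: "expQ M (k + l) v = expQ M k (expQ M l v)"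
    and comm_A_expQ: "act M (A n) (expQ M k v) - expQ M k (act M (A n) v)
           = (if n = 0 then smul M (of_int k) (expQ M k v) else 0)"
    and comm_At_expQ: "act M (At n) (expQ M k v) = expQ M k (act M (At n) v)"
    and integral_charge: "\<exists>f. finite {m. f m \<noteq> 0} \<and>
           (\<forall>m::int. act M (A 0) (f m) = smul M (of_int m) (f m)) \<and> v = (\<Sum>m. f m)"
    and bounded_energy: "\<exists>N::int. \<forall>ws.
           (\<forall>g\<in>set ws. deg g \<ge> 0) \<and> (\<Sum>g\<leftarrow>ws. deg g) > N \<longrightarrow> word M ws v = 0"

section \<open>Formal fields\<close>

text \<open>
  A field \<open>F\<close> is a formal distribution in \<open>z\<close> with operator coefficients; \<open>F k\<close> is the
  coefficient of \<open>z\<^sup>k\<close>. In an \<open>\<hbar>\<close>-series of fields, \<open>F r k\<close> is the coefficient of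
  \<open>\<hbar>\<^sup>r z\<^sup>k\<close>. Infinite sums of operators are locally finite: they are applied to a
  vector and expressed by \<^const>\<open>Sum_any\<close>, the sum over the finite set of nonzero terms.
\<close>

type_synonym 'v distr = "int \<Rightarrow> 'v \<Rightarrow> 'v"
type_synonym 'v hdistr = "nat \<Rightarrow> int \<Rightarrow> 'v \<Rightarrow> 'v"

definition fone :: "'v::zero distr" where
  "fone k v = (if k = 0 then v else 0)"

definition fadd :: "'v::plus distr \<Rightarrow> 'v distr \<Rightarrow> 'v distr" where
  "fadd F G k v = F k v + G k v"

definition fsmul :: "('v, 'b) heis_scheme \<Rightarrow> complex \<Rightarrow> 'v distr \<Rightarrow> 'v distr" where
  "fsmul M c F k v = smul M c (F k v)"

definition fderiv :: "('v, 'b) heis_scheme \<Rightarrow> 'v distr \<Rightarrow> 'v distr" where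
  "fderiv M F k v = smul M (of_int (k + 1)) (F (k + 1) v)"

text \<open>Multiplication by \<open>z\<^sup>d\<close>.\<close>

definition fshift :: "int \<Rightarrow> 'v distr \<Rightarrow> 'v distr" where
  "fshift d F k = F (k - d)"

definition fmult :: "'v::comm_monoid_add distr \<Rightarrow> 'v distr \<Rightarrow> 'v distr" where
  "fmult F G k v = (\<Sum>i. F i (G (k - i) v))"

definition hadd :: "'v::plus hdistr \<Rightarrow> 'v hdistr \<Rightarrow> 'v hdistr" where
  "hadd F G r = fadd (F r) (G r)"

definition hscale ::
  "('v::ab_group_add, 'b) heis_scheme \<Rightarrow> complex fps \<Rightarrow> 'v hdistr \<Rightarrow> 'v hdistr" where
  "hscale M p F r k v = (\<Sum>i\<le>r. smul M (fps_nth p i) (F (r - i) k v))"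

definition hshift :: "int \<Rightarrow> 'v hdistr \<Rightarrow> 'v hdistr" where
  "hshift d F r = fshift d (F r)"

section \<open>Normal ordering and vertex operators\<close>

text \<open>
  Normal ordering of a product of modes and of an operator \<open>X\<close> such as \<open>e\<^bsup>kQ\<^esup>\<close>
  which involves zero modes only. The modes of nonnegative degree commute with each other,
  and so do those of negative degree.
\<close>

definition nord :: "('v, 'b) heis_scheme \<Rightarrow> ('v \<Rightarrow> 'v) \<Rightarrow> mode list \<Rightarrow> 'v \<Rightarrow> 'v" where
  "nord M X ws = word M (filter (\<lambda>g. deg g < 0) ws) \<circ> X \<circ> word M (filter (\<lambda>g. deg g \<ge> 0) ws)"

text \<open>The component of \<open>v\<close> in the eigenspace of \<open>a\<^sub>0\<close> with eigenvalue \<open>m\<close>.\<close>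

definition charge_part :: "('v::ab_group_add, 'b) heis_scheme \<Rightarrow> int \<Rightarrow> 'v \<Rightarrow> 'v" where
  "charge_part M m v = (THE u. \<exists>f. finite {n. f n \<noteq> 0} \<and>
     (\<forall>n::int. act M (A 0) (f n) = smul M (of_int n) (f n)) \<and> v = (\<Sum>n. f n) \<and> u = f m)"

text \<open>The field \<open>z\<close> to the power \<open>k a\<^sub>0\<close>.\<close>

definition zpow :: "('v::ab_group_add, 'b) heis_scheme \<Rightarrow> int \<Rightarrow> 'v distr" where
  "zpow M k j v = (\<Sum>m. if k * m = j then charge_part M m v else 0)"

text \<open>
  The pair \<open>(k, c)\<close> encodes the linear expression
  \<open>k (Q + a\<^sub>0 log z) + \<Sum>\<^sub>g c(g) g z\<^bsup>-deg g\<^esup>\<close>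
  in the generators, \<open>g\<close> running over all modes. Its coefficients are power series
  in \<open>\<hbar>\<close>; those of zero modes are to have vanishing constant term.
  Inside the normal ordering everything commutes, so a normally ordered product of exponentials
  is the normally ordered exponential of the sum of the exponents.
\<close>

type_synonym exponent = "int \<times> (mode \<Rightarrow> complex fps)"

definition exponent_add :: "exponent \<Rightarrow> exponent \<Rightarrow> exponent" where
  "exponent_add E F = (fst E + fst F, \<lambda>g. snd E g + snd F g)"

text \<open>
  The normally ordered exponential of \<open>E\<close>. The \<open>n\<close>-th power of the sum over the modes
  is expanded into a sum over the words of length \<open>n\<close>, and a word \<open>ws\<close> comes with
  \<open>z\<close> to the power minus the total degree of \<open>ws\<close>.
\<close>

definition nexp :: "('v::ab_group_add, 'b) heis_scheme \<Rightarrow> exponent \<Rightarrow> 'v hdistr" where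
  "nexp M E r j v = (\<Sum>ws.
     smul M (fps_nth (\<Prod>g\<leftarrow>ws. snd E g) r / fact (length ws))
       (nord M (expQ M (fst E) \<circ> zpow M (fst E) (j + (\<Sum>g\<leftarrow>ws. deg g))) ws v))"

section \<open>The bosonic field with a tilde, the fermions, and the fields T and G\<close>

text \<open>
  The derivative of \<open>\<phi>\<close> with a tilde: the sum of \<open>At n z\<^bsup>-n-1\<^esup>\<close> over all \<open>n\<close>.
\<close>

definition dphit :: "('v, 'b) heis_scheme \<Rightarrow> 'v distr" where
  "dphit M k = act M (At (- k - 1))"

definition nord_dphit_sq :: "('v::ab_group_add, 'b) heis_scheme \<Rightarrow> 'v distr" where
  "nord_dphit_sq M k v = (\<Sum>n. nord M id [At n, At (- k - 2 - n)] v)"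

text \<open>The exponent \<open>k \<phi>(z)\<close>.\<close>

definition phi_exponent :: "int \<Rightarrow> exponent" where
  "phi_exponent k = (k, \<lambda>g. case g of
       A n \<Rightarrow> if n = 0 then 0 else fps_const (- of_int k / of_int n)
     | At n \<Rightarrow> 0)"

definition exp_phi :: "('v::ab_group_add, 'b) heis_scheme \<Rightarrow> int \<Rightarrow> 'v distr" where
  "exp_phi M k = nexp M (phi_exponent k) 0"

definition psi :: "('v::ab_group_add, 'b) heis_scheme \<Rightarrow> 'v distr" where
  "psi M = fsmul M (1 / (\<i> * complex_of_real (sqrt 2)))
     (fadd (exp_phi M 1) (fsmul M (- 1) (exp_phi M (- 1))))"

definition psit :: "('v::ab_group_add, 'b) heis_scheme \<Rightarrow> 'v distr" where
  "psit M = fsmul M (1 / complex_of_real (sqrt 2)) (fadd (exp_phi M 1) (exp_phi M (- 1)))"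

text \<open>
  The coefficient of \<open>z\<^sup>i w\<^sup>j\<close> in the fermionic normally ordered product of
  \<open>F(z)\<close> and \<open>F(w)\<close>. The mode \<open>F\<^sub>\<mu>\<close> is the coefficient of \<open>z\<close> to the power
  \<open>-\<mu>-1/2\<close>, hence \<open>\<mu> \<le> \<nu>\<close> amounts to \<open>j \<le> i\<close> for the indices of the coefficients.
\<close>

definition fermion_nord :: "'v::ab_group_add distr \<Rightarrow> int \<Rightarrow> int \<Rightarrow> 'v \<Rightarrow> 'v" where
  "fermion_nord F i j v = (if j \<le> i then F i (F j v) else - F j (F i v))"

text \<open>The fermionic normally ordered product of \<open>F'(z)\<close> and \<open>F(z)\<close>.\<close>

definition fermion_nord_deriv ::
  "('v::ab_group_add, 'b) heis_scheme \<Rightarrow> 'v distr \<Rightarrow> 'v distr" where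
  "fermion_nord_deriv M F k v = (\<Sum>i. smul M (of_int i) (fermion_nord F i (k + 1 - i) v))"

text \<open>In what follows, \<open>s\<close> is the chosen square root of \<open>\<beta>\<close>.\<close>

definition sigma :: "complex \<Rightarrow> complex \<Rightarrow> complex" where
  "sigma \<beta> s = (1 - \<beta>) / (2 * s)"

definition Tfield :: "('v::ab_group_add, 'b) heis_scheme \<Rightarrow> complex \<Rightarrow> complex \<Rightarrow> 'v distr" where
  "Tfield M \<beta> s =
     fadd (fsmul M (1 / 2) (nord_dphit_sq M))
    (fadd (fsmul M (sigma \<beta> s) (fderiv M (dphit M)))
          (fsmul M (1 / 2) (fermion_nord_deriv M (psi M))))"

definition Gfield :: "('v::ab_group_add, 'b) heis_scheme \<Rightarrow> complex \<Rightarrow> complex \<Rightarrow> 'v distr" where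
  "Gfield M \<beta> s =
     fadd (fmult (dphit M) (psi M)) (fsmul M (2 * sigma \<beta> s) (fderiv M (psi M)))"

definition sfT ::
  "('v::ab_group_add, 'b) heis_scheme \<Rightarrow> complex \<Rightarrow> complex \<Rightarrow> complex \<Rightarrow> 'v distr" where
  "sfT M \<beta> s x =
     fadd (Tfield M \<beta> s)
    (fadd (fsmul M (x\<^sup>2 / \<beta> - 1 / 2) (fermion_nord_deriv M (psit M)))
          (fsmul M (x / (\<i> * s)) (fmult (psit M) (Gfield M \<beta> s))))"

section \<open>The operator \<open>\<T>(\<xi>;z)\<close>\<close>

text \<open>\<^term>\<open>fps_X\<close> is \<open>\<hbar>\<close>, and \<^term>\<open>fps_exp c\<close> is the exponential of \<open>c \<hbar>\<close>.\<close>

definition q1 :: "complex fps" where "q1 = fps_exp 1"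
definition q2 :: "complex \<Rightarrow> complex fps" where "q2 \<beta> = fps_exp (\<beta> - 1)"
definition q3 :: "complex \<Rightarrow> complex fps" where "q3 \<beta> = fps_exp (- \<beta>)"
definition log_q :: "complex \<Rightarrow> complex fps" where "log_q \<beta> = fps_const ((\<beta> - 1) / 2) * fps_X"
definition qq :: "complex \<Rightarrow> complex fps" where "qq \<beta> = fps_exp ((\<beta> - 1) / 2)"
definition xi :: "complex \<Rightarrow> complex fps" where "xi x = fps_exp x"

text \<open>\<open>lin n \<alpha> \<gamma>\<close> is the linear combination \<open>\<alpha> A n + \<gamma> At n\<close>, as a family of coefficients.\<close>

definition lin :: "int \<Rightarrow> complex fps \<Rightarrow> complex fps \<Rightarrow> mode \<Rightarrow> complex fps" where
  "lin n \<alpha> \<gamma> g = (if g = A n then \<alpha> else if g = At n then \<gamma> else 0)"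

text \<open>
  The index \<open>i\<close> is 1 or 2. In the realization, the terms of \<open>h\<^sub>2\<close> and \<open>Q\<^sub>2\<close> belonging to
  \<open>a\<^sub>n\<close> and \<open>Q\<close> are those of \<open>h\<^sub>1\<close> and \<open>Q\<^sub>1\<close> with the opposite sign.
\<close>

definition sg :: "nat \<Rightarrow> int" where
  "sg i = (if i = 1 then 1 else - 1)"

definition hperp ::
  "complex \<Rightarrow> complex \<Rightarrow> nat \<Rightarrow> int \<Rightarrow> mode \<Rightarrow> complex fps" where
  "hperp \<beta> s i n =
    (if n > 0 then
       lin n (of_int (sg i) * ((1 + q1 powi n) * (1 + q3 \<beta> powi n)) / (2 * (1 + q2 \<beta> powi (- n))))
             (fps_const (s / 2) * (1 - q1 powi n))
     else if n < 0 then
       (let m = - n in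
        lin (- m) (of_int (sg i))
                  ((1 - q3 \<beta> powi m) / (fps_const s * (1 + q2 \<beta> powi (- m)))))
     else lin 0 (of_int (sg i)) 0)"

text \<open>
  In the zero mode part, \<open>log_q \<beta> * hperp \<beta> s i 0 g\<close> comes from the power of \<open>q\<close> with exponent
  \<open>h\<^sub>0\<close>, and \<open>fps_X * lin 0 0 (s / 2) g\<close> from the power of
  \<open>q1\<close> with exponent the zero mode \<open>s / 2\<close> times \<open>At 0\<close>.
\<close>

definition Lambda_plus :: "complex \<Rightarrow> complex \<Rightarrow> nat \<Rightarrow> exponent" where
  "Lambda_plus \<beta> s i = (sg i, \<lambda>g. let n = deg g in
     if n \<noteq> 0 then - (qq \<beta> powi n * fps_const (1 / of_int n)) * hperp \<beta> s i n g
     else - log_q \<beta> * hperp \<beta> s i 0 g + fps_X * lin 0 0 (fps_const (s / 2)) g)"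

definition Lambda_minus :: "complex \<Rightarrow> complex \<Rightarrow> nat \<Rightarrow> exponent" where
  "Lambda_minus \<beta> s i = (- sg i, \<lambda>g. let n = deg g in
     if n \<noteq> 0 then (qq \<beta> powi (- n) * fps_const (1 / of_int n)) * hperp \<beta> s i n g
     else - log_q \<beta> * hperp \<beta> s i 0 g - fps_X * lin 0 0 (fps_const (s / 2)) g)"

text \<open>
  Substitution of \<open>\<xi> z\<close> for \<open>z\<close> in an exponent, where \<open>log (\<xi> z) = x \<hbar> + log z\<close>.
\<close>

definition at_xi :: "complex \<Rightarrow> exponent \<Rightarrow> exponent" where
  "at_xi x E = (fst E, \<lambda>g. snd E g * xi x powi (- deg g)
     + (if g = A 0 then of_int (fst E) * fps_const x * fps_X else 0))"

definition TT ::
  "('v::ab_group_add, 'b) heis_scheme \<Rightarrow> complex \<Rightarrow> complex \<Rightarrow> complex \<Rightarrow> 'v hdistr" where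
  "TT M \<beta> s x =
     hadd (hscale M (qq \<beta>)
            (nexp M (exponent_add (at_xi x (Lambda_plus \<beta> s 1)) (Lambda_plus \<beta> s 2))))
    (hadd (hscale M (inverse (qq \<beta>))
            (nexp M (exponent_add (at_xi x (Lambda_minus \<beta> s 1)) (Lambda_minus \<beta> s 2))))
    (hadd (hshift 2 (hscale M (qq \<beta> * (1 - q1 * xi x) * (1 - q3 \<beta> * xi x))
            (nexp M (exponent_add (at_xi x (Lambda_plus \<beta> s 1)) (Lambda_minus \<beta> s 2)))))
          (hshift 2 (hscale M (inverse (qq \<beta>) * (1 - inverse q1 * xi x) * (1 - inverse (q3 \<beta>) * xi x))
            (nexp M (exponent_add (at_xi x (Lambda_minus \<beta> s 1)) (Lambda_plus \<beta> s 2)))))))"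

section \<open>The Fock space\<close>

text \<open>
  An instance of \<open>heisenberg_module\<close>, so that the locale is not vacuous. The
  basis vector \<open>(m, p)\<close> stands for the product of the modes in \<open>p\<close> applied to
  \<open>e\<^bsup>mQ\<^esup>\<close> times the vacuum. The generator \<open>Q\<close> with a tilde is the variable \<open>At 0\<close>,
  and \<open>At 0\<close> acts as the derivative with respect to it. (Positive modes and \<open>A 0\<close> are
  harmless additional variables, and only multiply the representation.)
\<close>

fun conj_mode :: "mode \<Rightarrow> mode" where
  "conj_mode (A n) = A (- n)"
| "conj_mode (At n) = At (- n)"

type_synonym fock = "(int \<times> mode multiset) \<Rightarrow>\<^sub>0 complex"

definition fock_act_fun ::
  "mode \<Rightarrow> (int \<times> mode multiset \<Rightarrow> complex) \<Rightarrow> int \<times> mode multiset \<Rightarrow> complex" where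
  "fock_act_fun g f = (\<lambda>(m, p).
     if deg g < 0 then (if g \<in># p then f (m, p - {#g#}) else 0)
     else if g = A 0 then of_int m * f (m, p)
     else of_int (if deg g = 0 then 1 else deg g) * (of_nat (count p (conj_mode g)) + 1)
            * f (m, add_mset (conj_mode g) p))"

lemma finite_fock_act_fun:
  assumes "finite {b. f b \<noteq> 0}"
  shows "finite {b. fock_act_fun g f b \<noteq> 0}"
proof (rule finite_subset)
  let ?S = "{b. f b \<noteq> 0}"
  show "{b. fock_act_fun g f b \<noteq> 0} \<subseteq> ?S \<union> (\<lambda>(m, p). (m, add_mset g p)) ` ?S
          \<union> (\<lambda>(m, p). (m, p - {#conj_mode g#})) ` ?S"
  proof
    fix b assume b: "b \<in> {b. fock_act_fun g f b \<noteq> 0}"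
    obtain m p where [simp]: "b = (m, p)" by (cases b)
    consider "deg g < 0" | "g = A 0" | "\<not> deg g < 0" "g \<noteq> A 0" by blast
    then show "b \<in> ?S \<union> (\<lambda>(m, p). (m, add_mset g p)) ` ?S
          \<union> (\<lambda>(m, p). (m, p - {#conj_mode g#})) ` ?S"
    proof cases
      case 1
      then have "g \<in># p" "f (m, p - {#g#}) \<noteq> 0"
        using b by (auto simp: fock_act_fun_def split: if_splits)
      then have "b = (\<lambda>(m, p). (m, add_mset g p)) (m, p - {#g#})" "(m, p - {#g#}) \<in> ?S" by auto
      then show ?thesis by blast
    next
      case 2
      then show ?thesis using b by (auto simp: fock_act_fun_def)
    next
      case 3
      then have "f (m, add_mset (conj_mode g) p) \<noteq> 0" using b by (auto simp: fock_act_fun_def)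
      then have "b = (\<lambda>(m, p). (m, p - {#conj_mode g#})) (m, add_mset (conj_mode g) p)"
        "(m, add_mset (conj_mode g) p) \<in> ?S" by auto
      then show ?thesis by blast
    qed
  qed
  show "finite (?S \<union> (\<lambda>(m, p). (m, add_mset g p)) ` ?S
          \<union> (\<lambda>(m, p). (m, p - {#conj_mode g#})) ` ?S)"
    using assms by blast
qed

lemma finite_fock_shift:
  assumes "finite {b. f b \<noteq> (0::complex)}"
  shows "finite {b. f (fst b - (k::int), snd b) \<noteq> 0}"
proof (rule finite_subset)
  show "{b. f (fst b - k, snd b) \<noteq> 0} \<subseteq> (\<lambda>(m, p). (m + k, p)) ` {b. f b \<noteq> 0}"
  proof
    fix b assume "b \<in> {b. f (fst b - k, snd b) \<noteq> 0}"
    then have "b = (\<lambda>(m, p). (m + k, p)) (fst b - k, snd b)" "(fst b - k, snd b) \<in> {b. f b \<noteq> 0}"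
      by auto
    then show "b \<in> (\<lambda>(m, p). (m + k, p)) ` {b. f b \<noteq> 0}" by blast
  qed
qed (use assms in blast)

lift_definition fock_act :: "mode \<Rightarrow> fock \<Rightarrow> fock" is fock_act_fun
  by (rule finite_fock_act_fun)

lift_definition fock_expQ :: "int \<Rightarrow> fock \<Rightarrow> fock" is "\<lambda>k f b. f (fst b - k, snd b)"
  by (rule finite_fock_shift)

lift_definition fock_smul :: "complex \<Rightarrow> fock \<Rightarrow> fock" is "\<lambda>c f b. c * f b"
  by (erule rev_finite_subset) auto

lift_definition fock_charge :: "int \<Rightarrow> fock \<Rightarrow> fock" is "\<lambda>m f b. if fst b = m then f b else 0"
  by (erule rev_finite_subset) auto

definition fock :: "fock heis" where
  "fock = \<lparr>smul = fock_smul, act = fock_act, expQ = fock_expQ\<rparr>"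

definition energy :: "mode multiset \<Rightarrow> int" where
  "energy p = (\<Sum>g\<in>#p. \<bar>deg g\<bar>)"

lemma heisenberg_module_fock: "heisenberg_module fock"
proof -
  note lk = fock_act.rep_eq fock_expQ.rep_eq fock_smul.rep_eq fock_charge.rep_eq
    lookup_add lookup_minus
  have vs: "vector_space fock_smul"
    by unfold_locales (auto intro!: poly_mapping_eqI simp: lk algebra_simps)
  have lin_act: "Vector_Spaces.linear fock_smul fock_smul (fock_act g)" for g
    using vs unfolding Vector_Spaces.linear_def module_hom_def module_hom_axioms_def vector_space_def
    by (auto simp: module_def intro!: poly_mapping_eqI)
      (auto simp: lk fock_act_fun_def algebra_simps)
  have lin_expQ: "Vector_Spaces.linear fock_smul fock_smul (fock_expQ k)" for k
    using vs unfolding Vector_Spaces.linear_def module_hom_def module_hom_axioms_def vector_space_def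
    by (auto simp: module_def intro!: poly_mapping_eqI) (auto simp: lk)
  have mixed: "fock_act g (fock_act g' v) - fock_act g' (fock_act g v)
      = (if g' = conj_mode g then fock_smul (of_int (deg g)) v else 0)"
    if g: "deg g < 0" and g': "\<not> deg g' < 0" for g g' :: mode and v :: fock
  proof (rule poly_mapping_eqI)
    fix b :: "int \<times> mode multiset"
    obtain m p where b: "b = (m, p)" by (cases b)
    have conj: "conj_mode (conj_mode h) = h" "deg (conj_mode h) = - deg h" for h by (cases h; simp)+
    show "Poly_Mapping.lookup (fock_act g (fock_act g' v) - fock_act g' (fock_act g v)) b
        = Poly_Mapping.lookup (if g' = conj_mode g then fock_smul (of_int (deg g)) v else 0) b"
    proof (cases "g' = conj_mode g")
      case True
      then have "g' \<noteq> A 0" "deg g' \<noteq> 0" using g conj(2)[of g] by auto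
      with g g' True show ?thesis
        by (cases "g \<in># p")
          (auto simp: b lk fock_act_fun_def conj count_eq_zero_iff algebra_simps of_nat_diff Suc_le_eq)
    next
      case False
      then have "conj_mode g' \<noteq> g" using conj(1)[of g'] by auto
      with g g' False show ?thesis
        by (auto simp: b lk fock_act_fun_def conj)
    qed
  qed

  have comm: "fock_act g (fock_act g' v) - fock_act g' (fock_act g v)
      = (if g' = conj_mode g then fock_smul (of_int (deg g)) v else 0)"
    for g g' :: mode and v :: fock
  proof (rule poly_mapping_eqI)
    fix b :: "int \<times> mode multiset"
    obtain m p where b: "b = (m, p)" by (cases b)
    have neq: "conj_mode g = conj_mode g' \<longleftrightarrow> g = g'"
      by (cases g; cases g') auto
    have cc: "g = conj_mode g' \<longleftrightarrow> g' = conj_mode g"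
      by (cases g; cases g') auto
    have dc: "deg (conj_mode h) = - deg h" and A0: "conj_mode h = A 0 \<longleftrightarrow> h = A 0" for h
      by (cases h; simp)+
    consider (nn) "deg g < 0" "deg g' < 0" | (np) "deg g < 0" "\<not> deg g' < 0"
      | (pn) "\<not> deg g < 0" "deg g' < 0" | (pp) "\<not> deg g < 0" "\<not> deg g' < 0" by blast
    then show "Poly_Mapping.lookup (fock_act g (fock_act g' v) - fock_act g' (fock_act g v)) b
        = Poly_Mapping.lookup (if g' = conj_mode g then fock_smul (of_int (deg g)) v else 0) b"
    proof cases
      case nn
      then have "g' \<noteq> conj_mode g" using dc[of g] by auto
      with nn show ?thesis
        by (auto simp: b lk fock_act_fun_def in_diff_count diff_right_commute add_mset_commute split: if_splits)
    next
      case np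
      then show ?thesis using mixed[of g g' v] by simp
    next
      case pn
      have "fock_act g (fock_act g' v) - fock_act g' (fock_act g v)
          = - (fock_act g' (fock_act g v) - fock_act g (fock_act g' v))" by simp
      also have "\<dots> = - (if g = conj_mode g' then fock_smul (of_int (deg g')) v else 0)"
        using pn by (subst mixed) auto
      finally show ?thesis using cc dc[of g] by (auto simp: lk)
    next
      case pp
      show ?thesis
      proof (cases "g = g'")
        case True
        have "deg g = 0" if "g = conj_mode g" using dc[of g] that by simp
        with True show ?thesis by (auto simp: lk)
      next
        case False
        moreover have "g' \<noteq> conj_mode g"
        proof
          assume eq: "g' = conj_mode g"
          then have "deg g = 0" using pp dc[of g] by simp
          with eq False show False by (cases g) auto
        qed
        ultimately show ?thesis
          using pp neq[symmetric] by (auto simp: b lk fock_act_fun_def add_mset_commute A0)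
      qed
    qed
  qed
  have cA: "fock_act (A n) (fock_expQ k v) - fock_expQ k (fock_act (A n) v)
      = (if n = 0 then fock_smul (of_int k) (fock_expQ k v) else 0)" for n k v
    by (rule poly_mapping_eqI) (auto simp: lk fock_act_fun_def algebra_simps split_beta)
  have cAt: "fock_act (At n) (fock_expQ k v) = fock_expQ k (fock_act (At n) v)" for n k v
    by (rule poly_mapping_eqI) (auto simp: lk fock_act_fun_def split_beta)
  have charge: "\<exists>f. finite {m. f m \<noteq> 0} \<and>
      (\<forall>m::int. fock_act (A 0) (f m) = fock_smul (of_int m) (f m)) \<and> v = (\<Sum>m. f m)" for v
  proof (intro exI conjI allI)
    let ?S = "fst ` Poly_Mapping.keys v"
    have sub: "{m. fock_charge m v \<noteq> 0} \<subseteq> ?S"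
    proof
      fix m assume "m \<in> {m. fock_charge m v \<noteq> 0}"
      then obtain b where "Poly_Mapping.lookup (fock_charge m v) b \<noteq> 0"
        by (metis lookup_zero mem_Collect_eq poly_mapping_eqI)
      then have "fst b = m" "b \<in> Poly_Mapping.keys v"
        by (auto simp: lk in_keys_iff split: if_splits)
      then show "m \<in> ?S" by blast
    qed
    show "finite {m. fock_charge m v \<noteq> 0}" using sub by (rule finite_subset) simp
    show "fock_act (A 0) (fock_charge m v) = fock_smul (of_int m) (fock_charge m v)" for m
      by (rule poly_mapping_eqI) (auto simp: lk fock_act_fun_def)
    have "(\<Sum>m. fock_charge m v) = (\<Sum>m\<in>?S. fock_charge m v)"
      using sub by (intro Sum_any.expand_superset) simp_all
    also have "\<dots> = v"
    proof (rule poly_mapping_eqI)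
      fix b
      have "Poly_Mapping.lookup (\<Sum>m\<in>?S. fock_charge m v) b = (\<Sum>m\<in>?S. if fst b = m then Poly_Mapping.lookup v b else 0)"
        by (simp add: lookup_sum lk)
      also have "\<dots> = Poly_Mapping.lookup v b" by (auto simp: in_keys_iff image_iff)
      finally show "Poly_Mapping.lookup (\<Sum>m\<in>?S. fock_charge m v) b = Poly_Mapping.lookup v b" .
    qed
    finally show "v = (\<Sum>m. fock_charge m v)" by simp
  qed
  have energy: "\<exists>N::int. \<forall>ws. (\<forall>g\<in>set ws. deg g \<ge> 0) \<and> (\<Sum>g\<leftarrow>ws. deg g) > N
      \<longrightarrow> word fock ws v = 0" for v
  proof -
    define N where "N = (\<Sum>b\<in>Poly_Mapping.keys v. energy (snd b))"
    have pos: "energy p \<ge> 0" for p by (induction p) (auto simp: energy_def)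
    have "energy (snd b) + (\<Sum>g\<leftarrow>ws. deg g) \<le> N"
      if "\<forall>g\<in>set ws. deg g \<ge> 0" "Poly_Mapping.lookup (word fock ws v) b \<noteq> 0" for ws b
      using that
    proof (induction ws arbitrary: b)
      case Nil
      then have "b \<in> Poly_Mapping.keys v" by (simp add: word_def in_keys_iff)
      then show ?case unfolding N_def
        using member_le_sum[of b "Poly_Mapping.keys v" "\<lambda>b. energy (snd b)"] pos by simp
    next
      case (Cons g ws)
      obtain m p where b: "b = (m, p)" by (cases b)
      have g: "deg g \<ge> 0" using Cons.prems by simp
      have nz: "fock_act_fun g (Poly_Mapping.lookup (word fock ws v)) (m, p) \<noteq> 0"
        using Cons.prems by (simp add: word_def fock_def lk b)
      show ?case
      proof (cases "g = A 0")
        case True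
        then have "Poly_Mapping.lookup (word fock ws v) (m, p) \<noteq> 0" using nz by (simp add: fock_act_fun_def)
        from Cons.IH[OF _ this] Cons.prems True show ?thesis by (simp add: b)
      next
        case False
        then have "Poly_Mapping.lookup (word fock ws v) (m, add_mset (conj_mode g) p) \<noteq> 0"
          using nz g by (auto simp: fock_act_fun_def)
        from Cons.IH[OF _ this] Cons.prems have
          "energy (add_mset (conj_mode g) p) + (\<Sum>g\<leftarrow>ws. deg g) \<le> N" by simp
        moreover have "energy (add_mset (conj_mode g) p) = deg g + energy p"
          using g by (cases g) (auto simp: energy_def)
        ultimately show ?thesis by (simp add: b)
      qed
    qed
    then have "Poly_Mapping.lookup (word fock ws v) b = 0"
      if "\<forall>g\<in>set ws. deg g \<ge> 0" "(\<Sum>g\<leftarrow>ws. deg g) > N" for ws b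
      using that pos[of "snd b"] by fastforce
    then have "word fock ws v = 0"
      if "\<forall>g\<in>set ws. deg g \<ge> 0" "(\<Sum>g\<leftarrow>ws. deg g) > N" for ws
      using that by (auto intro!: poly_mapping_eqI)
    then show ?thesis by blast
  qed
  show ?thesis
  proof (rule heisenberg_module.intro)
    show "vector_space (smul fock)" using vs by (simp add: fock_def)
    show "Vector_Spaces.linear (smul fock) (smul fock) (act fock g)" for g
      using lin_act by (simp add: fock_def)
    show "Vector_Spaces.linear (smul fock) (smul fock) (expQ fock k)" for k
      using lin_expQ by (simp add: fock_def)
    show "\<exists>N::int. \<forall>ws. (\<forall>g\<in>set ws. deg g \<ge> 0) \<and> (\<Sum>g\<leftarrow>ws. deg g) > N
      \<longrightarrow> word fock ws v = 0" for v by (rule energy)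
    show "\<exists>f. finite {m. f m \<noteq> 0} \<and>
      (\<forall>m::int. act fock (A 0) (f m) = smul fock (of_int m) (f m)) \<and> v = (\<Sum>m. f m)" for v
      using charge by (simp add: fock_def)
    show "expQ fock 0 v = v" for v by (rule poly_mapping_eqI) (simp add: fock_def lk)
    show "expQ fock (k + l) v = expQ fock k (expQ fock l v)" for k l v
      by (rule poly_mapping_eqI) (simp add: fock_def lk algebra_simps)
  qed (use comm[of "A _" "A _"] comm[of "At _" "At _"] comm[of "A _" "At _"] cA cAt
        in \<open>auto simp: fock_def eq_neg_iff_add_eq_0 add.commute\<close>)
qed

end

theory Submission
  imports Defs
begin

text \<open>
  The theorem is an instance of bosonization. At order \<open>\<hbar>\<^sup>2\<close> the two terms of \<open>\<T>\<close> without
  factor \<open>z\<^sup>2\<close> have exponents without constant term, so that they are quadratic in the currents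
  \<open>\<phi>'\<close> and its analogue with a tilde, and the two others reduce to \<open>e\<^bsup>\<plusminus>2\<phi>\<^esup>\<close>. On the other side, the fermion bilinears
  are found by splitting vertex operators into creation and annihilation parts: moving the latter to the right
  yields \<open>e\<^bsup>k\<phi>(z)\<^esup>e\<^bsup>l\<phi>(w)\<^esup> = (z - w)\<^bsup>kl\<^esup> :e\<^bsup>k\<phi>(z) + l\<phi>(w)\<^esup>:\<close> for
  \<open>kl = \<plusminus>1\<close>. For \<open>kl = -1\<close>, a bilinear at \<open>z = w\<close> is then a polynomial moment, in the power of
  \<open>z\<close>, of \<open>:e\<^bsup>\<phi>(z) - \<phi>(w)\<^esup>:\<close>, and Euler's identity expresses these moments by the currents.
\<close>

text \<open>The sums defining the fields are finite only on each single vector, and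
  \<open>Sum_any\<close> returns 0 on an infinite support. Every interchange of sums therefore needs
  a joint bound on the support; the bounds on modes descend from \<open>bounded_energy\<close>.
  Moreover z to the power k a_0 is one monomial only on eigenvectors of a_0, so products are
  computed there and extended by linearity. For kl = -1 the factor 1/(z - w) is an infinite
  geometric series, and a single product at w = z has no meaning. Two combinations stay finite: the
  difference of the two orders of the charges, which is what the product of \<open>psit\<close> and
  \<open>psi\<close> contains, and the sum of both orders after fermionic normal ordering, where a
  fixed cut-off is subtracted from each tail. On the side of the expansion, second order
  coefficients of the two neutral exponents enter only through their sum, which factors into two
  series divisible by the parameter; first orders then suffice. The prefactors of the terms with z^2
  already have order two, so these terms contribute their leading vertex operators only.\<close>

section \<open>Sums of finite support\<close>

text \<open>Finiteness is part of the relation because an equation about \<open>Sum_any\<close>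
  alone could hold by the default value 0 and would not be additive.\<close>

definition has_fsum :: "('b \<Rightarrow> 'a::comm_monoid_add) \<Rightarrow> 'a \<Rightarrow> bool" where
  "has_fsum f s \<longleftrightarrow> finite {x. f x \<noteq> 0} \<and> Sum_any (\<lambda>x. f x) = s"

lemma has_fsumI: "finite S \<Longrightarrow> (\<And>x. x \<notin> S \<Longrightarrow> f x = 0) \<Longrightarrow> sum f S = s \<Longrightarrow> has_fsum f s"
  unfolding has_fsum_def
  by (metis (mono_tags, lifting) Sum_any.expand_superset mem_Collect_eq rev_finite_subset subsetI)

lemma has_fsum_Sum_any: "has_fsum f s \<Longrightarrow> Sum_any (\<lambda>x. f x) = s"
  by (simp add: has_fsum_def)

lemma has_fsum_unique: "has_fsum f s \<Longrightarrow> has_fsum f t \<Longrightarrow> s = t"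
  by (simp add: has_fsum_def)

lemma has_fsumE:
  assumes "has_fsum f s"
  obtains S where "finite S" "\<And>x. x \<notin> S \<Longrightarrow> f x = 0" "sum f S = s"
proof
  show "finite {x. f x \<noteq> 0}" "\<And>x. x \<notin> {x. f x \<noteq> 0} \<Longrightarrow> f x = 0" "sum f {x. f x \<noteq> 0} = s"
    using assms by (auto simp: has_fsum_def Sum_any.expand_set)
qed

lemma has_fsum_superset:
  assumes "has_fsum f s" "finite S" "\<And>x. x \<notin> S \<Longrightarrow> f x = 0"
  shows "sum f S = s"
  by (rule has_fsum_unique[OF has_fsumI[OF assms(2,3) refl] assms(1)])

lemma has_fsum_cong: "has_fsum f s \<Longrightarrow> (\<And>x. f x = g x) \<Longrightarrow> s = t \<Longrightarrow> has_fsum g t"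
  using ext[of f g] by simp

lemma has_fsum_0: "has_fsum (\<lambda>x. 0) 0"
  by (simp add: has_fsum_def)

lemma has_fsum_add:
  assumes "has_fsum f s" "has_fsum g t" shows "has_fsum (\<lambda>x. f x + g x) (s + t)"
  using assms unfolding has_fsum_def
  by (auto simp: Sum_any.distrib intro: rev_finite_subset[of "{x. f x \<noteq> 0} \<union> {x. g x \<noteq> 0}"])

lemma has_fsum_sum:
  assumes "\<And>a. a \<in> S \<Longrightarrow> has_fsum (f a) (s a)"
  shows "has_fsum (\<lambda>x. \<Sum>a\<in>S. f a x) (\<Sum>a\<in>S. s a)"
  using assms by (induction S rule: infinite_finite_induct) (simp_all add: has_fsum_0 has_fsum_add)

lemma has_fsum_single: "(\<And>x. x \<noteq> a \<Longrightarrow> f x = 0) \<Longrightarrow> f a = s \<Longrightarrow> has_fsum f s"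
  by (rule has_fsumI[of "{a}"]) auto

lemma has_fsum_reindex:
  assumes "has_fsum f s" and "bij g"
  shows "has_fsum (\<lambda>x. f (g x)) s"
proof -
  have "{x. f (g x) \<noteq> 0} = g -` {x. f x \<noteq> 0}" by auto
  moreover have "finite (g -` {x. f x \<noteq> 0})"
    using assms by (intro finite_vimageI) (auto simp: has_fsum_def bij_is_inj)
  moreover have "Sum_any f = Sum_any (\<lambda>x. f (g x))"
    by (rule Sum_any.reindex_cong[OF assms(2)]) (simp add: o_def)
  ultimately show ?thesis using assms(1) by (simp add: has_fsum_def)
qed

lemma has_fsum_shift:
  fixes f :: "int \<Rightarrow> 'a::comm_monoid_add"
  assumes "has_fsum f s" shows "has_fsum (\<lambda>x. f (x + c)) s"
  by (rule has_fsum_reindex[OF assms]) (rule o_bij[of "\<lambda>x. x - c"]; auto)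

lemma has_fsum_reflect:
  fixes f :: "int \<Rightarrow> 'a::comm_monoid_add"
  assumes "has_fsum f s" shows "has_fsum (\<lambda>x. f (c - x)) s"
  by (rule has_fsum_reindex[OF assms]) (rule o_bij[of "\<lambda>x. c - x"]; auto)

text \<open>Fubini in the direction from the joint sum to the iterated one: a finite joint support
  lies in a finite rectangle.\<close>

lemma has_fsum_Pair:
  assumes "has_fsum (\<lambda>(x, y). f x y) s" and "\<And>x. has_fsum (f x) (g x)"
  shows "has_fsum g s"
proof -
  obtain S where S: "finite S" "\<And>p. p \<notin> S \<Longrightarrow> (case p of (x, y) \<Rightarrow> f x y) = 0"
    "(\<Sum>(x, y)\<in>S. f x y) = s"
    by (rule has_fsumE[OF assms(1)]) blast
  let ?B = "fst ` S \<times> snd ` S"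
  have sub: "S \<subseteq> ?B" by force
  have fin: "finite (fst ` S)" "finite (snd ` S)" using S(1) by auto
  have z: "f x y = 0" if "x \<notin> fst ` S \<or> y \<notin> snd ` S" for x y
    using S(2)[of "(x, y)"] that by force
  have g: "g x = (\<Sum>y\<in>snd ` S. f x y)" for x
    using has_fsum_superset[OF assms(2) fin(2), of x] z by simp
  show ?thesis
  proof (rule has_fsumI[OF fin(1)])
    show "g x = 0" if "x \<notin> fst ` S" for x using g z that by simp
    have "(\<Sum>x\<in>fst ` S. g x) = (\<Sum>(x, y)\<in>?B. f x y)" by (simp add: g sum.cartesian_product)
    also have "\<dots> = (\<Sum>(x, y)\<in>S. f x y)"
      using fin sub S(2) by (intro sum.mono_neutral_right) auto
    finally show "(\<Sum>x\<in>fst ` S. g x) = s" using S(3) by simp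
  qed
qed

lemma has_fsum_Pair_swap:
  assumes "has_fsum (\<lambda>(x, y). f x y) s"
  shows "has_fsum (\<lambda>(y, x). f x y) s"
  using has_fsum_reindex[OF assms, of prod.swap] by (simp add: case_prod_unfold)

text \<open>Joint finiteness is essential: the array with 1 at (x, x) and -1 at (x, x + 1) for x >=
  0 has all row sums 0, but a column sum 1 at y = 0.\<close>

lemma has_fsum_swap:
  assumes "finite {(x, y). f x y \<noteq> 0}"
    and "\<And>x. has_fsum (f x) (g x)" and "has_fsum g s" and "\<And>y. has_fsum (\<lambda>x. f x y) (h y)"
  shows "has_fsum h s"
proof -
  have "finite {p. (case p of (x, y) \<Rightarrow> f x y) \<noteq> 0}"
    using assms(1) by (simp add: case_prod_unfold)
  then have t: "has_fsum (\<lambda>(x, y). f x y) (Sum_any (\<lambda>(x, y). f x y))" (is "has_fsum _ ?t")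
    by (simp add: has_fsum_def)
  have "has_fsum g ?t" by (rule has_fsum_Pair[OF t assms(2)])
  then have "?t = s" using assms(3) by (rule has_fsum_unique)
  moreover have "has_fsum h ?t"
    by (rule has_fsum_Pair[OF has_fsum_Pair_swap[OF t] assms(4)])
  ultimately show ?thesis by simp
qed

section \<open>Linear operators and words of modes\<close>

context heisenberg_module
begin

sublocale vs: vector_space "smul M"
  by (rule vector_space)

abbreviation scl (infixr "\<cdot>" 75) where "c \<cdot> v \<equiv> smul M c v"

definition linop :: "('v \<Rightarrow> 'v) \<Rightarrow> bool" where
  "linop f \<longleftrightarrow> (\<forall>u v. f (u + v) = f u + f v) \<and> (\<forall>c v. f (c \<cdot> v) = c \<cdot> f v)"

lemma linop_add: "linop f \<Longrightarrow> f (u + v) = f u + f v"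
  and linop_scale: "linop f \<Longrightarrow> f (c \<cdot> v) = c \<cdot> f v"
  by (auto simp: linop_def)

lemma linop_0: "linop f \<Longrightarrow> f 0 = 0"
  using linop_scale[of f 0 0] by simp

lemma linop_minus: "linop f \<Longrightarrow> f (- v) = - f v"
  using linop_scale[of f "-1" v] by simp

lemma linop_diff: "linop f \<Longrightarrow> f (u - v) = f u - f v"
  using linop_add[of f u "- v"] linop_minus[of f v] by simp

lemma linop_sum: "linop f \<Longrightarrow> f (\<Sum>a\<in>S. g a) = (\<Sum>a\<in>S. f (g a))"
  by (induction S rule: infinite_finite_induct) (auto simp: linop_0 linop_add)

lemma linop_has_fsum: "linop f \<Longrightarrow> has_fsum g s \<Longrightarrow> has_fsum (\<lambda>x. f (g x)) (f s)"
  by (erule has_fsumE, rule has_fsumI) (auto simp: linop_0 linop_sum[symmetric])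

lemma linop_act: "linop (act M g)" and linop_expQ: "linop (expQ M k)"
  using linear_act linear_expQ unfolding linop_def Vector_Spaces.linear_iff by auto

lemma linop_id: "linop (\<lambda>v. v)" and linop_zero: "linop (\<lambda>v. 0)"
  by (auto simp: linop_def)

lemma linop_comp: "linop f \<Longrightarrow> linop g \<Longrightarrow> linop (\<lambda>v. f (g v))"
  by (simp add: linop_def)

lemma linop_plus: "linop f \<Longrightarrow> linop g \<Longrightarrow> linop (\<lambda>v. f v + g v)"
  by (simp add: linop_def vs.scale_right_distrib)

lemma linop_smul: "linop f \<Longrightarrow> linop (\<lambda>v. c \<cdot> f v)"
  by (simp add: linop_def vs.scale_right_distrib mult.commute)

lemma linop_uminus: "linop f \<Longrightarrow> linop (\<lambda>v. - f v)"
  by (simp add: linop_def)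

lemma linop_Sum: "(\<And>a. a \<in> S \<Longrightarrow> linop (f a)) \<Longrightarrow> linop (\<lambda>v. \<Sum>a\<in>S. f a v)"
  by (induction S rule: infinite_finite_induct) (auto intro: linop_zero linop_plus)

lemma linop_if: "linop f \<Longrightarrow> linop g \<Longrightarrow> linop (\<lambda>v. if P then f v else g v)"
  by (cases P) simp_all

lemma linop_Sum_any:
  assumes "\<And>a. linop (f a)" and fin: "\<And>v. finite {a. f a v \<noteq> 0}"
  shows "linop (\<lambda>v. \<Sum>a. f a v)"
proof -
  have "has_fsum (\<lambda>a. f a v) (Sum_any (\<lambda>a. f a v))" for v using fin by (simp add: has_fsum_def)
  note fs = this
  have "Sum_any (\<lambda>a. f a (u + v)) = Sum_any (\<lambda>a. f a u) + Sum_any (\<lambda>a. f a v)" for u v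
    by (rule has_fsum_Sum_any, rule has_fsum_cong[OF has_fsum_add[OF fs[of u] fs[of v]]])
      (auto simp: linop_add assms(1))
  moreover have "Sum_any (\<lambda>a. f a (c \<cdot> v)) = c \<cdot> Sum_any (\<lambda>a. f a v)" for c v
    by (rule has_fsum_Sum_any, rule has_fsum_cong[OF linop_has_fsum[OF linop_smul[OF linop_id] fs[of v]]])
      (auto simp: linop_scale assms(1))
  ultimately show ?thesis by (simp add: linop_def)
qed

lemma smul_has_fsum: "has_fsum f s \<Longrightarrow> has_fsum (\<lambda>x. c \<cdot> f x) (c \<cdot> s)"
  by (rule linop_has_fsum[OF linop_smul[OF linop_id]])

lemma linop_word: "linop (word M ws)"
  by (induction ws) (auto simp: word_def linop_def linop_add[OF linop_act] linop_scale[OF linop_act])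

lemmas linop_intros = linop_act linop_expQ linop_word linop_id linop_zero linop_plus linop_smul
  linop_uminus linop_Sum linop_if

lemma word_Nil: "word M [] v = v" and word_Cons: "word M (g # ws) v = act M g (word M ws v)"
  by (auto simp: word_def)

lemma word_append: "word M (us @ ws) v = word M us (word M ws v)"
  by (induction us) (simp_all add: word_Nil word_Cons)

lemma word_commute:
  assumes "\<And>g v. g \<in> set ws \<Longrightarrow> f (act M g v) = act M g (f v)"
  shows "f (word M ws v) = word M ws (f v)"
  using assms by (induction ws) (auto simp: word_Nil word_Cons)

text \<open>Two modes fail to commute only if they are of the same kind and have opposite nonzero
  degrees; the alternatives in the hypothesis are the negation of this.\<close>

lemma act_commute:
  assumes "deg g + deg h \<noteq> 0 \<or> deg g = 0 \<or> (\<forall>n m. (g, h) \<noteq> (A n, A m) \<and> (g, h) \<noteq> (At n, At m))"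
  shows "act M g (act M h v) = act M h (act M g v)"
  using assms comm_A_A[of "deg g" "deg h" v] comm_At_At[of "deg g" "deg h" v]
    comm_A_At[of "deg g" "deg h" v] comm_A_At[of "deg h" "deg g" v]
  by (cases g; cases h) (auto split: if_splits)

lemma act_A_A: "act M (A n) (act M (A m) v)
    = act M (A m) (act M (A n) v) + (if n + m = 0 then of_int n \<cdot> v else 0)"
  using comm_A_A[of n m v] by (simp add: algebra_simps)

lemma act_expQ: "act M (A n) (expQ M k v)
    = expQ M k (act M (A n) v) + (if n = 0 then of_int k \<cdot> expQ M k v else 0)"
  using comm_A_expQ[of n k v] by (simp add: algebra_simps)

section \<open>Charge\<close>

definition charge :: "int \<Rightarrow> 'v \<Rightarrow> bool" where
  "charge m v \<longleftrightarrow> act M (A 0) v = of_int m \<cdot> v"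

lemma charge_expQ: "charge m v \<Longrightarrow> charge (m + k) (expQ M k v)"
  by (simp add: charge_def act_expQ linop_scale[OF linop_expQ] vs.scale_left_distrib)

lemma charge_commute:
  "linop f \<Longrightarrow> act M (A 0) (f v) = f (act M (A 0) v) \<Longrightarrow> charge m v \<Longrightarrow> charge m (f v)"
  by (simp add: charge_def linop_scale)

lemma charge_act: "charge m v \<Longrightarrow> charge m (act M g v)"
  by (rule charge_commute) (auto intro: linop_act act_commute)

lemma charge_word: "charge m v \<Longrightarrow> charge m (word M ws v)"
  by (induction ws) (auto simp: word_Nil word_Cons charge_act)

text \<open>By \<open>integral_charge\<close> every vector is a finite sum of eigenvectors of a_0.
  This is how identities proved for a fixed charge reach all vectors.\<close>

lemma charge_induct [case_names zero charge add]:
  assumes "P 0" "\<And>m v. charge m v \<Longrightarrow> P v" "\<And>u v. P u \<Longrightarrow> P v \<Longrightarrow> P (u + v)"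
  shows "P v"
proof -
  obtain f where f: "finite {m. f m \<noteq> 0}" "\<And>m. charge m (f m)" "v = Sum_any (\<lambda>m. f m)"
    using integral_charge[of v] unfolding charge_def by blast
  have "P (\<Sum>m\<in>S. f m)" for S
    by (induction S rule: infinite_finite_induct) (auto intro: assms f(2))
  then show ?thesis unfolding f(3) Sum_any.expand_set by blast
qed

lemma charge_independent:
  assumes "finite S" "\<And>m. charge m (f m)" "(\<Sum>m\<in>S. f m) = 0" "m \<in> S"
  shows "f m = 0"
  using assms
proof (induction S arbitrary: f m rule: finite_induct)
  case (insert a S)
  have a: "f a = - (\<Sum>m\<in>S. f m)" using insert.prems insert.hyps by (simp add: eq_neg_iff_add_eq_0)
  \<comment> \<open>Applying a_0 - a to the relation removes the vector with index a and multiplies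
    the others by nonzero scalars, leaving a shorter relation.\<close>
  define g where "g m = (of_int m - of_int a) \<cdot> f m" for m
  have "(\<Sum>m\<in>S. g m) = (\<Sum>m\<in>S. act M (A 0) (f m)) - of_int a \<cdot> (\<Sum>m\<in>S. f m)"
    using insert.prems(1) unfolding charge_def g_def
    by (simp add: vs.scale_left_diff_distrib sum_subtractf vs.scale_sum_right)
  also have "\<dots> = - (act M (A 0) (f a)) + of_int a \<cdot> f a"
    by (simp add: a linop_minus[OF linop_act] linop_sum[OF linop_act])
  also have "\<dots> = 0" using insert.prems(1)[of a] by (simp add: charge_def)
  finally have "(\<Sum>m\<in>S. g m) = 0" .
  moreover have "charge m (g m)" for m
    unfolding g_def by (rule charge_commute[OF linop_smul[OF linop_id] _ insert.prems(1)])
      (simp add: linop_scale[OF linop_act])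
  ultimately have "g m = 0" if "m \<in> S" for m using insert.IH[of g] that by blast
  then have S: "f m = 0" if "m \<in> S" for m using that insert.hyps unfolding g_def by auto
  with a insert.prems(3) show ?case by auto
qed auto

text \<open>Independence of eigenvectors makes the decomposition unique, so the definite description
  in \<open>charge_part\<close> can be evaluated on any decomposition at hand.\<close>

lemma charge_part_eqI:
  assumes "has_fsum f v" "\<And>m. charge m (f m)"
  shows "charge_part M m v = f m"
  unfolding charge_part_def charge_def[symmetric]
proof (rule the_equality)
  show "\<exists>f'. finite {n. f' n \<noteq> 0} \<and> (\<forall>n. charge n (f' n)) \<and> v = Sum_any f' \<and> f m = f' m"
    by (rule exI[of _ f]) (use assms in \<open>simp add: has_fsum_def\<close>)
  fix u assume "\<exists>f. finite {n. f n \<noteq> 0} \<and> (\<forall>n. charge n (f n)) \<and> v = Sum_any f \<and> u = f m"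
  then obtain g where "finite {n. g n \<noteq> 0} \<and> (\<forall>n. charge n (g n)) \<and> v = Sum_any g \<and> u = g m" ..
  then have g: "has_fsum g v" "\<And>n. charge n (g n)" "u = g m"
    by (metis has_fsum_def)+
  let ?S = "insert m ({n. f n \<noteq> 0} \<union> {n. g n \<noteq> 0})"
  have S: "finite ?S" using assms(1) g(1) by (simp add: has_fsum_def)
  have "(\<Sum>n\<in>?S. f n) = v" by (rule has_fsum_superset[OF assms(1) S]) simp
  moreover have "(\<Sum>n\<in>?S. g n) = v" by (rule has_fsum_superset[OF g(1) S]) simp
  ultimately have z: "(\<Sum>n\<in>?S. f n - g n) = 0" by (simp only: sum_subtractf) simp
  have c: "charge n (f n - g n)" for n
    using assms(2)[of n] g(2)[of n]
    by (simp only: charge_def linop_diff[OF linop_act] vs.scale_right_diff_distrib)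
  have "f m - g m = 0"
    by (rule charge_independent[OF S c z]) simp
  then show "u = f m" using g(3) by simp
qed

lemma charge_0: "charge m 0"
  by (simp add: charge_def linop_0[OF linop_act])

lemma charge_part_charge:
  assumes "charge m v" shows "charge_part M n v = (if n = m then v else 0)"
proof (rule charge_part_eqI)
  show "has_fsum (\<lambda>k. if k = m then v else 0) v" by (rule has_fsum_single[of m]) auto
  show "\<And>k. charge k (if k = m then v else 0)" using assms charge_0 by auto
qed

lemma has_fsum_charge_part: "has_fsum (\<lambda>m. charge_part M m v) v"
  and linop_charge_part: "linop (charge_part M m)"
proof -
  have "\<forall>v. \<exists>f. (\<forall>m. charge m (f m)) \<and> has_fsum f v"
    using integral_charge unfolding charge_def has_fsum_def by metis
  from choice[OF this] obtain f where f: "\<And>m. charge m (f v m)" and fs: "has_fsum (f v) v" for v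
    by blast
  have cp: "charge_part M m v = f v m" for m v by (rule charge_part_eqI[OF fs f])
  show "has_fsum (\<lambda>m. charge_part M m v) v" unfolding cp by (rule fs)
  have "charge_part M m (u + v) = f u m + f v m" for u v
    using f[of _ u] f[of _ v] by (intro charge_part_eqI[OF has_fsum_add[OF fs fs]])
      (simp add: charge_def linop_add[OF linop_act] vs.scale_right_distrib)
  moreover have "charge_part M m (c \<cdot> v) = c \<cdot> f v m" for c v
    using f[of _ v] by (intro charge_part_eqI[OF smul_has_fsum[OF fs]])
      (simp add: charge_def linop_scale[OF linop_act] mult.commute)
  ultimately show "linop (charge_part M m)" by (simp add: linop_def cp)
qed

lemma zpow_charge:
  assumes "charge m v" shows "zpow M k j v = (if k * m = j then v else 0)"
  unfolding zpow_def charge_part_charge[OF assms]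
  by (rule has_fsum_Sum_any, rule has_fsum_single[of m]) auto

lemma zpow_0: "zpow M 0 j v = (if j = 0 then v else 0)"
  using has_fsum_Sum_any[OF has_fsum_charge_part] by (auto simp: zpow_def)

lemma linop_zpow: "linop (zpow M k j)"
proof -
  have "finite {m. (if k * m = j then charge_part M m v else 0) \<noteq> 0}" for v
    by (rule rev_finite_subset[of "{m. charge_part M m v \<noteq> 0}"])
      (use has_fsum_charge_part in \<open>auto simp: has_fsum_def\<close>)
  then show ?thesis unfolding zpow_def[abs_def]
    by (intro linop_Sum_any linop_if linop_charge_part linop_zero)
qed

end

section \<open>Creation and annihilation parts of a vertex operator\<close>

definition cphi :: "int \<Rightarrow> mode \<Rightarrow> complex" where
  "cphi k g = fps_nth (snd (phi_exponent k) g) 0"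

text \<open>The first formula includes n = 0: division by zero yields 0, the coefficient prescribed
  for the zero mode.\<close>

lemma cphi_simps [simp]: "cphi k (A n) = - of_int k / of_int n" "cphi k (At n) = 0"
  by (simp_all add: cphi_def phi_exponent_def)

definition wt :: "int \<Rightarrow> mode list \<Rightarrow> complex" where
  "wt k ws = (\<Prod>g\<leftarrow>ws. cphi k g) / fact (length ws)"

definition letter :: "int \<Rightarrow> mode \<Rightarrow> bool" where
  "letter s g \<longleftrightarrow> (\<exists>n. g = A n \<and> s * n > 0)"

text \<open>The index \<open>i\<close> is the absolute value of the degree for either sign
  \<open>s\<close>, so creation and annihilation words share one theory. Negative \<open>i\<close>
  gives the empty set, which later lets sums run over all integers.\<close>

definition awords :: "int \<Rightarrow> int \<Rightarrow> mode list set" where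
  "awords s i = {ws. (\<forall>g\<in>set ws. letter s g) \<and> (\<Sum>g\<leftarrow>ws. deg g) = s * i}"

lemma letter_deg: "letter s g \<Longrightarrow> s * deg g > 0"
  by (auto simp: letter_def)

lemma letters_length:
  "\<forall>g\<in>set ws. letter s g \<Longrightarrow> int (length ws) \<le> s * (\<Sum>g\<leftarrow>ws. deg g)"
proof (induction ws)
  case (Cons g ws)
  then show ?case using letter_deg[of s g] by (simp add: distrib_left)
qed simp

lemma letters_deg:
  "\<forall>g\<in>set ws. letter s g \<Longrightarrow> g \<in> set ws \<Longrightarrow> s * deg g \<le> s * (\<Sum>g\<leftarrow>ws. deg g)"
proof (induction ws)
  case (Cons h ws)
  then show ?case using letter_deg[of s h] letters_length[of ws s]
    by (auto simp: distrib_left)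
qed simp

lemma mset_rotate: "mset (rotate t ws) = mset ws"
  by (metis append_take_drop_id mset_append rotate_drop_take union_commute)

context
  fixes s :: int
  assumes s: "\<bar>s\<bar> = 1"
begin

lemma sign_square: "s * s = 1" "s * (s * n) = n" for n :: int
  using s by (auto simp: abs_if split: if_splits)

lemma finite_awords: "finite (awords s i)"
proof -
  have "awords s i \<subseteq> {ws. set ws \<subseteq> A ` {-\<bar>i\<bar>..\<bar>i\<bar>} \<and> length ws \<le> nat i}"
  proof
    fix ws assume ws: "ws \<in> awords s i"
    then have "int (length ws) \<le> i"
      using letters_length[of ws s] by (simp add: awords_def sign_square)
    moreover have "g \<in> A ` {-\<bar>i\<bar>..\<bar>i\<bar>}" if g: "g \<in> set ws" for g
    proof -
      obtain n where n: "g = A n" "s * n > 0"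
        using ws g unfolding awords_def letter_def by blast
      have "s * n \<le> i" using letters_deg[of ws s g] ws g n by (simp add: awords_def sign_square)
      then have "n \<in> {-\<bar>i\<bar>..\<bar>i\<bar>}" using n(2) s by (auto simp: abs_if split: if_splits)
      then show ?thesis using n(1) by blast
    qed
    ultimately show "ws \<in> {ws. set ws \<subseteq> A ` {-\<bar>i\<bar>..\<bar>i\<bar>} \<and> length ws \<le> nat i}" by auto
  qed
  then show ?thesis by (rule finite_subset) (rule finite_lists_length_le, simp)
qed

lemma awords_neg: "i < 0 \<Longrightarrow> awords s i = {}"
  using letters_length by (fastforce simp: awords_def sign_square)

lemma awords_0: "awords s 0 = {[]}"
proof -
  have "ws = []" if "ws \<in> awords s 0" for ws
    using that letters_length[of ws s] by (simp add: awords_def)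
  then show ?thesis by (auto simp: awords_def)
qed

lemma rotate_awords: "rotate t ws \<in> awords s i \<longleftrightarrow> ws \<in> awords s i"
proof -
  have "(\<Sum>g\<leftarrow>rotate t ws. deg g) = (\<Sum>g\<leftarrow>ws. deg g)"
    by (metis mset_map mset_rotate sum_mset_sum_list)
  then show ?thesis by (simp add: awords_def)
qed

lemma awords_Cons:
  "A (s * n) # ws \<in> awords s i \<longleftrightarrow> n > 0 \<and> ws \<in> awords s (i - n)"
  by (auto simp: awords_def letter_def algebra_simps sign_square)

lemma awords_cases:
  assumes "ws \<in> awords s i" "ws \<noteq> []"
  obtains n us where "n \<in> {1..i}" "us \<in> awords s (i - n)" "ws = A (s * n) # us"
proof -
  obtain g us where gs: "ws = g # us" using assms by (cases ws) auto
  then obtain m where m: "g = A m" "s * m > 0"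
    using assms(1) by (auto simp: awords_def letter_def)
  have "g = A (s * (s * m))" using m by (simp add: sign_square)
  then have *: "s * m > 0" "us \<in> awords s (i - s * m)" "ws = A (s * (s * m)) # us"
    using gs assms(1) m(2) awords_Cons[of "s * m" us i] by auto
  moreover have "i - s * m \<ge> 0" using *(2) awords_neg[of "i - s * m"] by (cases "i - s * m < 0") auto
  ultimately show ?thesis using that[of "s * m" us] by auto
qed

lemma sum_awords_Cons:
  assumes "i \<noteq> 0"
  shows "(\<Sum>ws\<in>awords s i. f ws)
    = (\<Sum>n\<in>{1..i}. \<Sum>us\<in>awords s (i - n). f (A (s * n) # us) :: 'a::comm_monoid_add)"
proof -
  have "(\<Sum>ws\<in>awords s i. f ws)
      = (\<Sum>(n, us)\<in>Sigma {1..i} (\<lambda>n. awords s (i - n)). f (A (s * n) # us))"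
  proof (rule sum.reindex_bij_witness[where i = "\<lambda>(n, us). A (s * n) # us"
      and j = "\<lambda>ws. (s * deg (hd ws), tl ws)"])
    fix ws assume ws: "ws \<in> awords s i"
    have "ws \<noteq> []" using ws assms s by (auto simp: awords_def)
    then obtain n us where *: "n \<in> {1..i}" "us \<in> awords s (i - n)" "ws = A (s * n) # us"
      using awords_cases ws by blast
    then show "(case (s * deg (hd ws), tl ws) of (n, us) \<Rightarrow> A (s * n) # us) = ws"
      "(s * deg (hd ws), tl ws) \<in> Sigma {1..i} (\<lambda>n. awords s (i - n))"
      "(case (s * deg (hd ws), tl ws) of (n, us) \<Rightarrow> f (A (s * n) # us)) = f ws"
      by (auto simp: sign_square)
  next
    fix p assume "p \<in> Sigma {1..i} (\<lambda>n. awords s (i - n))"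
    then show "(s * deg (hd (case p of (n, us) \<Rightarrow> A (s * n) # us)), tl (case p of (n, us) \<Rightarrow> A (s * n) # us)) = p"
      "(case p of (n, us) \<Rightarrow> A (s * n) # us) \<in> awords s i"
      by (auto simp: sign_square awords_Cons)
  qed
  then show ?thesis by (simp add: sum.Sigma finite_awords)
qed

end

lemma wt_Nil: "wt k [] = 1"
  by (simp add: wt_def)

lemma wt_Cons: "of_nat (Suc (length ws)) * wt k (g # ws) = cphi k g * wt k ws"
proof -
  have "of_nat (Suc (length ws)) \<noteq> (0::complex)" by (simp only: of_nat_neq_0 not_False_eq_True)
  then show ?thesis by (simp add: wt_def)
qed

lemma wt_rotate: "wt k (rotate t ws) = wt k ws"
proof -
  have "prod_list (map (cphi k) (rotate t ws)) = prod_list (map (cphi k) ws)"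
    by (metis mset_map mset_rotate prod_mset_prod_list)
  then show ?thesis by (simp add: wt_def)
qed

context heisenberg_module
begin

text \<open>
  The coefficient of \<open>z\<^bsup>-si\<^esup>\<close> in the exponential of the part of \<open>k \<phi>(z)\<close> whose modes have
  the sign \<open>s\<close>: creation operators for \<open>s = -1\<close>, annihilation operators for \<open>s = 1\<close>.
\<close>

definition osc :: "int \<Rightarrow> int \<Rightarrow> int \<Rightarrow> 'v \<Rightarrow> 'v" where
  "osc s k i v = (\<Sum>ws\<in>awords s i. wt k ws \<cdot> word M ws v)"

lemma linop_osc: "linop (osc s k i)"
  unfolding osc_def[abs_def] by (intro linop_intros)

lemma osc_commute:
  assumes "linop f" "\<And>n v. s * n > 0 \<Longrightarrow> f (act M (A n) v) = act M (A n) (f v)"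
  shows "f (osc s k i v) = osc s k i (f v)"
proof -
  have "f (word M ws v) = word M ws (f v)" if "ws \<in> awords s i" for ws
    using that assms(2) by (intro word_commute) (auto simp: awords_def letter_def)
  then show ?thesis
    by (simp add: osc_def linop_sum[OF assms(1)] linop_scale[OF assms(1)])
qed

lemma osc_At: "act M (At n) (osc s k i v) = osc s k i (act M (At n) v)"
  by (rule osc_commute[OF linop_act]) (simp add: comm_A_At)

lemma osc_A: "s * n \<ge> 0 \<Longrightarrow> act M (A n) (osc s k i v) = osc s k i (act M (A n) v)"
proof (rule osc_commute[OF linop_act], rule act_commute)
  fix m assume "0 \<le> s * n" "0 < s * m"
  then have "0 < s * (n + m)" by (simp add: distrib_left)
  then show "deg (A n) + deg (A m) \<noteq> 0 \<or> deg (A n) = 0 \<or>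
     (\<forall>na ma. (A n, A m) \<noteq> (A na, A ma) \<and> (A n, A m) \<noteq> (At na, At ma))" by auto
qed

lemma osc_expQ: "expQ M l (osc s k i v) = osc s k i (expQ M l v)"
  by (rule osc_commute[OF linop_expQ]) (auto simp: act_expQ)

lemma osc_osc: "osc s k i (osc s l j v) = osc s l j (osc s k i v)"
  by (rule osc_commute[OF linop_osc, of s]) (auto simp: osc_A)

lemma charge_osc: "charge m v \<Longrightarrow> charge m (osc s k i v)"
  by (rule charge_commute[OF linop_osc]) (simp_all add: osc_A)

context
  fixes s :: int
  assumes s: "\<bar>s\<bar> = 1"
begin

lemma osc_neg: "i < 0 \<Longrightarrow> osc s k i v = 0"
  by (simp add: osc_def awords_neg[OF s])

lemma osc_0: "osc s k 0 v = v"
  by (simp add: osc_def awords_0[OF s] wt_Nil word_Nil)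

lemma word_rotate:
  assumes "ws \<in> awords s i" shows "word M (rotate t ws) v = word M ws v"
proof -
  let ?n = "t mod length ws"
  have "act M g (act M h v) = act M h (act M g v)" if "g \<in> set ws" "h \<in> set ws" for g h v
  proof (rule act_commute)
    have "letter s g" "letter s h" using that assms by (auto simp: awords_def)
    then obtain n m where nm: "g = A n" "s * n > 0" "h = A m" "s * m > 0"
      unfolding letter_def by blast
    then have "0 < s * (n + m)" by (simp add: distrib_left)
    with nm show "deg g + deg h \<noteq> 0 \<or> deg g = 0 \<or>
      (\<forall>n m. (g, h) \<noteq> (A n, A m) \<and> (g, h) \<noteq> (At n, At m))" by auto
  qed
  then have c: "act M g (word M us v) = word M us (act M g v)"
    if "g \<in> set ws" "set us \<subseteq> set ws" for g us v
    using that by (intro word_commute) auto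
  have "word M (drop ?n ws) (word M (take ?n ws) v) = word M (take ?n ws) (word M (drop ?n ws) v)"
    by (rule word_commute) (auto intro!: c[symmetric] dest: in_set_takeD in_set_dropD)
  then show ?thesis
    by (metis append_take_drop_id rotate_drop_take word_append)
qed

text \<open>Since a word may be rotated, its degree can be counted at its first letter.\<close>

lemma osc_Euler:
  "of_int (s * i) \<cdot> osc s k i v
    = - of_int k \<cdot> (\<Sum>n\<in>{1..i}. act M (A (s * n)) (osc s k (i - n) v))"
proof (cases "i = 0")
  case False
  let ?W = "awords s i"
  define F where "F ws = wt k ws \<cdot> word M ws v" for ws
  have F: "F (rotate t ws) = F ws" if "ws \<in> ?W" for t ws
    using that by (simp add: F_def wt_rotate word_rotate)
  note rot = rotate_awords[OF s]
  have "of_int (s * i) \<cdot> osc s k i v = (\<Sum>ws\<in>?W. of_int (\<Sum>g\<leftarrow>ws. deg g) \<cdot> F ws)"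
    unfolding osc_def vs.scale_sum_right F_def by (rule sum.cong) (auto simp: awords_def)
  also have "\<dots> = (\<Sum>ws\<in>?W. \<Sum>t\<in>{..<length ws}. of_int (deg (ws ! t)) \<cdot> F ws)"
    by (rule sum.cong) (auto simp: sum_list_sum_nth vs.scale_sum_left lessThan_atLeast0)
  also have "\<dots> = (\<Sum>(ws, t)\<in>Sigma ?W (\<lambda>ws. {..<length ws}). of_int (deg (ws ! t)) \<cdot> F ws)"
    by (simp add: sum.Sigma finite_awords[OF s])
  \<comment> \<open>Rotation by \<open>t\<close> brings the marked letter to the front and preserves
    weight, operator and degree; rotation by the complementary amount undoes it.\<close>
  also have "\<dots> = (\<Sum>(ws, t)\<in>Sigma ?W (\<lambda>ws. {..<length ws}). of_int (deg (hd ws)) \<cdot> F ws)"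
  proof (rule sum.reindex_bij_witness[where i = "\<lambda>(ws, t). (rotate (length ws - t) ws, t)"
      and j = "\<lambda>(ws, t). (rotate t ws, t)"])
    fix p assume "p \<in> Sigma ?W (\<lambda>ws. {..<length ws})"
    then obtain ws t where p: "p = (ws, t)" "ws \<in> ?W" "t < length ws" by auto
    then show "(case case p of (ws, t) \<Rightarrow> (rotate t ws, t) of (ws, t) \<Rightarrow> (rotate (length ws - t) ws, t)) = p"
      "(case case p of (ws, t) \<Rightarrow> (rotate (length ws - t) ws, t) of (ws, t) \<Rightarrow> (rotate t ws, t)) = p"
      by (auto simp: rotate_rotate)
    show "(case p of (ws, t) \<Rightarrow> (rotate t ws, t)) \<in> Sigma ?W (\<lambda>ws. {..<length ws})"
      "(case p of (ws, t) \<Rightarrow> (rotate (length ws - t) ws, t)) \<in> Sigma ?W (\<lambda>ws. {..<length ws})"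
      using p rot by auto
    have "hd (rotate t ws) = ws ! t"
      using p(3) hd_rotate_conv_nth[of ws t] by (cases "ws = []") auto
    then show "(case case p of (ws, t) \<Rightarrow> (rotate t ws, t) of (ws, t) \<Rightarrow> of_int (deg (hd ws)) \<cdot> F ws)
        = (case p of (ws, t) \<Rightarrow> of_int (deg (ws ! t)) \<cdot> F ws)"
      using p F by simp
  qed
  also have "\<dots> = (\<Sum>ws\<in>?W. \<Sum>t\<in>{..<length ws}. of_int (deg (hd ws)) \<cdot> F ws)"
    by (simp add: sum.Sigma finite_awords[OF s])
  also have "\<dots> = (\<Sum>ws\<in>?W. of_nat (length ws) \<cdot> (of_int (deg (hd ws)) \<cdot> F ws))"
    by (simp add: vs.scale_sum_left[symmetric] sum_constant_scale vs.sum_constant_scale)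
  \<comment> \<open>A word of nonzero degree is not empty, so it splits into its first letter and a
    rest; the factor \<open>length ws\<close> is what \<open>wt_Cons\<close> absorbs.\<close>
  also have "\<dots> = (\<Sum>n\<in>{1..i}. \<Sum>us\<in>awords s (i - n).
      of_nat (Suc (length us)) \<cdot> (of_int (s * n) \<cdot> F (A (s * n) # us)))"
    by (simp add: sum_awords_Cons[OF s False])
  also have "\<dots> = (\<Sum>n\<in>{1..i}. \<Sum>us\<in>awords s (i - n).
      - of_int k \<cdot> (act M (A (s * n)) (wt k us \<cdot> word M us v)))"
  proof (intro sum.cong refl)
    fix n us assume n: "n \<in> {1..i}"
    have "of_int (s * n) \<noteq> (0::complex)" using n s by auto
    \<comment> \<open>The degree \<open>s * n\<close> cancels the denominator of
      \<open>cphi k (A (s * n))\<close>, which leaves the factor -k, the same for all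
      letters.\<close>
    then have "of_nat (Suc (length us)) * of_int (s * n) * wt k (A (s * n) # us) = - of_int k * wt k us"
      using wt_Cons[of us k "A (s * n)"] by (simp add: field_simps)
    then show "of_nat (Suc (length us)) \<cdot> (of_int (s * n) \<cdot> F (A (s * n) # us))
        = - of_int k \<cdot> (act M (A (s * n)) (wt k us \<cdot> word M us v))"
      unfolding F_def by (simp only: vs.scale_scale word_Cons linop_scale[OF linop_act] mult.assoc)
  qed
  finally show ?thesis
    by (simp add: osc_def linop_sum[OF linop_act] vs.scale_sum_right)
qed simp

end

end

section \<open>Exchange relations\<close>

lemma sum_triangle_swap:
  fixes f :: "int \<Rightarrow> int \<Rightarrow> 'a::comm_monoid_add"
  shows "(\<Sum>n\<in>{1..i}. \<Sum>p\<in>{0..i - n}. f n p) = (\<Sum>p\<in>{0..i}. \<Sum>n\<in>{1..i - p}. f n p)"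
proof -
  have "(\<Sum>(n, p)\<in>Sigma {1..i} (\<lambda>n. {0..i - n}). f n p) = (\<Sum>(p, n)\<in>Sigma {0..i} (\<lambda>p. {1..i - p}). f n p)"
    by (rule sum.reindex_bij_witness[where i = prod.swap and j = prod.swap]) auto
  then show ?thesis by (simp add: sum.Sigma)
qed

lemma sum_triangle_diagonal:
  fixes f :: "int \<Rightarrow> int \<Rightarrow> 'a::comm_monoid_add"
  shows "(\<Sum>n\<in>{1..i}. \<Sum>p\<in>{0..i - n}. f n p) = (\<Sum>q\<in>{0..i}. \<Sum>n\<in>{1..q}. f n (q - n))"
proof -
  have "(\<Sum>(n, p)\<in>Sigma {1..i} (\<lambda>n. {0..i - n}). f n p) = (\<Sum>(q, n)\<in>Sigma {0..i} (\<lambda>q. {1..q}). f n (q - n))"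
    by (rule sum.reindex_bij_witness[where i = "\<lambda>(q, n). (n, q - n)" and j = "\<lambda>(n, p). (n + p, n)"]) auto
  then show ?thesis by (simp add: sum.Sigma)
qed

lemma int_less_induct_ge [consumes 1, case_names step]:
  assumes "b \<le> i" and "\<And>i :: int. b \<le> i \<Longrightarrow> (\<And>j. b \<le> j \<Longrightarrow> j < i \<Longrightarrow> P j) \<Longrightarrow> P i"
  shows "P i"
  using assms(1)
proof (induction "nat (i - b)" arbitrary: i rule: less_induct)
  case less
  show ?case
  proof (rule assms(2)[OF less.prems])
    show "P j" if "b \<le> j" "j < i" for j using less.hyps[of j] that by simp
  qed
qed

context heisenberg_module
begin

text \<open>Terms with negative index vanish, so the range may be enlarged.
  \<open>act_creation\<close> applies the identity at two indices with one common range.\<close>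

lemma osc_Euler':
  assumes s: "\<bar>s\<bar> = 1" and "i \<le> N"
  shows "of_int (s * i) \<cdot> osc s k i v
    = - of_int k \<cdot> (\<Sum>n\<in>{1..N}. act M (A (s * n)) (osc s k (i - n) v))"
proof -
  have "(\<Sum>n\<in>{1..N}. act M (A (s * n)) (osc s k (i - n) v))
      = (\<Sum>n\<in>{1..i}. act M (A (s * n)) (osc s k (i - n) v))"
    using assms(2) by (intro sum.mono_neutral_right) (auto simp: osc_neg[OF s] linop_0[OF linop_act])
  then show ?thesis using osc_Euler[OF s, of i k v] by simp
qed

lemma osc_charge_0: "\<bar>s\<bar> = 1 \<Longrightarrow> osc s 0 i v = (if i = 0 then v else 0)"
  using osc_Euler[of s i 0 v] by (auto simp: osc_0)

text \<open>Exponentials of commuting modes multiply by adding exponents. Both sides obey the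
  recursion \<open>osc_Euler\<close>, which determines every coefficient of nonzero index from those
  of smaller index.\<close>

lemma osc_mult:
  assumes s: "\<bar>s\<bar> = 1"
  shows "(\<Sum>p\<in>{0..i}. osc s k p (osc s l (i - p) v)) = osc s (k + l) i v"
proof (cases "i < 0")
  case True
  then show ?thesis by (simp add: osc_neg[OF s])
next
  case False
  then have "0 \<le> i" by simp
  then show ?thesis
  proof (induction i rule: int_less_induct_ge)
    case (step i)
    show ?case
    proof (cases "i = 0")
      case False
      define a where "a n = act M (A (s * n))" for n
      have la: "linop (a n)" for n unfolding a_def by (rule linop_act)
      have aosc: "osc s k p (a n v) = a n (osc s k p v)" if "n \<ge> 1" for k p n v
        using that by (simp add: a_def osc_A sign_square[OF s])
      define S where "S = (\<Sum>n\<in>{1..i}. \<Sum>p\<in>{0..i - n}. a n (osc s k p (osc s l (i - n - p) v)))"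
      have E: "of_int (s * i) \<cdot> osc s k i v = - of_int k \<cdot> (\<Sum>n\<in>{1..i}. a n (osc s k (i - n) v))" for i k v
        unfolding a_def by (rule osc_Euler[OF s])
      \<comment> \<open>Leibniz rule: the degree i is split as p + (i - p), and Euler's identity is
        applied to each factor.\<close>
      have "of_int (s * i) \<cdot> (\<Sum>p\<in>{0..i}. osc s k p (osc s l (i - p) v))
          = (\<Sum>p\<in>{0..i}. of_int (s * p) \<cdot> osc s k p (osc s l (i - p) v))
            + (\<Sum>p\<in>{0..i}. osc s k p (of_int (s * (i - p)) \<cdot> osc s l (i - p) v))"
        unfolding linop_scale[OF linop_osc] sum.distrib[symmetric] vs.scale_left_distrib[symmetric]
          vs.scale_sum_right
        by (intro sum.cong refl arg_cong2[where f = "smul M"]) (simp add: algebra_simps)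
      also have "(\<Sum>p\<in>{0..i}. of_int (s * p) \<cdot> osc s k p (osc s l (i - p) v)) = - of_int k \<cdot> S"
        unfolding S_def sum_triangle_diagonal E by (simp add: vs.scale_sum_right sum_negf)
      also have "(\<Sum>p\<in>{0..i}. osc s k p (of_int (s * (i - p)) \<cdot> osc s l (i - p) v)) = - of_int l \<cdot> S"
        unfolding S_def sum_triangle_swap E
        by (simp add: linop_scale[OF linop_osc] linop_minus[OF linop_osc] linop_sum[OF linop_osc] aosc vs.scale_sum_right
            sum_negf algebra_simps)
      also have "S = (\<Sum>n\<in>{1..i}. a n (osc s (k + l) (i - n) v))"
        unfolding S_def by (simp add: linop_sum[OF la, symmetric] step.IH)
      also have "- of_int k \<cdot> \<dots> + - of_int l \<cdot> \<dots> = of_int (s * i) \<cdot> osc s (k + l) i v"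
        unfolding E vs.scale_left_distrib[symmetric] by simp
      finally show ?thesis using False s by (subst (asm) vs.scale_cancel_left) auto
    qed (simp add: osc_0[OF s])
  qed
qed

text \<open>The commutator with a_n is a derivation sending the creation exponent, the sum of (l/p)
  a_{-p} w^p, to the scalar l w^n; so it multiplies the exponential by l w^n. In coefficients this
  follows by induction along Euler's recursion.\<close>

lemma act_creation:
  assumes "n > 0"
  shows "act M (A n) (osc (-1) l j v) = osc (-1) l j (act M (A n) v) + of_int l \<cdot> osc (-1) l (j - n) v"
proof (cases "j < 0")
  case True
  then show ?thesis using assms by (simp add: osc_neg linop_0[OF linop_act])
next
  case False
  then have "0 \<le> j" by simp
  then show ?thesis
  proof (induction j rule: int_less_induct_ge)
    case (step j)
    show ?case
    proof (cases "j = 0")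
      case True
      then show ?thesis using assms by (simp add: osc_0 osc_neg)
    next
      case False
      have E: "of_int i \<cdot> osc (-1) l i v = of_int l \<cdot> (\<Sum>p\<in>{1..j}. act M (A (- p)) (osc (-1) l (i - p) v))"
        if "i \<le> j" for i v
        using osc_Euler'[of "-1" i j l v] that by simp
      \<comment> \<open>For n > j the index n lies outside the range, and the right side vanishes as
        well because its index is negative.\<close>
      have nj: "(\<Sum>p\<in>{1..j}. if n = p then of_int n \<cdot> osc (-1) l (j - p) v else 0) = of_int n \<cdot> osc (-1) l (j - n) v"
        using assms by (simp add: osc_neg)
      have "of_int j \<cdot> act M (A n) (osc (-1) l j v)
          = of_int l \<cdot> (\<Sum>p\<in>{1..j}. act M (A n) (act M (A (- p)) (osc (-1) l (j - p) v)))"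
        by (simp only: linop_scale[OF linop_act, symmetric] E[OF order_refl])
          (simp add: linop_scale[OF linop_act] linop_sum[OF linop_act])
      also have "\<dots> = of_int l \<cdot> (\<Sum>p\<in>{1..j}. act M (A (- p)) (osc (-1) l (j - p) (act M (A n) v))
          + of_int l \<cdot> act M (A (- p)) (osc (-1) l (j - n - p) v)
          + (if n = p then of_int n \<cdot> osc (-1) l (j - p) v else 0))"
        using step.IH by (intro arg_cong[where f = "\<lambda>x. _ \<cdot> x"] sum.cong)
          (auto simp: act_A_A[of n] linop_add[OF linop_act] linop_scale[OF linop_act] algebra_simps)
      also have "\<dots> = of_int j \<cdot> osc (-1) l j (act M (A n) v)
          + of_int l \<cdot> (of_int (j - n) \<cdot> osc (-1) l (j - n) v) + of_int l \<cdot> (of_int n \<cdot> osc (-1) l (j - n) v)"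
        using assms by (subst (1 2) E) (simp_all add: sum.distrib nj vs.scale_right_distrib vs.scale_sum_right)
      also have "\<dots> = of_int j \<cdot> (osc (-1) l j (act M (A n) v) + of_int l \<cdot> osc (-1) l (j - n) v)"
        by (simp add: vs.scale_right_distrib add.assoc vs.scale_left_distrib[symmetric] distrib_left[symmetric] mult.commute)
      finally show ?thesis using False by (subst (asm) vs.scale_cancel_left) auto
    qed
  qed
qed

text \<open>
  The recursion for \<open>c\<close> says that its generating function is \<open>(1 - t)\<close> to the power \<open>kl\<close>.
\<close>

lemma osc_exchange:
  assumes c0: "c 0 = 1"
    and c: "\<And>p. p > 0 \<Longrightarrow> of_int p * c p = - of_int (k * l) * (\<Sum>n\<in>{1..p}. c (p - n) :: complex)"
  shows "osc 1 k i (osc (-1) l j v) = (\<Sum>p\<in>{0..i}. c p \<cdot> osc (-1) l (j - p) (osc 1 k (i - p) v))"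
proof (cases "i < 0")
  case True
  then show ?thesis by (simp add: osc_neg)
next
  case False
  then have "0 \<le> i" by simp
  then show ?thesis
  proof (induction i arbitrary: j v rule: int_less_induct_ge)
    case (step i)
    show ?case
    proof (cases "i = 0")
      case True
      then show ?thesis using c0 by (simp add: osc_0)
    next
      case False
      have E: "of_int i \<cdot> osc 1 k i v = - of_int k \<cdot> (\<Sum>n\<in>{1..i}. osc 1 k (i - n) (act M (A n) v))" for i v
        using osc_Euler[of 1 i k v] by (simp add: osc_A)
      define T where "T p = osc (-1) l (j - p) (osc 1 k (i - p) v)" for p
      have "of_int i \<cdot> osc 1 k i (osc (-1) l j v)
          = - of_int k \<cdot> (\<Sum>n\<in>{1..i}. osc 1 k (i - n) (act M (A n) (osc (-1) l j v)))"
        by (rule E)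
      also have "\<dots> = - of_int k \<cdot> (\<Sum>n\<in>{1..i}. osc 1 k (i - n) (osc (-1) l j (act M (A n) v))
          + of_int l \<cdot> osc 1 k (i - n) (osc (-1) l (j - n) v))"
        by (simp add: act_creation linop_add[OF linop_osc] linop_scale[OF linop_osc])
      \<comment> \<open>The induction hypothesis applies to i - n. The second double sum depends on
        n and p through \<open>T (n + p)\<close> only; collecting its diagonals produces the sum in
        the recursion for \<open>c\<close>.\<close>
      also have "\<dots> = - of_int k \<cdot> ((\<Sum>n\<in>{1..i}. \<Sum>p\<in>{0..i - n}.
            c p \<cdot> osc (-1) l (j - p) (osc 1 k (i - n - p) (act M (A n) v)))
          + of_int l \<cdot> (\<Sum>n\<in>{1..i}. \<Sum>p\<in>{0..i - n}. c p \<cdot> T (n + p)))"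
        by (simp add: step.IH sum.distrib vs.scale_sum_right T_def algebra_simps)
      also have "(\<Sum>n\<in>{1..i}. \<Sum>p\<in>{0..i - n}. c p \<cdot> T (n + p))
          = (\<Sum>q\<in>{0..i}. (\<Sum>n\<in>{1..q}. c (q - n)) \<cdot> T q)"
        by (simp add: sum_triangle_diagonal vs.scale_sum_left)
      also have "- of_int k \<cdot> ((\<Sum>n\<in>{1..i}. \<Sum>p\<in>{0..i - n}.
            c p \<cdot> osc (-1) l (j - p) (osc 1 k (i - n - p) (act M (A n) v)))
          + of_int l \<cdot> (\<Sum>q\<in>{0..i}. (\<Sum>n\<in>{1..q}. c (q - n)) \<cdot> T q))
        = - of_int k \<cdot> (\<Sum>n\<in>{1..i}. \<Sum>p\<in>{0..i - n}.
            c p \<cdot> osc (-1) l (j - p) (osc 1 k (i - n - p) (act M (A n) v)))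
          + (\<Sum>q\<in>{0..i}. (- of_int (k * l) * (\<Sum>n\<in>{1..q}. c (q - n))) \<cdot> T q)"
        by (simp add: vs.scale_right_distrib vs.scale_sum_right sum_negf algebra_simps)
      also have "(\<Sum>q\<in>{0..i}. (- of_int (k * l) * (\<Sum>n\<in>{1..q}. c (q - n))) \<cdot> T q)
          = (\<Sum>q\<in>{0..i}. (of_int q * c q) \<cdot> T q)"
      \<comment> \<open>The recursion is assumed for positive indices; at q = 0 both sides vanish,
        the inner sum being empty.\<close>
      proof (rule sum.cong)
        show "(- of_int (k * l) * (\<Sum>n\<in>{1..q}. c (q - n))) \<cdot> T q = (of_int q * c q) \<cdot> T q"
          if "q \<in> {0..i}" for q
          using c[of q] that by (cases "q = 0") auto
      qed simp
      also have "- of_int k \<cdot> (\<Sum>n\<in>{1..i}. \<Sum>p\<in>{0..i - n}.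
            c p \<cdot> osc (-1) l (j - p) (osc 1 k (i - n - p) (act M (A n) v)))
          = (\<Sum>p\<in>{0..i}. c p \<cdot> osc (-1) l (j - p)
              (- of_int k \<cdot> (\<Sum>n\<in>{1..i - p}. osc 1 k (i - p - n) (act M (A n) v))))"
        by (simp add: sum_triangle_swap vs.scale_sum_right linop_scale[OF linop_osc] linop_minus[OF linop_osc]
            linop_sum[OF linop_osc] sum_negf algebra_simps)
      also have "\<dots> = (\<Sum>p\<in>{0..i}. (of_int (i - p) * c p) \<cdot> T p)"
        by (simp only: E[symmetric] T_def linop_scale[OF linop_osc] vs.scale_scale mult.commute)
      also have "(\<Sum>p\<in>{0..i}. (of_int (i - p) * c p) \<cdot> T p) + (\<Sum>q\<in>{0..i}. (of_int q * c q) \<cdot> T q)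
          = of_int i \<cdot> (\<Sum>p\<in>{0..i}. c p \<cdot> T p)"
        unfolding sum.distrib[symmetric] vs.scale_left_distrib[symmetric] vs.scale_sum_right vs.scale_scale
        by (intro sum.cong refl arg_cong2[where f = "smul M"]) (simp add: algebra_simps)
      finally show ?thesis
        using False unfolding T_def by (subst (asm) vs.scale_cancel_left) auto
    qed
  qed
qed

text \<open>The vanishing holds word by word, so one bound serves for all values of the charges
  \<open>k\<close> and \<open>l\<close>.\<close>

lemma osc_bounded:
  obtains N where "N \<ge> 0" "\<And>k l i j. i + j > N \<Longrightarrow> osc 1 k i (osc 1 l j v) = 0"
    "\<And>k i. i > N \<Longrightarrow> osc 1 k i v = 0"
    "\<And>ws. \<forall>g\<in>set ws. deg g \<ge> 0 \<Longrightarrow> (\<Sum>g\<leftarrow>ws. deg g) > N \<Longrightarrow> word M ws v = 0"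
proof -
  obtain N0 where N0: "\<And>ws. \<forall>g\<in>set ws. deg g \<ge> 0 \<Longrightarrow> (\<Sum>g\<leftarrow>ws. deg g) > N0 \<Longrightarrow> word M ws v = 0"
    using bounded_energy[of v] by blast
  define N where "N = max N0 0"
  have N: "N \<ge> 0" and Nw: "\<And>ws. \<forall>g\<in>set ws. deg g \<ge> 0 \<Longrightarrow> (\<Sum>g\<leftarrow>ws. deg g) > N \<Longrightarrow> word M ws v = 0"
    using N0 by (auto simp: N_def)
  have "osc 1 k i (osc 1 l j v) = 0" if "i + j > N" for k l i j
  proof -
    have "word M (us @ ws) v = 0" if "us \<in> awords 1 i" "ws \<in> awords 1 j" for us ws
      using that \<open>i + j > N\<close> by (intro Nw) (auto simp: awords_def letter_def)
    then show ?thesis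
      by (simp add: osc_def linop_sum[OF linop_word] linop_scale[OF linop_word] word_append)
  qed
  note b = this
  moreover have "osc 1 k i v = 0" if "i > N" for k i
    using b[of i 0 k 0] that by (simp add: osc_0)
  ultimately show ?thesis using that N Nw by blast
qed

section \<open>Vertex operators on vectors of fixed charge\<close>

text \<open>The second claim factors the vertex operator into creation part, \<open>expQ\<close> and
  annihilation part: words in the exponential are regrouped by their subwords of negative and
  positive modes. The shift by k m is the power of z produced by \<open>zpow\<close>. The first
  claim keeps the finiteness of the original sum, needed for linearity.\<close>

lemma exp_phi_charge:
  assumes m: "charge m v"
  shows "has_fsum (\<lambda>ws. (fps_nth (\<Prod>g\<leftarrow>ws. snd (phi_exponent k) g) 0 / fact (length ws)) \<cdot>
      nord M (expQ M k \<circ> zpow M k (j + (\<Sum>g\<leftarrow>ws. deg g))) ws v) (exp_phi M k j v)" (is "has_fsum ?F _")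
    and "has_fsum (\<lambda>i. osc (-1) k (j - k * m + i) (expQ M k (osc 1 k i v))) (exp_phi M k j v)"
proof -
  obtain N where N: "N \<ge> 0" "\<And>k i. i > N \<Longrightarrow> osc 1 k i v = 0"
    "\<And>ws. \<forall>g\<in>set ws. deg g \<ge> 0 \<Longrightarrow> (\<Sum>g\<leftarrow>ws. deg g) > N \<Longrightarrow> word M ws v = 0"
    by (rule osc_bounded[of v]) blast
  define neg where "neg = filter (\<lambda>g. deg g < 0)"
  define nng where "nng = filter (\<lambda>g. \<not> deg g < 0)"
  have F: "?F ws = (prod_list (map (cphi k) ws) / fact (length ws)) \<cdot>
      (if k * m = j + (\<Sum>g\<leftarrow>ws. deg g) then word M (neg ws) (expQ M k (word M (nng ws) v)) else 0)" for ws
  proof -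
    have "fps_nth (\<Prod>g\<leftarrow>ws. snd (phi_exponent k) g) 0 = prod_list (map (cphi k) ws)"
      by (induction ws) (auto simp: cphi_def)
    then show ?thesis
      by (simp add: nord_def neg_def nng_def zpow_charge[OF charge_word[OF m]] not_less
          linop_0[OF linop_expQ] linop_0[OF linop_word])
  qed
  \<comment> \<open>The annihilation word \<open>w\<close> contributes z^(-i) and
    \<open>zpow\<close> contributes z^(k m), so the creation word \<open>u\<close> must supply the
    power j - k m + i.\<close>
  let ?P = "Sigma {0..N} (\<lambda>i. awords 1 i \<times> awords (-1) (j - k * m + i))"
  let ?sh = "\<lambda>(i, w, u). shuffles u w"
  have finP: "finite ?P" by (auto simp: finite_awords)
  have nl: "\<And>g. letter (-1) g \<Longrightarrow> deg g < 0" "\<And>g. letter 1 g \<Longrightarrow> \<not> deg g < 0"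
    by (auto simp: letter_def)
  have sh: "neg ws = u" "nng ws = w" "k * m = j + (\<Sum>g\<leftarrow>ws. deg g)" "length ws = length u + length w"
    "prod_list (map (cphi k) ws) = prod_list (map (cphi k) u) * prod_list (map (cphi k) w)"
    if "(i, w, u) \<in> ?P" "ws \<in> shuffles u w" for i w u ws
  proof -
    have neg: "deg g < 0" if "g \<in> set u" for g using that \<open>(i, w, u) \<in> ?P\<close> nl(1) by (auto simp: awords_def)
    have nng: "\<not> deg g < 0" if "g \<in> set w" for g using that \<open>(i, w, u) \<in> ?P\<close> nl(2) by (auto simp: awords_def)
    have "neg ws \<in> shuffles (neg u) (neg w)" "nng ws \<in> shuffles (nng u) (nng w)"
      using that(2) filter_shuffles unfolding neg_def nng_def by blast+
    moreover have "neg u = u" "neg w = []" "nng u = []" "nng w = w"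
      using neg nng by (auto simp: neg_def nng_def filter_empty_conv filter_id_conv)
    ultimately show "neg ws = u" "nng ws = w" by auto
    have ms: "mset ws = mset u + mset w" by (rule mset_shuffles[OF that(2)])
    have "(\<Sum>g\<leftarrow>ws. deg g) = (\<Sum>g\<leftarrow>u. deg g) + (\<Sum>g\<leftarrow>w. deg g)"
      unfolding sum_mset_sum_list[symmetric] mset_map ms by simp
    then show "k * m = j + (\<Sum>g\<leftarrow>ws. deg g)" using that(1) by (auto simp: awords_def)
    show "length ws = length u + length w" by (rule length_shuffles[OF that(2)])
    show "prod_list (map (cphi k) ws) = prod_list (map (cphi k) u) * prod_list (map (cphi k) w)"
      unfolding prod_mset_prod_list[symmetric] mset_map ms by simp
  qed
  let ?S = "\<Union>p\<in>?P. ?sh p"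
  have finS: "finite ?S" using finP by auto
  have supp: "ws \<in> ?S" if "?F ws \<noteq> 0" for ws
  proof -
    have "prod_list (map (cphi k) ws) \<noteq> 0" "k * m = j + (\<Sum>g\<leftarrow>ws. deg g)" "word M (nng ws) v \<noteq> 0"
      using that unfolding F by (auto simp: linop_0[OF linop_expQ] linop_0[OF linop_word] split: if_splits)
    note nz = this
    \<comment> \<open>\<open>cphi k\<close> vanishes on tilde modes and on \<open>A 0\<close>, so
      these never occur in a contributing word.\<close>
    have "\<exists>n. g = A n \<and> n \<noteq> 0" if "g \<in> set ws" for g
    proof -
      have "cphi k g \<noteq> 0" using nz(1) that by (auto simp: prod_list_zero_iff image_iff)
      then show ?thesis by (cases g) auto
    qed
    then have letters: "letter (-1) g \<or> letter 1 g" if "g \<in> set ws" for g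
      using that unfolding letter_def by fastforce
    define i where "i = (\<Sum>g\<leftarrow>nng ws. deg g)"
    have w: "nng ws \<in> awords 1 i"
      using letters nl unfolding nng_def awords_def i_def by auto
    have "i \<le> N" using N(3)[of "nng ws"] nz(3) unfolding i_def nng_def by (force simp: not_less)
    moreover have "i \<ge> 0" unfolding i_def nng_def by (rule sum_list_nonneg) auto
    moreover have "(\<Sum>g\<leftarrow>ws. deg g) = (\<Sum>g\<leftarrow>neg ws. deg g) + i"
      unfolding i_def neg_def nng_def by (induction ws) auto
    then have "neg ws \<in> awords (-1) (j - k * m + i)"
      using letters nl nz(2) unfolding neg_def awords_def by auto
    moreover have "ws \<in> shuffles (neg ws) (nng ws)"
      unfolding neg_def nng_def by (rule partition_in_shuffles)
    ultimately show ?thesis using w by (intro UN_I[of "(i, nng ws, neg ws)"]) auto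
  qed
  have "sum ?F ?S = (\<Sum>p\<in>?P. sum ?F (?sh p))"
  proof (rule sum.UNION_disjoint[OF finP])
    show "\<forall>p\<in>?P. finite (?sh p)" by auto
    show "\<forall>p\<in>?P. \<forall>p'\<in>?P. p \<noteq> p' \<longrightarrow> ?sh p \<inter> ?sh p' = {}"
    proof (intro ballI impI, rule ccontr)
      fix p p' assume *: "p \<in> ?P" "p' \<in> ?P" "p \<noteq> p'" "?sh p \<inter> ?sh p' \<noteq> {}"
      obtain i w u i' w' u' where p: "p = (i, w, u)" "p' = (i', w', u')" by (cases p; cases p') auto
      obtain ws where "ws \<in> shuffles u w" "ws \<in> shuffles u' w'" using * p by auto
      then have "u = u'" "w = w'" using sh(1,2)[of i w u ws] sh(1,2)[of i' w' u' ws] *(1,2)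
        unfolding p by simp_all
      moreover have "i = i'" using *(1,2) \<open>w = w'\<close> unfolding p by (auto simp: awords_def)
      ultimately show False using *(3) p by simp
    qed
  qed
  also have "\<dots> = (\<Sum>(i, w, u)\<in>?P. (wt k u * wt k w) \<cdot> word M u (expQ M k (word M w v)))"
  proof (rule sum.cong)
    fix p assume p: "p \<in> ?P"
    obtain i w u where pe: "p = (i, w, u)" by (cases p) auto
    let ?X = "word M u (expQ M k (word M w v))"
    let ?c = "prod_list (map (cphi k) u) * prod_list (map (cphi k) w)"
    \<comment> \<open>As \<open>u\<close> and \<open>w\<close> share no letter, the number of
      shuffles is a binomial coefficient; it turns the factorial of the total length into the
      product of the two factorials.\<close>
    have disj: "set u \<inter> set w = {}" using p nl unfolding pe by (fastforce simp: awords_def)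
    have "sum ?F (shuffles u w) = (\<Sum>ws\<in>shuffles u w. (?c / fact (length u + length w)) \<cdot> ?X)"
      using sh[of i w u] p unfolding pe F by (intro sum.cong) simp_all
    also have "\<dots> = (of_nat (card (shuffles u w)) * (?c / fact (length u + length w))) \<cdot> ?X"
      by (simp add: vs.sum_constant_scale)
    also have "of_nat (card (shuffles u w)) * (?c / fact (length u + length w)) = wt k u * wt k w"
      by (simp add: card_disjoint_shuffles[OF disj] wt_def binomial_fact)
    finally show "sum ?F (?sh p) = (case p of (i, w, u) \<Rightarrow> (wt k u * wt k w) \<cdot> word M u (expQ M k (word M w v)))"
      unfolding pe prod.case .
  qed simp
  also have "\<dots> = (\<Sum>i\<in>{0..N}. \<Sum>w\<in>awords 1 i. \<Sum>u\<in>awords (-1) (j - k * m + i).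
      (wt k u * wt k w) \<cdot> word M u (expQ M k (word M w v)))"
    by (simp add: sum.Sigma finite_awords)
  also have "\<dots> = (\<Sum>i\<in>{0..N}. osc (-1) k (j - k * m + i) (expQ M k (osc 1 k i v)))"
  proof (rule sum.cong)
    show "(\<Sum>w\<in>awords 1 i. \<Sum>u\<in>awords (-1) (j - k * m + i).
          (wt k u * wt k w) \<cdot> word M u (expQ M k (word M w v)))
        = osc (-1) k (j - k * m + i) (expQ M k (osc 1 k i v))" for i
      by (subst sum.swap) (simp add: osc_def linop_sum[OF linop_expQ] linop_sum[OF linop_word]
        linop_scale[OF linop_expQ] linop_scale[OF linop_word] vs.scale_sum_right)
  qed simp
  finally have eq: "sum ?F ?S = \<dots>" .
  have F: "has_fsum ?F (sum ?F ?S)" by (rule has_fsumI[OF finS]) (use supp in blast, simp)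
  then have Fe: "sum ?F ?S = exp_phi M k j v"
    unfolding exp_phi_def nexp_def has_fsum_def by (simp add: phi_exponent_def)
  then show "has_fsum ?F (exp_phi M k j v)" using F by simp
  show "has_fsum (\<lambda>i. osc (-1) k (j - k * m + i) (expQ M k (osc 1 k i v))) (exp_phi M k j v)"
  proof (rule has_fsumI[of "{0..N}"])
    show "osc (-1) k (j - k * m + i) (expQ M k (osc 1 k i v)) = 0" if "i \<notin> {0..N}" for i
      using that N by (cases "i < 0") (auto simp: osc_neg linop_0[OF linop_expQ] linop_0[OF linop_osc])
  qed (use eq Fe in simp_all)
qed

end

text \<open>Converse of \<open>has_fsum_Pair\<close>: an iterated sum is the joint sum once the
  joint support is known to be finite.\<close>

lemma has_fsum_PairI:
  assumes "finite {(x, y). f x y \<noteq> 0}" "\<And>x. has_fsum (f x) (g x)" "has_fsum g s"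
  shows "has_fsum (\<lambda>(x, y). f x y) s"
proof -
  have "finite {p. (case p of (x, y) \<Rightarrow> f x y) \<noteq> 0}"
    using assms(1) by (simp add: case_prod_unfold)
  then have t: "has_fsum (\<lambda>(x, y). f x y) (Sum_any (\<lambda>(x, y). f x y))" (is "has_fsum _ ?t")
    by (simp add: has_fsum_def)
  have "has_fsum g ?t" by (rule has_fsum_Pair[OF t assms(2)])
  then have "?t = s" using assms(3) by (rule has_fsum_unique)
  with t show ?thesis by simp
qed

context heisenberg_module
begin

lemma finite_support_add:
  assumes "\<And>a. linop (f a)" "finite {a. f a u \<noteq> 0}" "finite {a. f a v \<noteq> 0}"
  shows "finite {a. f a (u + v) \<noteq> 0}"
  by (rule rev_finite_subset[OF finite_UnI[OF assms(2,3)]]) (auto simp: linop_add[OF assms(1)])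

text \<open>A \<open>Sum_any\<close> of linear terms is linear if its support is finite on every
  vector. This is known on eigenvectors of a_0 and passes to sums of vectors.\<close>

lemma linop_exp_phi: "linop (exp_phi M k j)"
proof -
  let ?F = "\<lambda>ws v. (fps_nth (\<Prod>g\<leftarrow>ws. snd (phi_exponent k) g) 0 / fact (length ws)) \<cdot>
      nord M (expQ M k \<circ> zpow M k (j + (\<Sum>g\<leftarrow>ws. deg g))) ws v"
  have lin: "linop (?F ws)" for ws
    unfolding nord_def o_def by (intro linop_smul linop_comp[OF linop_word] linop_comp[OF linop_expQ]
      linop_comp[OF linop_zpow] linop_word)
  have fin: "finite {ws. ?F ws v \<noteq> 0}" for v
  proof (induction v rule: charge_induct)
    case zero
    show ?case by (simp only: linop_0[OF lin]) simp
  next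
    case (charge m v)
    from exp_phi_charge(1)[OF this, of k j] show ?case unfolding has_fsum_def by (rule conjunct1)
  next
    case (add u v)
    show ?case by (rule finite_support_add[where f = ?F, OF lin add])
  qed
  have eq: "exp_phi M k j = (\<lambda>v. Sum_any (\<lambda>ws. ?F ws v))"
    by (simp add: fun_eq_iff exp_phi_def nexp_def phi_exponent_def)
  show "linop (exp_phi M k j)" unfolding eq using lin fin by (rule linop_Sum_any)
qed

lemma charge_exp_phi:
  assumes "charge m v" shows "charge (m + k) (exp_phi M k j v)"
proof -
  obtain S where S: "(\<Sum>i\<in>S. osc (-1) k (j - k * m + i) (expQ M k (osc 1 k i v))) = exp_phi M k j v"
    by (rule has_fsumE[OF exp_phi_charge(2)[OF assms]])
  have c: "charge (m + k) (\<Sum>i\<in>S. f i)" if "\<And>i. charge (m + k) (f i)" for S :: "int set" and f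
    using that by (induction S rule: infinite_finite_induct)
      (auto simp: charge_0, auto simp: charge_def linop_add[OF linop_act] vs.scale_right_distrib)
  show ?thesis unfolding S[symmetric] by (rule c) (intro charge_osc charge_expQ assms)
qed

lemma exp_phi_At: "act M (At n) (exp_phi M k j v) = exp_phi M k j (act M (At n) v)"
proof (induction v rule: charge_induct)
  case zero
  show ?case by (simp add: linop_0[OF linop_exp_phi] linop_0[OF linop_act])
next
  case (charge m v)
  have "has_fsum (\<lambda>i. act M (At n) (osc (-1) k (j - k * m + i) (expQ M k (osc 1 k i v))))
      (act M (At n) (exp_phi M k j v))"
    by (rule linop_has_fsum[OF linop_act exp_phi_charge(2)[OF charge]])
  then have "has_fsum (\<lambda>i. osc (-1) k (j - k * m + i) (expQ M k (osc 1 k i (act M (At n) v))))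
      (act M (At n) (exp_phi M k j v))"
    by (simp add: osc_At comm_At_expQ)
  then show ?case
    using exp_phi_charge(2)[OF charge_act[OF charge]] has_fsum_unique by blast
next
  case (add u v)
  then show ?case by (simp add: linop_add[OF linop_exp_phi] linop_add[OF linop_act])
qed

lemma exp_phi_0:
  assumes "charge m v" shows "exp_phi M 0 j v = (if j = 0 then v else 0)"
proof -
  have "has_fsum (\<lambda>i. osc (-1) 0 (j - 0 * m + i) (expQ M 0 (osc 1 0 i v))) (if j = 0 then v else 0)"
    by (rule has_fsum_single[of 0]) (auto simp: osc_charge_0 expQ_0 linop_0[OF linop_osc])
  then show ?thesis by (rule has_fsum_unique[OF exp_phi_charge(2)[OF assms]])
qed

section \<open>Normally ordered products of two vertex operators\<close>

text \<open>
  On vectors of charge \<open>m\<close>, \<open>pair_op k l m a b\<close> is the coefficient of \<open>z\<^sup>a w\<^sup>b\<close> in the normally ordered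
  exponential of \<open>k \<phi>(z) + l \<phi>(w)\<close>.
\<close>

definition pair_term :: "int \<Rightarrow> int \<Rightarrow> int \<Rightarrow> int \<Rightarrow> 'v \<Rightarrow> int \<times> int \<Rightarrow> 'v" where
  "pair_term k l a b v = (\<lambda>(i, j).
     osc (-1) k (a + i) (osc (-1) l (b + j) (expQ M (k + l) (osc 1 k i (osc 1 l j v)))))"

definition pair_op :: "int \<Rightarrow> int \<Rightarrow> int \<Rightarrow> int \<Rightarrow> int \<Rightarrow> 'v \<Rightarrow> 'v" where
  "pair_op k l m a b v = Sum_any (pair_term k l (a - k * m) (b - l * m) v)"

lemmas linop_zeros = linop_0[OF linop_osc] linop_0[OF linop_expQ] linop_0[OF linop_act]

text \<open>The third claim uses the same \<open>N\<close> for all n >= 0: a_n commutes with the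
  annihilation parts and kills \<open>v\<close> for n > N. Euler's identity sums over n and needs
  this uniformity.\<close>

lemma pair_term_bounded:
  obtains N where "N \<ge> 0"
    "\<And>k l a b i j. pair_term k l a b v (i, j) \<noteq> 0 \<Longrightarrow> 0 \<le> i \<and> i \<le> N \<and> 0 \<le> j \<and> j \<le> N \<and> 0 \<le> a + i \<and> 0 \<le> b + j"
    "\<And>n k l a b i j. n \<ge> 0 \<Longrightarrow> pair_term k l a b (act M (A n) v) (i, j) \<noteq> 0 \<Longrightarrow>
      0 \<le> i \<and> i \<le> N \<and> 0 \<le> j \<and> j \<le> N \<and> 0 \<le> a + i \<and> 0 \<le> b + j \<and> n \<le> N"
proof -
  obtain N where N: "N \<ge> 0" "\<And>k l i j. i + j > N \<Longrightarrow> osc 1 k i (osc 1 l j v) = 0"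
    "\<And>ws. \<forall>g\<in>set ws. deg g \<ge> 0 \<Longrightarrow> (\<Sum>g\<leftarrow>ws. deg g) > N \<Longrightarrow> word M ws v = 0"
    by (rule osc_bounded[of v]) blast
  have "0 \<le> i \<and> i \<le> N \<and> 0 \<le> j \<and> j \<le> N \<and> 0 \<le> a + i \<and> 0 \<le> b + j"
    if nz: "pair_term k l a b w (i, j) \<noteq> 0"
      and w: "\<And>k l i j. i + j > N \<Longrightarrow> osc 1 k i (osc 1 l j w) = 0" for k l a b w i j
  proof -
    have "\<not> i + j > N" "\<not> i < 0" "\<not> j < 0" "\<not> a + i < 0" "\<not> b + j < 0"
      using nz w[of i j k l] by (auto simp: pair_term_def osc_neg linop_zeros)
    then show ?thesis by auto
  qed
  note * = this
  have "osc 1 k i (osc 1 l j (act M (A n) v)) = 0" if "i + j > N" "n \<ge> 0" for n k l i j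
    using N(2)[OF that(1), of k l] that(2) by (simp add: osc_A[symmetric] linop_zeros)
  note c = this
  have "act M (A n) v = 0" if "n > N" for n
    using N(3)[of "[A n]"] that N(1) by (simp add: word_Cons word_Nil)
  then have d: "n \<le> N" if "pair_term k l a b (act M (A n) v) (i, j) \<noteq> 0" for n k l a b i j
    using that by (rule_tac ccontr) (auto simp: pair_term_def linop_zeros)
  show ?thesis
  proof (rule that[OF N(1)])
    show "0 \<le> i \<and> i \<le> N \<and> 0 \<le> j \<and> j \<le> N \<and> 0 \<le> a + i \<and> 0 \<le> b + j"
      if "pair_term k l a b v (i, j) \<noteq> 0" for k l a b i j
      by (rule *[OF that N(2)])
    show "0 \<le> i \<and> i \<le> N \<and> 0 \<le> j \<and> j \<le> N \<and> 0 \<le> a + i \<and> 0 \<le> b + j \<and> n \<le> N"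
      if "n \<ge> 0" "pair_term k l a b (act M (A n) v) (i, j) \<noteq> 0" for n k l a b i j
      using *[OF that(2) c[OF _ that(1)]] d[OF that(2)] by blast
  qed
qed

lemma has_fsum_pair_op:
  "has_fsum (pair_term k l (a - k * m) (b - l * m) v) (pair_op k l m a b v)"
proof -
  obtain N where N: "\<And>k l a b i j. pair_term k l a b v (i, j) \<noteq> 0 \<Longrightarrow> 0 \<le> i \<and> i \<le> N \<and> 0 \<le> j \<and> j \<le> N"
    by (rule pair_term_bounded[of v]) blast
  have "{p. pair_term k l (a - k * m) (b - l * m) v p \<noteq> 0} \<subseteq> {0..N} \<times> {0..N}"
  proof
    fix p assume p: "p \<in> {p. pair_term k l (a - k * m) (b - l * m) v p \<noteq> 0}"
    obtain i j where ij: "p = (i, j)" by (cases p)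
    show "p \<in> {0..N} \<times> {0..N}" using N[of k l _ _ i j] p unfolding ij by simp
  qed
  then have "finite {p. pair_term k l (a - k * m) (b - l * m) v p \<noteq> 0}"
    by (rule finite_subset) simp
  then show ?thesis by (simp add: has_fsum_def pair_op_def)
qed

text \<open>Creation parts commute with each other, and so do annihilation parts: a normally ordered
  product is symmetric in its factors.\<close>

lemma pair_op_swap: "pair_op k l m a b v = pair_op l k m b a v"
proof -
  have "pair_term k l a b v (prod.swap p) = pair_term l k b a v p" for a b p
    by (cases p) (simp add: pair_term_def osc_osc[of _ k] add.commute)
  then have "has_fsum (pair_term l k (b - l * m) (a - k * m) v) (pair_op k l m a b v)"
    using has_fsum_reindex[OF has_fsum_pair_op[of k l a m b v], of prod.swap] by (simp add: bij_swap)
  then show ?thesis using has_fsum_pair_op has_fsum_unique by blast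
qed

lemma pair_op_bounded:
  obtains B where "\<And>a b. a < B \<or> b < B \<Longrightarrow> pair_op k l m a b v = 0"
    "\<And>n a b. n \<ge> 0 \<Longrightarrow> a < B \<or> b < B \<or> n > - B \<Longrightarrow> pair_op k l m a b (act M (A n) v) = 0"
proof -
  obtain N where N: "N \<ge> 0"
    "\<And>k l a b i j. pair_term k l a b v (i, j) \<noteq> 0 \<Longrightarrow> 0 \<le> i \<and> i \<le> N \<and> 0 \<le> j \<and> j \<le> N \<and> 0 \<le> a + i \<and> 0 \<le> b + j"
    "\<And>n k l a b i j. n \<ge> 0 \<Longrightarrow> pair_term k l a b (act M (A n) v) (i, j) \<noteq> 0 \<Longrightarrow>
      0 \<le> i \<and> i \<le> N \<and> 0 \<le> j \<and> j \<le> N \<and> 0 \<le> a + i \<and> 0 \<le> b + j \<and> n \<le> N"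
    by (rule pair_term_bounded[of v]) blast
  define B where "B = - \<bar>k * m\<bar> - \<bar>l * m\<bar> - N"
  have B: "pair_op k l m a b w = 0"
    if "\<And>i j. pair_term k l (a - k * m) (b - l * m) w (i, j) = 0" for a b w
  proof -
    have "pair_term k l (a - k * m) (b - l * m) w = (\<lambda>p. 0)" using that by auto
    then show ?thesis by (simp add: pair_op_def)
  qed
  show ?thesis
  proof
    show "pair_op k l m a b v = 0" if "a < B \<or> b < B" for a b
    proof (rule B, rule ccontr)
      fix i j assume "pair_term k l (a - k * m) (b - l * m) v (i, j) \<noteq> 0"
      from N(2)[OF this] that show False unfolding B_def by auto
    qed
    show "pair_op k l m a b (act M (A n) v) = 0" if "n \<ge> 0" "a < B \<or> b < B \<or> n > - B" for n a b
    proof (rule B, rule ccontr)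
      fix i j assume "pair_term k l (a - k * m) (b - l * m) (act M (A n) v) (i, j) \<noteq> 0"
      from N(3)[OF that(1) this] that(2) show False unfolding B_def by auto
    qed
  qed
qed

text \<open>The left factor meets charge m + l instead of m, which gives an additional z^(kl);
  \<open>osc_exchange\<close> gives (1 - w/z)^(kl). Together they are (z - w)^(kl) expanded in
  powers of w/z, with coefficients \<open>c p\<close>.\<close>

lemma exp_phi_exp_phi:
  assumes m: "charge m v" and c0: "c 0 = 1"
    and c: "\<And>p. p > 0 \<Longrightarrow> of_int p * c p = - of_int (k * l) * (\<Sum>n\<in>{1..p}. c (p - n) :: complex)"
    and cneg: "\<And>p. p < 0 \<Longrightarrow> c p = 0"
  shows "has_fsum (\<lambda>p. c p \<cdot> pair_op k l m (i - k * l + p) (j - p) v)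
    (exp_phi M k i (exp_phi M l j v))"
proof -
  define y where "y = exp_phi M l j v"
  define \<Phi> where "\<Phi> p = (\<lambda>(i', j'). c p \<cdot> pair_term k l (i - k * l + p - k * m) (j - p - l * m) v (i', j'))" for p
  obtain N where N: "N \<ge> 0" "\<And>k l a b i j. pair_term k l a b v (i, j) \<noteq> 0 \<Longrightarrow>
      0 \<le> i \<and> i \<le> N \<and> 0 \<le> j \<and> j \<le> N \<and> 0 \<le> a + i \<and> 0 \<le> b + j"
    by (rule pair_term_bounded[of v]) blast
  have \<Phi>: "p \<in> {0..j - l * m + N} \<and> i' \<in> {0..N} \<and> j' \<in> {0..N}" if "\<Phi> p (i', j') \<noteq> 0" for p i' j'
  proof -
    have "c p \<noteq> 0" "pair_term k l (i - k * l + p - k * m) (j - p - l * m) v (i', j') \<noteq> 0"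
      using that by (auto simp: \<Phi>_def)
    then have "\<not> p < 0" "0 \<le> i' \<and> i' \<le> N \<and> 0 \<le> j' \<and> j' \<le> N \<and> 0 \<le> j - p - l * m + j'"
      using cneg N(2) by blast+
    then show ?thesis by auto
  qed
  have "finite {x. (case x of (p, q) \<Rightarrow> \<Phi> p q) \<noteq> 0}"
    by (rule finite_subset[of _ "{0..j - l * m + N} \<times> {0..N} \<times> {0..N}"]) (use \<Phi> in auto)
  then have t: "has_fsum (\<lambda>(p, q). \<Phi> p q) (Sum_any (\<lambda>(p, q). \<Phi> p q))" (is "has_fsum _ ?t")
    by (simp add: has_fsum_def)
  have "has_fsum (\<Phi> p) (c p \<cdot> pair_op k l m (i - k * l + p) (j - p) v)" for p
    unfolding \<Phi>_def using smul_has_fsum[OF has_fsum_pair_op[of k l "i - k * l + p" m "j - p" v], of "c p"]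
    by (simp add: case_prod_unfold)
  then have 1: "has_fsum (\<lambda>p. c p \<cdot> pair_op k l m (i - k * l + p) (j - p) v) ?t"
    by (rule has_fsum_Pair[OF t])
  \<comment> \<open>The new \<open>i'\<close> is the annihilation degree of the left operator before
    reordering, of which \<open>p\<close> is used up in passing the creation part of the right
    one.\<close>
  let ?g = "\<lambda>(i', j', p). (p, i' - p, j') :: int \<times> int \<times> int"
  have "bij ?g" by (rule o_bij[of "\<lambda>(p, i', j'). (i' + p, j', p)"]) auto
  from has_fsum_reindex[OF t this]
  have 2: "has_fsum (\<lambda>(i', j', p). \<Phi> p (i' - p, j')) ?t"
    by (simp add: case_prod_unfold)
  define V where "V i' = osc (-1) k (i - k * (m + l) + i') (expQ M k (osc 1 k i' y))" for i'
  have "has_fsum (\<lambda>(j', p). \<Phi> p (i' - p, j')) (V i')" for i'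
  proof (rule has_fsum_PairI)
    show "finite {(j', p). \<Phi> p (i' - p, j') \<noteq> 0}"
      by (rule finite_subset[of _ "{0..N} \<times> {0..j - l * m + N}"]) (use \<Phi> in auto)
    show "has_fsum (\<lambda>p. \<Phi> p (i' - p, j')) (\<Sum>p\<in>{0..i'}. \<Phi> p (i' - p, j'))" for j'
    proof (rule has_fsumI[of "{0..i'}"])
      show "\<Phi> x (i' - x, j') = 0" if "x \<notin> {0..i'}" for x
        using \<Phi>[of x "i' - x" j'] that by auto
    qed simp_all
    have "has_fsum (\<lambda>j'. osc (-1) k (i - k * (m + l) + i') (expQ M k (osc 1 k i'
        (osc (-1) l (j - l * m + j') (expQ M l (osc 1 l j' v)))))) (V i')"
      unfolding V_def y_def
      by (rule linop_has_fsum[OF linop_comp[OF linop_osc linop_comp[OF linop_expQ linop_osc]]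
            exp_phi_charge(2)[OF m]])
    then show "has_fsum (\<lambda>j'. \<Sum>p\<in>{0..i'}. \<Phi> p (i' - p, j')) (V i')"
      by (rule has_fsum_cong)
        (simp_all add: osc_exchange[of c k l, OF c0 c] \<Phi>_def pair_term_def linop_sum[OF linop_expQ]
          linop_sum[OF linop_osc] linop_scale[OF linop_expQ] linop_scale[OF linop_osc] expQ_add osc_expQ algebra_simps)
  qed
  from has_fsum_Pair[OF 2 this] have "has_fsum V ?t" .
  moreover have "has_fsum V (exp_phi M k i y)"
    unfolding V_def y_def by (rule exp_phi_charge(2)[OF charge_exp_phi[OF m]])
  ultimately show ?thesis using 1 has_fsum_unique unfolding y_def by metis
qed

text \<open>For kl = 1 the series \<open>c\<close> is 1 - t, so the factor is the polynomial z -
  w.\<close>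

lemma exp_phi_exp_phi_same:
  assumes "charge m v" "k * l = 1"
  shows "exp_phi M k i (exp_phi M l j v) = pair_op k l m (i - 1) j v - pair_op k l m i (j - 1) v"
proof -
  define c :: "int \<Rightarrow> complex" where "c p = (if p = 0 then 1 else if p = 1 then -1 else 0)" for p
  have "of_int p * c p = - of_int (k * l) * (\<Sum>n\<in>{1..p}. c (p - n))" if "p > 0" for p
  proof (cases "p = 1")
    case False
    have "(\<Sum>n\<in>{1..p}. c (p - n)) = (\<Sum>n\<in>{p - 1, p}. c (p - n))"
      using that False by (intro sum.mono_neutral_right) (auto simp: c_def)
    then show ?thesis using False that by (simp add: c_def)
  qed (simp add: c_def assms(2))
  then have "has_fsum (\<lambda>p. c p \<cdot> pair_op k l m (i - k * l + p) (j - p) v) (exp_phi M k i (exp_phi M l j v))"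
    by (intro exp_phi_exp_phi[OF assms(1)]) (auto simp: c_def)
  then have "(\<Sum>p\<in>{0, 1}. c p \<cdot> pair_op k l m (i - k * l + p) (j - p) v) = exp_phi M k i (exp_phi M l j v)"
    by (rule has_fsum_superset) (auto simp: c_def)
  then show ?thesis by (simp add: c_def assms(2))
qed

text \<open>For kl = -1 the series \<open>c\<close> is geometric. Substituting a = i + 1 + p turns
  the product into a tail of the diagonal a + b = i + j + 1, the extra 1 coming from the
  pole.\<close>

lemma exp_phi_exp_phi_opposite:
  assumes "charge m v" "k * l = -1"
  shows "has_fsum (\<lambda>a. if a > i then pair_op k l m a (i + j + 1 - a) v else 0)
    (exp_phi M k i (exp_phi M l j v))"
proof -
  define c :: "int \<Rightarrow> complex" where "c p = (if p \<ge> 0 then 1 else 0)" for p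
  have "has_fsum (\<lambda>p. c p \<cdot> pair_op k l m (i - k * l + p) (j - p) v) (exp_phi M k i (exp_phi M l j v))"
    by (intro exp_phi_exp_phi[OF assms(1)]) (auto simp: c_def assms(2))
  from has_fsum_shift[OF this, of "- (i + 1)"] show ?thesis
    by (rule has_fsum_cong) (auto simp: c_def assms(2) algebra_simps)
qed

text \<open>At w = z the two exponents merge: \<open>osc_mult\<close> combines the creation parts
  and the annihilation parts separately.\<close>

lemma pair_op_diagonal:
  assumes m: "charge m v"
  shows "has_fsum (\<lambda>a. pair_op k l m a (K - a) v) (exp_phi M (k + l) K v)"
proof -
  define \<Phi> where "\<Phi> a q = pair_term k l (a - k * m) (K - a - l * m) v q" for a q
  obtain N where N: "N \<ge> 0" "\<And>k l a b i j. pair_term k l a b v (i, j) \<noteq> 0 \<Longrightarrow>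
      0 \<le> i \<and> i \<le> N \<and> 0 \<le> j \<and> j \<le> N \<and> 0 \<le> a + i \<and> 0 \<le> b + j"
    by (rule pair_term_bounded[of v]) blast
  have \<Phi>: "a \<in> {k * m - N..K - l * m + N} \<and> i \<in> {0..N} \<and> j \<in> {0..N}" if "\<Phi> a (i, j) \<noteq> 0" for a i j
    using N(2)[OF that[unfolded \<Phi>_def]] by auto
  have fin: "finite {(a, q). \<Phi> a q \<noteq> 0}"
    by (rule finite_subset[of _ "{k * m - N..K - l * m + N} \<times> {0..N} \<times> {0..N}"]) (use \<Phi> in auto)
  define T where "T i j = K - (k + l) * m + i + j" for i j
  define W where "W = (\<lambda>(i, j). osc (-1) (k + l) (T i j) (expQ M (k + l) (osc 1 k i (osc 1 l j v))))"
  have "has_fsum (\<lambda>a. \<Phi> a q) (W q)" for q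
  proof -
    obtain i j where q: "q = (i, j)" by (cases q)
    define w where "w = expQ M (k + l) (osc 1 k i (osc 1 l j v))"
    have "has_fsum (\<lambda>p. osc (-1) k p (osc (-1) l (T i j - p) w)) (W q)"
      by (rule has_fsumI[of "{0..T i j}"]) (auto simp: osc_neg linop_zeros osc_mult W_def w_def q)
    moreover have "a + (i - k * m) = a - k * m + i" "T i j - (a + (i - k * m)) = K - a - l * m + j" for a
      by (simp_all add: T_def algebra_simps)
    ultimately show ?thesis
      using has_fsum_shift[of "\<lambda>p. osc (-1) k p (osc (-1) l (T i j - p) w)" "W q" "i - k * m"]
      by (simp only: \<Phi>_def pair_term_def w_def q prod.case)
  qed
  note W = this
  have "has_fsum (\<lambda>(P, i). W (i, P - i)) (exp_phi M (k + l) K v)"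
  proof (rule has_fsum_PairI)
    have "W (i, j) = 0" if "i \<notin> {0..N} \<or> j \<notin> {0..N}" for i j
    proof -
      have "\<Phi> a (i, j) = 0" for a using \<Phi> that by blast
      then show ?thesis using W[of "(i, j)"] has_fsum_0 has_fsum_unique by (metis (no_types, lifting) has_fsum_cong)
    qed
    note z = this
    have "{(P, i). W (i, P - i) \<noteq> 0} \<subseteq> {0..N + N} \<times> {0..N}"
    proof
      fix x assume x: "x \<in> {(P, i). W (i, P - i) \<noteq> 0}"
      obtain P i where [simp]: "x = (P, i)" by (cases x)
      have "W (i, P - i) \<noteq> 0" using x by simp
      then have "i \<in> {0..N}" "P - i \<in> {0..N}" using z by blast+
      then show "x \<in> {0..N + N} \<times> {0..N}" by auto
    qed
    then show "finite {(P, i). W (i, P - i) \<noteq> 0}" by (rule finite_subset) simp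
    show "has_fsum (\<lambda>i. W (i, P - i)) (osc (-1) (k + l) (K - (k + l) * m + P) (expQ M (k + l) (osc 1 (k + l) P v)))" for P
    proof (rule has_fsumI[of "{0..P}"])
      show "W (i, P - i) = 0" if "i \<notin> {0..P}" for i
        using that by (auto simp: W_def osc_neg linop_zeros)
      show "(\<Sum>i\<in>{0..P}. W (i, P - i)) = osc (-1) (k + l) (K - (k + l) * m + P) (expQ M (k + l) (osc 1 (k + l) P v))"
        by (simp add: W_def T_def osc_mult[symmetric] linop_sum[OF linop_expQ] linop_sum[OF linop_osc] add.assoc)
    qed simp
    show "has_fsum (\<lambda>P. osc (-1) (k + l) (K - (k + l) * m + P) (expQ M (k + l) (osc 1 (k + l) P v))) (exp_phi M (k + l) K v)"
      by (rule exp_phi_charge(2)[OF m])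
  qed
  moreover have "bij (\<lambda>(i, j). (i + j, i :: int))"
    by (rule o_bij[of "\<lambda>(P, i). (i, P - i)"]) auto
  ultimately have "has_fsum W (exp_phi M (k + l) K v)"
    using has_fsum_reindex[of "\<lambda>(P, i). W (i, P - i)" _ "\<lambda>(i, j). (i + j, i)"] by (simp add: case_prod_unfold)
  with W have "has_fsum (\<lambda>(q, a). \<Phi> a q) (exp_phi M (k + l) K v)"
    by (intro has_fsum_PairI) (use finite_imageI[OF fin, of prod.swap] in \<open>auto simp: image_def elim!: rev_finite_subset\<close>)
  from has_fsum_Pair_swap[OF this] show ?thesis
    by (rule has_fsum_Pair) (simp add: \<Phi>_def has_fsum_pair_op)
qed

end

section \<open>Euler's identity and the moments of a pair of opposite charges\<close>

text \<open>Each indicator alone has infinite support; the difference is the signed indicator of the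
  interval between \<open>a\<close> and \<open>b\<close>, over which the sum telescopes.\<close>

lemma has_fsum_telescope:
  fixes w W :: "int \<Rightarrow> complex"
  assumes W: "\<And>i. W (i + 1) - W i = w i"
  shows "has_fsum (\<lambda>i. w i * (of_bool (i < a) - of_bool (i < b))) (W a - W b)"
proof (induction a rule: int_induct[where k = b])
  case base
  show ?case by (simp add: has_fsum_0)
next
  case (step1 a)
  have "has_fsum (\<lambda>i. if i = a then w i else 0) (w a)" by (rule has_fsum_single[of a]) auto
  from has_fsum_add[OF step1(2) this] show ?case
    by (rule has_fsum_cong) (auto simp: W[symmetric] algebra_simps)
next
  case (step2 a)
  have "has_fsum (\<lambda>i. if i = a - 1 then - w i else 0) (- w (a - 1))" by (rule has_fsum_single[of "a - 1"]) auto
  from has_fsum_add[OF step2(2) this] show ?case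
    by (rule has_fsum_cong) (auto simp: W[symmetric] algebra_simps)
qed

context heisenberg_module
begin

lemma has_fsum_scale_left:
  assumes "has_fsum f c" shows "has_fsum (\<lambda>i. f i \<cdot> v) (c \<cdot> v)"
proof -
  obtain S where S: "finite S" "\<And>x. x \<notin> S \<Longrightarrow> f x = 0" "sum f S = c"
    by (rule has_fsumE[OF assms]) blast
  show ?thesis by (rule has_fsumI[OF S(1)]) (auto simp: S vs.scale_sum_left[symmetric])
qed

lemma has_fsum_diff:
  assumes "has_fsum f s" "has_fsum g t" shows "has_fsum (\<lambda>x. f x - g x) (s - t :: 'v)"
  using has_fsum_add[OF assms(1) smul_has_fsum[OF assms(2), of "-1"]] by simp

text \<open>The operator z d/dz brings down k z \<phi>'(z), the sum of k a_n z^(-n), inside the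
  normal ordering: negative modes act last, the others first.\<close>

lemma pair_op_Euler:
  assumes m: "charge m v"
  shows "has_fsum (\<lambda>n. of_int k \<cdot> (if n < 0 then act M (A n) (pair_op k l m (a + n) b v)
      else pair_op k l m (a + n) b (act M (A n) v))) (of_int a \<cdot> pair_op k l m a b v)"
proof -
  define \<Psi> where "\<Psi> n = (if n < 0 then \<lambda>q. act M (A n) (pair_term k l (a + n - k * m) (b - l * m) v q)
      else pair_term k l (a + n - k * m) (b - l * m) (act M (A n) v))" for n
  \<comment> \<open>A mode a_n with n >= 0 takes n units of annihilation degree. After this shift
    the total degrees (i, j) are fixed while n varies, and the sum over n is an instance of
    \<open>osc_Euler\<close>.\<close>
  define sh where "sh n = (\<lambda>(i, j). (if n < 0 then i else i - n, j :: int))" for n :: int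
  have bij: "bij (sh n)" for n
    by (rule o_bij[of "\<lambda>(i, j). (if n < 0 then i else i + n, j)"]) (auto simp: sh_def)
  have rows: "has_fsum (\<lambda>q. of_int k \<cdot> \<Psi> n (sh n q)) (of_int k \<cdot> (if n < 0 then act M (A n) (pair_op k l m (a + n) b v)
      else pair_op k l m (a + n) b (act M (A n) v)))" for n
  proof -
    have "has_fsum (\<Psi> n) (if n < 0 then act M (A n) (pair_op k l m (a + n) b v)
      else pair_op k l m (a + n) b (act M (A n) v))"
      using linop_has_fsum[OF linop_act has_fsum_pair_op] has_fsum_pair_op by (simp add: \<Psi>_def)
    from smul_has_fsum[OF has_fsum_reindex[OF this bij]] show ?thesis .
  qed
  obtain N where N: "N \<ge> 0"
    "\<And>k l a b i j. pair_term k l a b v (i, j) \<noteq> 0 \<Longrightarrow> 0 \<le> i \<and> i \<le> N \<and> 0 \<le> j \<and> j \<le> N \<and> 0 \<le> a + i \<and> 0 \<le> b + j"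
    "\<And>n k l a b i j. n \<ge> 0 \<Longrightarrow> pair_term k l a b (act M (A n) v) (i, j) \<noteq> 0 \<Longrightarrow>
      0 \<le> i \<and> i \<le> N \<and> 0 \<le> j \<and> j \<le> N \<and> 0 \<le> a + i \<and> 0 \<le> b + j \<and> n \<le> N"
    by (rule pair_term_bounded[of v]) blast
  have supp: "n \<in> {k * m - a - N..N} \<and> i \<in> {0..N + N} \<and> j \<in> {0..N}" if nz: "\<Psi> n (sh n (i, j)) \<noteq> 0" for n i j
  proof (cases "n < 0")
    case True
    then have "pair_term k l (a + n - k * m) (b - l * m) v (i, j) \<noteq> 0"
      using nz by (auto simp: \<Psi>_def sh_def linop_zeros)
    from N(2)[OF this] True show ?thesis by auto
  next
    case False
    then have "pair_term k l (a + n - k * m) (b - l * m) (act M (A n) v) (i - n, j) \<noteq> 0"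
      using nz by (auto simp: \<Psi>_def sh_def)
    from N(3)[OF _ this] False show ?thesis by auto
  qed
  have fin: "finite {(q, n). of_int k \<cdot> \<Psi> n (sh n q) \<noteq> 0}"
    by (rule finite_subset[of _ "({0..N + N} \<times> {0..N}) \<times> {k * m - a - N..N}"]) (use supp in auto)
  have cols: "has_fsum (\<lambda>n. of_int k \<cdot> \<Psi> n (sh n q)) (of_int a \<cdot> pair_term k l (a - k * m) (b - l * m) v q)" for q
  proof -
    obtain i j where q: "q = (i, j)" by (cases q)
    define L where "L = a - k * m + i"
    define W where "W y = osc (-1) l (b - l * m + j) (expQ M (k + l) y)" for y
    have W: "linop W" unfolding W_def by (intro linop_comp[OF linop_osc] linop_expQ)
    define E where "E = osc 1 l j v"
    have chE: "charge m (osc 1 k i E)" unfolding E_def by (intro charge_osc m)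
    define X where "X = osc (-1) k L (W (osc 1 k i E))"
    have neg: "\<Psi> n (sh n q) = act M (A n) (osc (-1) k (L + n) (W (osc 1 k i E)))" if "n < 0" for n
      using that by (simp add: \<Psi>_def sh_def q pair_term_def L_def W_def E_def algebra_simps)
    have nng: "\<Psi> n (sh n q) = osc (-1) k L (W (act M (A n) (osc 1 k (i - n) E)))" if "n \<ge> 0" for n
    proof -
      have "a + n - k * m + (i - n) = L" by (simp add: L_def)
      then show ?thesis using that by (simp add: \<Psi>_def sh_def q pair_term_def W_def E_def osc_A)
    qed
    have "(\<Sum>n\<in>{-L..-1}. of_int k \<cdot> \<Psi> n (sh n q))
        = (\<Sum>n\<in>{1..L}. of_int k \<cdot> act M (A (- n)) (osc (-1) k (L - n) (W (osc 1 k i E))))"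
      by (rule sum.reindex_bij_witness[of _ uminus uminus]) (auto simp: neg)
    also have "\<dots> = of_int L \<cdot> X"
      unfolding X_def vs.scale_sum_right[symmetric] using osc_Euler[of "-1" L k] by simp
    finally have s1: "(\<Sum>n\<in>{-L..-1}. of_int k \<cdot> \<Psi> n (sh n q)) = of_int L \<cdot> X" .
    have s2: "of_int k \<cdot> \<Psi> 0 (sh 0 q) = of_int (k * m) \<cdot> X"
      using chE by (simp add: nng X_def charge_def linop_scale[OF linop_osc] linop_scale[OF W])
    have "(\<Sum>n\<in>{1..i}. of_int k \<cdot> \<Psi> n (sh n q))
        = osc (-1) k L (W (of_int k \<cdot> (\<Sum>n\<in>{1..i}. act M (A n) (osc 1 k (i - n) E))))"
      by (simp add: nng linop_scale[OF linop_osc] linop_scale[OF W] linop_sum[OF linop_osc] linop_sum[OF W]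
          vs.scale_sum_right)
    also have "of_int k \<cdot> (\<Sum>n\<in>{1..i}. act M (A n) (osc 1 k (i - n) E)) = - of_int i \<cdot> osc 1 k i E"
      using osc_Euler[of 1 i k E] by simp
    finally have s3: "(\<Sum>n\<in>{1..i}. of_int k \<cdot> \<Psi> n (sh n q)) = - of_int i \<cdot> X"
      by (simp only: linop_scale[OF linop_osc] linop_scale[OF W] X_def)
    have "has_fsum (\<lambda>n. of_int k \<cdot> \<Psi> n (sh n q)) (\<Sum>n\<in>{-L..-1} \<union> ({0} \<union> {1..i}). of_int k \<cdot> \<Psi> n (sh n q))"
    proof (rule has_fsumI)
      fix n assume n: "n \<notin> {-L..-1} \<union> ({0} \<union> {1..i})"
      show "of_int k \<cdot> \<Psi> n (sh n q) = 0"
        using n by (cases "n < 0") (auto simp: neg nng osc_neg linop_zeros linop_0[OF W])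
    qed auto
    \<comment> \<open>Creation modes, zero mode and annihilation modes contribute L, k m and -i,
      which add up to a.\<close>
    also have "(\<Sum>n\<in>{-L..-1} \<union> ({0} \<union> {1..i}). of_int k \<cdot> \<Psi> n (sh n q))
        = of_int L \<cdot> X + (of_int (k * m) \<cdot> X + - of_int i \<cdot> X)"
      by (subst sum.union_disjoint, simp, simp, force, subst sum.union_disjoint) (auto simp: s1 s2[simplified] s3)
    also have "\<dots> = of_int a \<cdot> X"
      by (simp only: vs.scale_left_distrib[symmetric]) (simp add: L_def)
    finally show ?thesis by (simp add: q X_def pair_term_def L_def W_def E_def)
  qed
  show ?thesis
    by (rule has_fsum_swap[OF fin cols smul_has_fsum[OF has_fsum_pair_op] rows])
qed

text \<open>At w = z opposite charges cancel and the normally ordered exponential becomes 1.\<close>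

lemma pair_op_moment_0:
  assumes "charge m v"
  shows "has_fsum (\<lambda>a. pair_op 1 (-1) m a (K - a) v) (if K = 0 then v else 0)"
  using pair_op_diagonal[OF assms, of 1 "-1" K] exp_phi_0[OF assms, of K] by simp

text \<open>Joint support bound for interchanging the sum over modes with the sum along the
  diagonal.\<close>

lemma pair_op_Euler_finite:
  "finite {(n, a). (if n < 0 then act M (A n) (pair_op k l m (a + n) (K - a) v)
      else pair_op k l m (a + n) (K - a) (act M (A n) v)) \<noteq> 0}" (is "finite ?S")
proof -
  obtain B where B: "\<And>a b. a < B \<or> b < B \<Longrightarrow> pair_op k l m a b v = 0"
    "\<And>n a b. n \<ge> 0 \<Longrightarrow> a < B \<or> b < B \<or> n > - B \<Longrightarrow> pair_op k l m a b (act M (A n) v) = 0"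
    by (rule pair_op_bounded[of k l m v]) blast
  let ?R = "3 * \<bar>B\<bar> + \<bar>K\<bar>"
  have "n \<in> {-?R..?R} \<and> a \<in> {-?R..?R}" if "(n, a) \<in> ?S" for n a
  proof (cases "n < 0")
    case True
    then have "\<not> (a + n < B \<or> K - a < B)" using that B(1)[of "a + n" "K - a"] by (auto simp: linop_zeros)
    then show ?thesis using True by auto
  next
    case False
    then have "\<not> (a + n < B \<or> K - a < B \<or> n > - B)" using that B(2)[of n "a + n" "K - a"] by auto
    then show ?thesis using False by auto
  qed
  then have "?S \<subseteq> {-?R..?R} \<times> {-?R..?R}" by (intro subrelI) (simp only: mem_Sigma_iff)
  then show ?thesis by (rule finite_subset) simp
qed

text \<open>Weighting by \<open>a\<close> is z d/dz followed by w = z. After Euler's identity and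
  interchange of sums, the zeroth moments leave only the mode n = -K.\<close>

lemma pair_op_moment_1:
  assumes m: "charge m v"
  shows "has_fsum (\<lambda>a. of_int a \<cdot> pair_op 1 (-1) m a (K - a) v) (act M (A (- K)) v)"
proof (rule has_fsum_swap[OF pair_op_Euler_finite[of 1 "-1" m K v]])
  show "has_fsum (\<lambda>a. if n < 0 then act M (A n) (pair_op 1 (-1) m (a + n) (K - a) v)
      else pair_op 1 (-1) m (a + n) (K - a) (act M (A n) v)) (if n = - K then act M (A n) v else 0)" for n
  proof -
    have *: "has_fsum (\<lambda>a. pair_op 1 (-1) m (a + n) (K - a) w) (if n = - K then w else 0)" if "charge m w" for w
      using has_fsum_shift[OF pair_op_moment_0[OF that, of "K + n"], of n]
      by (rule has_fsum_cong) (auto simp: algebra_simps)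
    show ?thesis
      using linop_has_fsum[OF linop_act *[OF m], of "A n"] *[OF charge_act[OF m], of "A n"]
      by (cases "n < 0"; cases "n = - K") (simp_all add: linop_zeros)
  qed
  show "has_fsum (\<lambda>n. if n = - K then act M (A n) v else 0) (act M (A (- K)) v)"
    by (rule has_fsum_single[of "- K"]) auto
  show "has_fsum (\<lambda>n. if n < 0 then act M (A n) (pair_op 1 (-1) m (a + n) (K - a) v)
      else pair_op 1 (-1) m (a + n) (K - a) (act M (A n) v)) (of_int a \<cdot> pair_op 1 (-1) m a (K - a) v)" for a
    using pair_op_Euler[OF m, of 1 "-1" a "K - a"] by simp
qed

lemma nord_pair: "nord M id [g, h] v = (if deg g < 0 then act M g (act M h v)
    else if deg h < 0 then act M h (act M g v) else act M g (act M h v))"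
proof (cases "deg g < 0 \<or> deg h \<ge> 0")
  case True
  then show ?thesis
    by (cases "deg h < 0"; cases "deg g < 0") (simp_all add: nord_def word_Cons word_Nil)
qed (simp add: nord_def word_Cons word_Nil)

lemma nord_pair_finite:
  assumes "\<And>n. deg (f n) = n" "\<And>n. deg (h n) = n"
  shows "finite {n. nord M id [f n, h (c - n)] v \<noteq> 0}"
proof -
  obtain N where N: "N \<ge> 0" "\<And>ws. \<forall>g\<in>set ws. deg g \<ge> 0 \<Longrightarrow> (\<Sum>g\<leftarrow>ws. deg g) > N \<Longrightarrow> word M ws v = 0"
    by (rule osc_bounded[of v]) blast
  have "nord M id [f n, h (c - n)] v = 0" if "n > N \<or> c - n > N" for n
  proof -
    have "word M (filter (\<lambda>g. deg g \<ge> 0) [f n, h (c - n)]) v = 0"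
      using that N(1) by (intro N(2)) (auto simp: assms)
    then show ?thesis unfolding nord_def by (simp add: linop_0[OF linop_word])
  qed
  then have "{n. nord M id [f n, h (c - n)] v \<noteq> 0} \<subseteq> {c - N..N}" by force
  then show ?thesis by (rule finite_subset) simp
qed

text \<open>The coefficient of \<open>z\<^bsup>-K\<^esup>\<close> in the normally ordered square of \<open>z \<phi>'(z)\<close>.\<close>

definition current_sq :: "int \<Rightarrow> 'v \<Rightarrow> 'v" where
  "current_sq K v = Sum_any (\<lambda>n. nord M id [A n, A (- K - n)] v)"

lemma has_fsum_current_sq: "has_fsum (\<lambda>n. nord M id [A n, A (- K - n)] v) (current_sq K v)"
  using nord_pair_finite[of A A "- K" v] by (simp add: has_fsum_def current_sq_def)

lemma linop_nord: "linop X \<Longrightarrow> linop (nord M X ws)"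
  unfolding nord_def o_def by (rule linop_comp[OF linop_word linop_comp[OF _ linop_word]])

lemma linop_current_sq: "linop (current_sq K)"
  unfolding current_sq_def[abs_def]
  by (rule linop_Sum_any) (use has_fsum_current_sq linop_id in \<open>auto simp: has_fsum_def id_def intro!: linop_nord\<close>)

text \<open>Euler's identity is applied once, then the first moment with a = (a + n) - n. The
  correction from -n survives only at n = -K; it is the derivative term z (z \<phi>')' of the second
  derivative of an exponential.\<close>

lemma pair_op_moment_2:
  assumes m: "charge m v"
  shows "has_fsum (\<lambda>a. of_int (a * a) \<cdot> pair_op 1 (-1) m a (K - a) v)
    (current_sq K v + of_int K \<cdot> act M (A (- K)) v)"
proof -
  define \<Psi> where "\<Psi> n a = (if n < 0 then act M (A n) (pair_op 1 (-1) m (a + n) (K - a) v)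
      else pair_op 1 (-1) m (a + n) (K - a) (act M (A n) v))" for n a
  have fin0: "finite {(n, a). \<Psi> n a \<noteq> 0}"
    unfolding \<Psi>_def by (rule pair_op_Euler_finite)
  have fin: "finite {(n, a). of_int a \<cdot> \<Psi> n a \<noteq> 0}"
  proof (rule finite_subset[OF _ fin0], rule subrelI)
    show "(n, a) \<in> {(n, a). \<Psi> n a \<noteq> 0}" if "(n, a) \<in> {(n, a). of_int a \<cdot> \<Psi> n a \<noteq> 0}" for n a
      using that by simp
  qed
  have rows: "has_fsum (\<lambda>a. of_int a \<cdot> \<Psi> n a)
      (nord M id [A n, A (- K - n)] v + (if n = - K then of_int K \<cdot> act M (A (- K)) v else 0))" for n
  proof -
    have *: "has_fsum (\<lambda>a. of_int a \<cdot> pair_op 1 (-1) m (a + n) (K - a) w)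
        (act M (A (- K - n)) w - of_int n \<cdot> (if K + n = 0 then w else 0))" if w: "charge m w" for w
    proof -
      have "has_fsum (\<lambda>a. of_int a \<cdot> pair_op 1 (-1) m a (K + n - a) w - of_int n \<cdot> pair_op 1 (-1) m a (K + n - a) w)
        (act M (A (- (K + n))) w - of_int n \<cdot> (if K + n = 0 then w else 0))"
        by (intro has_fsum_diff smul_has_fsum pair_op_moment_0[OF w] pair_op_moment_1[OF w])
      from has_fsum_shift[OF this, of n] show ?thesis
        by (rule has_fsum_cong) (simp_all add: vs.scale_left_distrib)
    qed
    have comm: "act M (A (- K - n)) (act M (A n) v) = nord M id [A n, A (- K - n)] v" if "\<not> n < 0"
      using that act_commute[of "A (- K - n)" "A n" v] by (auto simp: nord_pair)
    show ?thesis
    proof (cases "n < 0")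
      case True
      from linop_has_fsum[OF linop_act *[OF m], of "A n"] show ?thesis
        by (rule has_fsum_cong) (use True in \<open>auto simp: \<Psi>_def nord_pair linop_diff[OF linop_act]
            linop_scale[OF linop_act] linop_zeros\<close>)
    next
      case False
      from *[OF charge_act[OF m], of "A n"] show ?thesis
        by (rule has_fsum_cong) (use False comm in \<open>auto simp: \<Psi>_def\<close>)
    qed
  qed
  have "has_fsum (\<lambda>n. if n = - K then of_int K \<cdot> act M (A (- K)) v else 0) (of_int K \<cdot> act M (A (- K)) v)"
    by (rule has_fsum_single[of "- K"]) auto
  note tot = has_fsum_add[OF has_fsum_current_sq this]
  have cols: "has_fsum (\<lambda>n. of_int a \<cdot> \<Psi> n a) (of_int (a * a) \<cdot> pair_op 1 (-1) m a (K - a) v)" for a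
    using smul_has_fsum[OF pair_op_Euler[OF m, of 1 "-1" a "K - a"], of "of_int a"] by (simp add: \<Psi>_def)
  show ?thesis by (rule has_fsum_swap[OF fin rows tot cols])
qed

section \<open>Fermion bilinears\<close>

lemma has_fsum_charge_induct:
  assumes f: "\<And>i. linop (f i)" and g: "linop g" and *: "\<And>m v. charge m v \<Longrightarrow> has_fsum (\<lambda>i. f i v) (g v)"
  shows "has_fsum (\<lambda>i. f i v) (g v)"
proof (induction v rule: charge_induct)
  case zero
  show ?case by (simp add: linop_0[OF f] linop_0[OF g] has_fsum_0)
next
  case (charge m v)
  then show ?case by (rule *)
next
  case (add u v)
  show ?case unfolding linop_add[OF f] linop_add[OF g] by (rule has_fsum_add[OF add])
qed

text \<open>
  The modes of \<open>e\<^bsup>\<phi>\<^esup>e\<^bsup>-\<phi>\<^esup>\<close> and \<open>e\<^bsup>-\<phi>\<^esup>e\<^bsup>\<phi>\<^esup>\<close> are tail sums of the same family \<open>D\<close>. Only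
  differences of such tail sums can be summed over \<open>i\<close>.
\<close>

lemma has_fsum_opposite:
  fixes w W :: "int \<Rightarrow> complex" and \<alpha> \<gamma> :: "int \<Rightarrow> int"
  assumes D: "finite {a. D a \<noteq> 0}" and W: "\<And>i. W (i + 1) - W i = w i"
    and s: "has_fsum (\<lambda>a. (W (\<alpha> a) - W (\<gamma> a)) \<cdot> D a) s"
    and F: "\<And>i. has_fsum (\<lambda>a. (of_bool (i < \<alpha> a) - of_bool (i < \<gamma> a)) \<cdot> D a) (F i)"
  shows "has_fsum (\<lambda>i. w i \<cdot> F i) s"
proof -
  let ?S = "{a. D a \<noteq> 0}"
  have Fi: "F i = (\<Sum>a\<in>?S. (of_bool (i < \<alpha> a) - of_bool (i < \<gamma> a)) \<cdot> D a)" for i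
    using has_fsum_superset[OF F D] by simp
  have "has_fsum (\<lambda>i. \<Sum>a\<in>?S. (w i * (of_bool (i < \<alpha> a) - of_bool (i < \<gamma> a))) \<cdot> D a)
      (\<Sum>a\<in>?S. (W (\<alpha> a) - W (\<gamma> a)) \<cdot> D a)"
    by (intro has_fsum_sum has_fsum_scale_left has_fsum_telescope W)
  moreover have "(\<Sum>a\<in>?S. (W (\<alpha> a) - W (\<gamma> a)) \<cdot> D a) = s"
    by (rule has_fsum_superset[OF s D]) simp
  ultimately show ?thesis by (simp add: Fi vs.scale_sum_right)
qed

text \<open>Summation by parts. The constant \<open>c\<close> has no effect because the differences
  alone sum to 0.\<close>

lemma has_fsum_difference:
  assumes "has_fsum G s"
  shows "has_fsum (\<lambda>i::int. (of_int i + c) \<cdot> (G (i - 1) - G i)) s"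
proof -
  obtain S where S: "finite S" "\<And>x. x \<notin> S \<Longrightarrow> G x = 0" by (rule has_fsumE[OF assms]) blast
  have 1: "has_fsum (\<lambda>i. (of_int i + c) \<cdot> G i) (\<Sum>i\<in>S. (of_int i + c) \<cdot> G i)" (is "has_fsum _ ?t")
    by (rule has_fsumI[OF S(1)]) (use S(2) in auto)
  from has_fsum_diff[OF has_fsum_add[OF has_fsum_shift[OF 1, of "-1"] has_fsum_shift[OF assms, of "-1"]] 1]
  have "has_fsum (\<lambda>i. (of_int (i - 1) + c) \<cdot> G (i - 1) + G (i - 1) - (of_int i + c) \<cdot> G i) (?t + s - ?t)"
    by simp
  then show ?thesis
    by (rule has_fsum_cong) (simp_all add: vs.scale_left_distrib vs.scale_left_diff_distrib vs.scale_right_diff_distrib)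
qed

lemma has_fsum_difference_0:
  assumes "has_fsum G s" shows "has_fsum (\<lambda>i::int. G (i - 1) - G i) (0 :: 'v)"
  using has_fsum_diff[OF has_fsum_shift[OF assms, of "-1"] assms] by simp

lemma pair_op_diagonal_finite: "finite {a. pair_op k l m a (K - a) v \<noteq> 0}"
proof -
  obtain B where "\<And>a b. a < B \<or> b < B \<Longrightarrow> pair_op k l m a b v = 0"
    by (rule pair_op_bounded[of k l m v]) blast
  then have "{a. pair_op k l m a (K - a) v \<noteq> 0} \<subseteq> {B..K - B}" by force
  then show ?thesis by (rule finite_subset) simp
qed

lemma exp_plus_minus:
  assumes "charge m v" "K = i + j + 1"
  shows "has_fsum (\<lambda>a. of_bool (i < a) \<cdot> pair_op 1 (-1) m a (K - a) v) (exp_phi M 1 i (exp_phi M (-1) j v))"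
  using exp_phi_exp_phi_opposite[OF assms(1), of 1 "-1" i j] assms(2) by (auto elim!: has_fsum_cong)

text \<open>Symmetry of \<open>pair_op\<close> and the reflection of \<open>a\<close> into K - a
  express this product by the same diagonal as \<open>exp_plus_minus\<close>; only the condition on
  the tail changes.\<close>

lemma exp_minus_plus:
  assumes "charge m v" "K = i + j + 1"
  shows "has_fsum (\<lambda>a. of_bool (i < K - a) \<cdot> pair_op 1 (-1) m a (K - a) v) (exp_phi M (-1) i (exp_phi M 1 j v))"
  using has_fsum_reflect[OF exp_phi_exp_phi_opposite[OF assms(1), of "-1" 1 i j], of K] assms(2)
  by (auto elim!: has_fsum_cong simp: pair_op_swap[of "-1" 1])

end

section \<open>Products of two fermions at the same point\<close>

context heisenberg_module
begin

lemma psi_mode: "psi M i v = (1 / (\<i> * complex_of_real (sqrt 2))) \<cdot> (exp_phi M 1 i v - exp_phi M (-1) i v)"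
  by (simp add: psi_def fsmul_def fadd_def)

lemma psit_mode: "psit M i v = (1 / complex_of_real (sqrt 2)) \<cdot> (exp_phi M 1 i v + exp_phi M (-1) i v)"
  by (simp add: psit_def fsmul_def fadd_def)

lemma linop_psi: "linop (psi M i)"
  by (simp add: linop_def psi_mode linop_add[OF linop_exp_phi] linop_scale[OF linop_exp_phi] vs.scale_right_distrib
      vs.scale_right_diff_distrib algebra_simps)

lemma linop_psit: "linop (psit M i)"
  by (simp add: linop_def psit_mode linop_add[OF linop_exp_phi] linop_scale[OF linop_exp_phi] vs.scale_right_distrib
      algebra_simps)

lemma sqrt2_complex: "complex_of_real (sqrt 2) * complex_of_real (sqrt 2) = 2"
  by (simp flip: of_real_mult)

lemmas linop_exps = linop_add[OF linop_exp_phi] linop_diff[OF linop_exp_phi] linop_scale[OF linop_exp_phi]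

lemma psi_psi: "psi M i (psi M j v) = (- 1 / 2) \<cdot> (exp_phi M 1 i (exp_phi M 1 j v) + exp_phi M (-1) i (exp_phi M (-1) j v)
    - (exp_phi M 1 i (exp_phi M (-1) j v) + exp_phi M (-1) i (exp_phi M 1 j v)))"
  using sqrt2_complex
  by (simp add: psi_mode linop_exps vs.scale_right_diff_distrib[symmetric] vs.scale_right_distrib[symmetric])
    (simp add: algebra_simps)

lemma psit_psit: "psit M i (psit M j v) = (1 / 2) \<cdot> (exp_phi M 1 i (exp_phi M 1 j v) + exp_phi M (-1) i (exp_phi M (-1) j v)
    + (exp_phi M 1 i (exp_phi M (-1) j v) + exp_phi M (-1) i (exp_phi M 1 j v)))"
  using sqrt2_complex
  by (simp add: psit_mode linop_exps vs.scale_right_diff_distrib[symmetric] vs.scale_right_distrib[symmetric])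

lemma psit_psi: "psit M i (psi M j v) = (- \<i> / 2) \<cdot> (exp_phi M 1 i (exp_phi M 1 j v) - exp_phi M (-1) i (exp_phi M (-1) j v)
    - (exp_phi M 1 i (exp_phi M (-1) j v) - exp_phi M (-1) i (exp_phi M 1 j v)))"
proof -
  have "1 / complex_of_real (sqrt 2) * (1 / (\<i> * complex_of_real (sqrt 2))) = 1 / (\<i> * (complex_of_real (sqrt 2) * complex_of_real (sqrt 2)))"
    by simp
  also have "\<dots> = - \<i> / 2" unfolding sqrt2_complex by (simp add: divide_simps)
  finally show ?thesis
    by (simp only: psi_mode psit_mode linop_exps vs.scale_right_diff_distrib[symmetric]
        vs.scale_right_distrib[symmetric] vs.scale_scale) (simp add: algebra_simps)?
qed

text \<open>The factor z - w is antisymmetric and the normally ordered product symmetric.\<close>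

lemma exp_phi_anticommute:
  assumes "k * k = 1"
  shows "exp_phi M k j (exp_phi M k i v) = - exp_phi M k i (exp_phi M k j v)"
proof (induction v rule: charge_induct)
  case (charge m v)
  show ?case
    using pair_op_swap[of k k m] by (simp add: exp_phi_exp_phi_same[OF charge assms])
qed (simp_all add: linop_0[OF linop_exp_phi] linop_exps)

lemma linop_exp_phi_2: "linop (\<lambda>v. exp_phi M k i (exp_phi M l j v))"
  by (rule linop_comp[OF linop_exp_phi linop_exp_phi])

text \<open>The product has the factor z - w, so it vanishes at w = z while its z-derivative there
  is the merged vertex operator. The free constant \<open>c\<close> lets the same lemma serve for a
  derivative of either factor.\<close>

lemma exp_phi_same_weighted:
  assumes k: "k * k = 1"
  shows "has_fsum (\<lambda>i. (of_int i + c) \<cdot> exp_phi M k i (exp_phi M k (n - i) v)) (exp_phi M (k + k) (n - 1) v)"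
    and "has_fsum (\<lambda>i. exp_phi M k i (exp_phi M k (n - i) v)) 0"
proof -
  have *: "exp_phi M k i (exp_phi M k (n - i) v) = pair_op k k m (i - 1) (n - 1 - (i - 1)) v - pair_op k k m i (n - 1 - i) v"
    if "charge m v" for m v i
    using exp_phi_exp_phi_same[OF that k, of i "n - i"] by (simp add: algebra_simps)
  show "has_fsum (\<lambda>i. (of_int i + c) \<cdot> exp_phi M k i (exp_phi M k (n - i) v)) (exp_phi M (k + k) (n - 1) v)"
  proof (rule has_fsum_charge_induct[where f = "\<lambda>i v. (of_int i + c) \<cdot> exp_phi M k i (exp_phi M k (n - i) v)" and g = "exp_phi M (k + k) (n - 1)"])
    fix m v assume m: "charge m v"
    show "has_fsum (\<lambda>i. (of_int i + c) \<cdot> exp_phi M k i (exp_phi M k (n - i) v)) (exp_phi M (k + k) (n - 1) v)"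
      unfolding *[OF m] by (rule has_fsum_difference[OF pair_op_diagonal[OF m]])
  qed (intro linop_smul linop_exp_phi_2, rule linop_exp_phi)
  show "has_fsum (\<lambda>i. exp_phi M k i (exp_phi M k (n - i) v)) 0"
  proof (rule has_fsum_charge_induct[where f = "\<lambda>i v. exp_phi M k i (exp_phi M k (n - i) v)" and g = "\<lambda>v. 0"])
    fix m v assume m: "charge m v"
    show "has_fsum (\<lambda>i. exp_phi M k i (exp_phi M k (n - i) v)) 0"
      unfolding *[OF m] by (rule has_fsum_difference_0[OF pair_op_diagonal[OF m]])
  qed (rule linop_exp_phi_2, rule linop_zero)
qed

text \<open>Both orders are tails of one diagonal, cut by i < a and by i < n + 1 - a. Their
  difference is finite for each \<open>a\<close>, so the sum over i telescopes to a difference of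
  the antiderivative \<open>W\<close> of the weight.\<close>

lemma exp_phi_opposite_weighted:
  assumes m: "charge m v" and W: "\<And>i. W (i + 1) - W i = (w i :: complex)"
    and s: "has_fsum (\<lambda>a. (W a - W (n + 1 - a)) \<cdot> pair_op 1 (-1) m a (n + 1 - a) v) s"
  shows "has_fsum (\<lambda>i. w i \<cdot> (exp_phi M 1 i (exp_phi M (-1) (n - i) v) - exp_phi M (-1) i (exp_phi M 1 (n - i) v))) s"
proof (rule has_fsum_opposite[OF pair_op_diagonal_finite W s])
  fix i
  have K: "n + 1 = i + (n - i) + 1" by simp
  show "has_fsum (\<lambda>a. (of_bool (i < a) - of_bool (i < n + 1 - a)) \<cdot> pair_op 1 (-1) m a (n + 1 - a) v)
      (exp_phi M 1 i (exp_phi M (-1) (n - i) v) - exp_phi M (-1) i (exp_phi M 1 (n - i) v))"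
    using has_fsum_diff[OF exp_plus_minus[OF m K] exp_minus_plus[OF m K]]
    by (simp only: vs.scale_left_diff_distrib)
qed

lemma pair_op_moment_1':
  assumes "charge m v"
  shows "has_fsum (\<lambda>a. (of_int a - of_int (K - a)) \<cdot> pair_op 1 (-1) m a (K - a) v) (2 \<cdot> act M (A (- K)) v)"
  using has_fsum_diff[OF smul_has_fsum[OF pair_op_moment_1[OF assms, of K], of 2]
      smul_has_fsum[OF pair_op_moment_0[OF assms, of K], of "of_int K"]]
  by (rule has_fsum_cong) (auto simp flip: vs.scale_left_diff_distrib)

lemma exp_phi_opposite_sum:
  "has_fsum (\<lambda>i. exp_phi M 1 i (exp_phi M (-1) (n - i) v) - exp_phi M (-1) i (exp_phi M 1 (n - i) v))
    (2 \<cdot> act M (A (- n - 1)) v)" (is ?A)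
  and exp_phi_opposite_deriv:
  "has_fsum (\<lambda>i. (of_int (n - i)) \<cdot> (exp_phi M 1 i (exp_phi M (-1) (n - i) v) - exp_phi M (-1) i (exp_phi M 1 (n - i) v)))
    (of_int n \<cdot> act M (A (- n - 1)) v)" (is ?B)
proof -
  have lin: "linop (\<lambda>v. exp_phi M 1 i (exp_phi M (-1) (n - i) v) - exp_phi M (-1) i (exp_phi M 1 (n - i) v))" for i
    using linop_plus[OF linop_exp_phi_2 linop_uminus[OF linop_exp_phi_2]] by simp
  show ?A
  proof (rule has_fsum_charge_induct[where f = "\<lambda>i v. exp_phi M 1 i (exp_phi M (-1) (n - i) v) - exp_phi M (-1) i (exp_phi M 1 (n - i) v)" and g = "\<lambda>v. 2 \<cdot> act M (A (- n - 1)) v"])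
    fix m v assume m: "charge m v"
    have "has_fsum (\<lambda>i. 1 \<cdot> (exp_phi M 1 i (exp_phi M (-1) (n - i) v) - exp_phi M (-1) i (exp_phi M 1 (n - i) v)))
        (2 \<cdot> act M (A (- n - 1)) v)"
      using pair_op_moment_1'[OF m, of "n + 1"]
      by (intro exp_phi_opposite_weighted[OF m, where W = of_int]) simp_all
    then show "has_fsum (\<lambda>i. exp_phi M 1 i (exp_phi M (-1) (n - i) v) - exp_phi M (-1) i (exp_phi M 1 (n - i) v))
        (2 \<cdot> act M (A (- n - 1)) v)" by simp
  qed (rule lin, intro linop_smul linop_act)
  show ?B
  proof (rule has_fsum_charge_induct[where f = "\<lambda>i v. of_int (n - i) \<cdot> (exp_phi M 1 i (exp_phi M (-1) (n - i) v) - exp_phi M (-1) i (exp_phi M 1 (n - i) v))" and g = "\<lambda>v. of_int n \<cdot> act M (A (- n - 1)) v"])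
    fix m v assume m: "charge m v"
    \<comment> \<open>A discrete antiderivative of n - i. Antisymmetrizing it under the reflection
      of a into n + 1 - a removes the quadratic part, so the first moment is enough.\<close>
    define W :: "int \<Rightarrow> complex" where "W a = of_int n * of_int a - of_int a * (of_int a - 1) / 2" for a
    have W: "W (i + 1) - W i = of_int (n - i)" for i by (simp add: W_def field_simps)
    have Wd: "W a - W (n + 1 - a) = (of_int n / 2) * (of_int a - of_int (n + 1 - a))" for a
      by (simp add: W_def field_simps)
    have "has_fsum (\<lambda>a. (W a - W (n + 1 - a)) \<cdot> pair_op 1 (-1) m a (n + 1 - a) v)
        ((of_int n / 2) \<cdot> 2 \<cdot> act M (A (- (n + 1))) v)"
      unfolding Wd vs.scale_scale[symmetric] by (rule smul_has_fsum[OF pair_op_moment_1'[OF m]])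
    then have "has_fsum (\<lambda>a. (W a - W (n + 1 - a)) \<cdot> pair_op 1 (-1) m a (n + 1 - a) v) (of_int n \<cdot> act M (A (- n - 1)) v)"
      by simp
    from exp_phi_opposite_weighted[OF m W this]
    show "has_fsum (\<lambda>i. (of_int (n - i)) \<cdot> (exp_phi M 1 i (exp_phi M (-1) (n - i) v) - exp_phi M (-1) i (exp_phi M 1 (n - i) v)))
      (of_int n \<cdot> act M (A (- n - 1)) v)" .
  qed (intro linop_smul lin, intro linop_smul linop_act)
qed

text \<open>The charge preserving part of the fermionic normally ordered products, up to a scalar.\<close>

definition mixed_nord :: "int \<Rightarrow> int \<Rightarrow> 'v \<Rightarrow> 'v" where
  "mixed_nord i j v = (if j \<le> i
     then exp_phi M 1 i (exp_phi M (-1) j v) + exp_phi M (-1) i (exp_phi M 1 j v)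
     else - (exp_phi M 1 j (exp_phi M (-1) i v) + exp_phi M (-1) j (exp_phi M 1 i v)))"

lemma linop_mixed_nord: "linop (mixed_nord i j)"
  unfolding mixed_nord_def[abs_def] by (intro linop_if linop_uminus linop_plus linop_exp_phi_2)

text \<open>Normal ordering replaces each tail indicator by its difference from the indicator of i <
  c. Summing against i then gives W(a) + W(K - a) - 2 W(c), a quadratic polynomial in a, which the
  moments of order 0, 1 and 2 evaluate.\<close>

lemma has_fsum_mixed_nord:
  "has_fsum (\<lambda>i. of_int i \<cdot> mixed_nord i (n - i) v) (current_sq (n + 1) v)"
proof (rule has_fsum_charge_induct[where f = "\<lambda>i v. of_int i \<cdot> mixed_nord i (n - i) v" and g = "current_sq (n + 1)"])
  fix m v assume m: "charge m v"
  define K where "K = n + 1"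
  \<comment> \<open>The condition n - i <= i of the normal ordering is equivalent to c <= i.\<close>
  define c where "c = K div 2"
  define D where "D a = pair_op 1 (-1) m a (K - a) v" for a
  define W :: "int \<Rightarrow> complex" where "W a = of_int a * (of_int a - 1) / 2" for a
  have W: "W (i + 1) - W i = of_int i" for i by (simp add: W_def field_simps)
  have finD: "finite {a. D a \<noteq> 0}" unfolding D_def by (rule pair_op_diagonal_finite)
  have sc: "has_fsum (\<lambda>a. f a \<cdot> D a) (Sum_any (\<lambda>a. f a \<cdot> D a))" for f
    unfolding has_fsum_def by (auto intro: rev_finite_subset[OF finD])
  define F where "F \<alpha> i = Sum_any (\<lambda>a. (of_bool (i < \<alpha> a) - of_bool (i < c)) \<cdot> D a)" for \<alpha> :: "int \<Rightarrow> int" and i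
  have F: "has_fsum (\<lambda>a. (of_bool (i < \<alpha> a) - of_bool (i < c)) \<cdot> D a) (F \<alpha> i)" for \<alpha> i
    unfolding F_def by (rule sc)
  have "mixed_nord i (n - i) v = F (\<lambda>a. a) i + F (\<lambda>a. K - a) i" for i
  proof -
    have FF: "has_fsum (\<lambda>a. (of_bool (i < a) - of_bool (i < c)) \<cdot> D a + (of_bool (i < K - a) - of_bool (i < c)) \<cdot> D a)
        (F (\<lambda>a. a) i + F (\<lambda>a. K - a) i)"
      by (rule has_fsum_add[OF F F])
    have K: "K = i + (n - i) + 1" "K = (n - i) + i + 1" by (simp_all add: K_def)
    have "has_fsum (\<lambda>a. (of_bool (i < a) - of_bool (i < c)) \<cdot> D a + (of_bool (i < K - a) - of_bool (i < c)) \<cdot> D a)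
        (mixed_nord i (n - i) v)"
    proof (cases "n - i \<le> i")
      case True
      then have "\<not> i < c" by (auto simp: c_def K_def)
      with True show ?thesis
        using has_fsum_add[OF exp_plus_minus[OF m K(1)] exp_minus_plus[OF m K(1)]]
        by (simp add: mixed_nord_def D_def)
    next
      case False
      then have c: "i < c" by (auto simp: c_def K_def)
      \<comment> \<open>Below the cut-off the factors are exchanged with a sign; minus the tail for
        n - i is the tail for i minus 1, by taking complements.\<close>
      have b: "of_bool (i < a) - 1 = - (of_bool (n - i < K - a) :: complex)"
        "of_bool (i < K - a) - 1 = - (of_bool (n - i < a) :: complex)" for a by (auto simp: K_def)
      from False c show ?thesis
        using smul_has_fsum[OF has_fsum_add[OF exp_plus_minus[OF m K(2)] exp_minus_plus[OF m K(2)]], of "-1"]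
        by (simp add: mixed_nord_def D_def b add.commute)
    qed
    then show ?thesis using FF by (rule has_fsum_unique)
  qed
  note eq = this
  have "has_fsum (\<lambda>i. of_int i \<cdot> F \<alpha> i) (Sum_any (\<lambda>a. (W (\<alpha> a) - W c) \<cdot> D a))" for \<alpha>
    using finD W sc F by (rule has_fsum_opposite)
  from has_fsum_add[OF this[of "\<lambda>a. a"] this[of "\<lambda>a. K - a"]]
  have 1: "has_fsum (\<lambda>i. of_int i \<cdot> mixed_nord i (n - i) v)
      (Sum_any (\<lambda>a. (W a - W c) \<cdot> D a) + Sum_any (\<lambda>a. (W (K - a) - W c) \<cdot> D a))" (is "has_fsum _ ?t")
    by (simp add: eq vs.scale_right_distrib)
  have "has_fsum (\<lambda>a. (W a - W c) \<cdot> D a + (W (K - a) - W c) \<cdot> D a) ?t"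
    by (rule has_fsum_add[OF sc sc])
  moreover have "has_fsum (\<lambda>a. (W a - W c) \<cdot> D a + (W (K - a) - W c) \<cdot> D a) (current_sq K v)"
  proof -
    \<comment> \<open>The constant meets only the zeroth moment, hence only K = 0, where it is 0.
      The linear term -K a cancels the a_{-K} correction in the second moment.\<close>
    let ?r = "of_int K * (of_int K - 1) / 2 - 2 * W c"
    have r: "?r \<cdot> (if K = 0 then v else 0) = 0" by (auto simp: W_def c_def)
    have w: "W a - W c + (W (K - a) - W c) = of_int (a * a) - of_int K * of_int a + ?r" for a
      by (simp add: W_def[of a] W_def[of "K - a"] field_simps)
    have "has_fsum (\<lambda>a. of_int (a * a) \<cdot> D a - of_int K \<cdot> (of_int a \<cdot> D a) + ?r \<cdot> D a)
        (current_sq K v + of_int K \<cdot> act M (A (- K)) v - of_int K \<cdot> act M (A (- K)) v + ?r \<cdot> (if K = 0 then v else 0))"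
      unfolding D_def
      by (intro has_fsum_add has_fsum_diff smul_has_fsum pair_op_moment_0[OF m] pair_op_moment_1[OF m] pair_op_moment_2[OF m])
    then show ?thesis
      unfolding r by (rule has_fsum_cong)
        (simp_all only: vs.scale_left_distrib[symmetric] w vs.scale_scale vs.scale_left_diff_distrib[symmetric] add_0_right add_diff_cancel)
  qed
  ultimately have "?t = current_sq K v" by (rule has_fsum_unique)
  with 1 show "has_fsum (\<lambda>i. of_int i \<cdot> mixed_nord i (n - i) v) (current_sq (n + 1) v)"
    by (simp add: K_def)
qed (intro linop_smul linop_mixed_nord, rule linop_current_sq)

text \<open>The parts of charge 2 and -2 anticommute, so the ordering does not change them; only the
  charge preserving part is affected.\<close>

lemma fermion_nord_psi: "fermion_nord (psi M) i j v = (- 1 / 2) \<cdot>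
    (exp_phi M 1 i (exp_phi M 1 j v) + exp_phi M (-1) i (exp_phi M (-1) j v) - mixed_nord i j v)"
  and fermion_nord_psit: "fermion_nord (psit M) i j v = (1 / 2) \<cdot>
    (exp_phi M 1 i (exp_phi M 1 j v) + exp_phi M (-1) i (exp_phi M (-1) j v) + mixed_nord i j v)"
proof -
  have a: "exp_phi M 1 j (exp_phi M 1 i v) = - exp_phi M 1 i (exp_phi M 1 j v)"
    "exp_phi M (-1) j (exp_phi M (-1) i v) = - exp_phi M (-1) i (exp_phi M (-1) j v)"
    by (rule exp_phi_anticommute; simp)+
  have n: "- (c \<cdot> x) = c \<cdot> (- x)" for c x by simp
  show "fermion_nord (psi M) i j v = (- 1 / 2) \<cdot>
    (exp_phi M 1 i (exp_phi M 1 j v) + exp_phi M (-1) i (exp_phi M (-1) j v) - mixed_nord i j v)"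
    unfolding fermion_nord_def psi_psi mixed_nord_def n a
    by (auto intro!: arg_cong[where f = "smul M _"])
  show "fermion_nord (psit M) i j v = (1 / 2) \<cdot>
    (exp_phi M 1 i (exp_phi M 1 j v) + exp_phi M (-1) i (exp_phi M (-1) j v) + mixed_nord i j v)"
    unfolding fermion_nord_def psit_psit mixed_nord_def n a
    by (auto intro!: arg_cong[where f = "smul M _"])
qed

text \<open>Equal charges give the exponentials of charge 2 and -2, opposite ones the square of the
  current. The index k + 2 arises because \<open>current_sq\<close> is built from z \<phi>' instead
  of \<phi>'.\<close>

lemma fermion_nord_deriv_psi: "fermion_nord_deriv M (psi M) k v
    = (- 1 / 2) \<cdot> (exp_phi M 2 k v + exp_phi M (-2) k v - current_sq (k + 2) v)"
  and fermion_nord_deriv_psit: "fermion_nord_deriv M (psit M) k v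
    = (1 / 2) \<cdot> (exp_phi M 2 k v + exp_phi M (-2) k v + current_sq (k + 2) v)"
proof -
  have E: "has_fsum (\<lambda>i. of_int i \<cdot> exp_phi M 1 i (exp_phi M 1 (k + 1 - i) v)
      + of_int i \<cdot> exp_phi M (-1) i (exp_phi M (-1) (k + 1 - i) v)) (exp_phi M 2 k v + exp_phi M (-2) k v)"
    using has_fsum_add[OF exp_phi_same_weighted(1)[of 1 0 "k + 1" v] exp_phi_same_weighted(1)[of "-1" 0 "k + 1" v]] by simp
  have X: "has_fsum (\<lambda>i. of_int i \<cdot> mixed_nord i (k + 1 - i) v) (current_sq (k + 2) v)"
    using has_fsum_mixed_nord[of "k + 1" v] by (simp add: add.commute)
  have c: "of_int i \<cdot> ((- 1 / 2) \<cdot> (x + y - z)) = (- 1 / 2) \<cdot> (of_int i \<cdot> x + of_int i \<cdot> y - of_int i \<cdot> z)"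
    "of_int i \<cdot> ((1 / 2) \<cdot> (x + y + z)) = (1 / 2) \<cdot> (of_int i \<cdot> x + of_int i \<cdot> y + of_int i \<cdot> z)" for i x y z
    by (simp_all only: vs.scale_right_distrib[symmetric] vs.scale_right_diff_distrib[symmetric] vs.scale_scale mult.commute)
  show "fermion_nord_deriv M (psi M) k v
    = (- 1 / 2) \<cdot> (exp_phi M 2 k v + exp_phi M (-2) k v - current_sq (k + 2) v)"
    unfolding fermion_nord_deriv_def fermion_nord_psi c
    by (rule has_fsum_Sum_any[OF smul_has_fsum[OF has_fsum_diff[OF E X]]])
  show "fermion_nord_deriv M (psit M) k v
    = (1 / 2) \<cdot> (exp_phi M 2 k v + exp_phi M (-2) k v + current_sq (k + 2) v)"
    unfolding fermion_nord_deriv_def fermion_nord_psit c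
    by (rule has_fsum_Sum_any[OF smul_has_fsum[OF has_fsum_add[OF E X]]])
qed

text \<open>The two neutral products enter with opposite signs, so their poles cancel and the
  product of fields converges without normal ordering; its value is \<phi>' times the imaginary
  unit.\<close>

lemma has_fsum_psit_psi: "has_fsum (\<lambda>i. psit M i (psi M (k - i) v)) (\<i> \<cdot> act M (A (- k - 1)) v)"
proof -
  have "has_fsum (\<lambda>i. psit M i (psi M (k - i) v)) ((- \<i> / 2) \<cdot> (0 - 0 - 2 \<cdot> act M (A (- k - 1)) v))"
    unfolding psit_psi
    by (intro smul_has_fsum has_fsum_diff exp_phi_opposite_sum exp_phi_same_weighted(2)) simp_all
  then show ?thesis by simp
qed

lemma has_fsum_psit_dpsi: "has_fsum (\<lambda>i. psit M i (fderiv M (psi M) (k - i) v))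
    ((\<i> / 2) \<cdot> (exp_phi M 2 k v - exp_phi M (-2) k v + of_int (k + 1) \<cdot> act M (A (- k - 2)) v))"
proof -
  have s: "has_fsum (\<lambda>i. of_int (k + 1 - i) \<cdot> exp_phi M l i (exp_phi M l (k + 1 - i) v)) (- exp_phi M (l + l) k v)"
    if "l * l = 1" for l
  proof -
    \<comment> \<open>The weight k + 1 - i is -(i + c) for c = -(k + 1), which brings
      \<open>exp_phi_same_weighted\<close> into play.\<close>
    have "-1 \<cdot> (of_int i + - of_int (k + 1)) \<cdot> x = of_int (k + 1 - i) \<cdot> x" for i x
      unfolding vs.scale_scale by (rule arg_cong[where f = "\<lambda>c. c \<cdot> x"]) simp
    moreover have "-1 \<cdot> x = - x" for x by simp
    ultimately show ?thesis
      using smul_has_fsum[OF exp_phi_same_weighted(1)[OF that, of "- of_int (k + 1)" "k + 1" v], of "-1"]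
      by (simp only: add_diff_cancel)
  qed
  have "psit M i (fderiv M (psi M) (k - i) v) = (- \<i> / 2) \<cdot>
      (of_int (k + 1 - i) \<cdot> exp_phi M 1 i (exp_phi M 1 (k + 1 - i) v)
       - of_int (k + 1 - i) \<cdot> exp_phi M (-1) i (exp_phi M (-1) (k + 1 - i) v)
       - of_int (k + 1 - i) \<cdot> (exp_phi M 1 i (exp_phi M (-1) (k + 1 - i) v)
          - exp_phi M (-1) i (exp_phi M 1 (k + 1 - i) v)))" for i
  proof -
    have "fderiv M (psi M) (k - i) v = of_int (k + 1 - i) \<cdot> psi M (k + 1 - i) v"
      by (simp add: fderiv_def algebra_simps)
    then show ?thesis
      by (simp only: linop_scale[OF linop_psit] psit_psi vs.scale_right_diff_distrib[symmetric] vs.scale_scale mult.commute)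
  qed
  moreover have "has_fsum (\<lambda>i. (- \<i> / 2) \<cdot>
      (of_int (k + 1 - i) \<cdot> exp_phi M 1 i (exp_phi M 1 (k + 1 - i) v)
       - of_int (k + 1 - i) \<cdot> exp_phi M (-1) i (exp_phi M (-1) (k + 1 - i) v)
       - of_int (k + 1 - i) \<cdot> (exp_phi M 1 i (exp_phi M (-1) (k + 1 - i) v)
          - exp_phi M (-1) i (exp_phi M 1 (k + 1 - i) v))))
      ((- \<i> / 2) \<cdot> (- exp_phi M (1 + 1) k v - (- exp_phi M (-1 + -1) k v)
        - of_int (k + 1) \<cdot> act M (A (- (k + 1) - 1)) v))"
    by (intro smul_has_fsum has_fsum_diff exp_phi_opposite_deriv s) simp_all
  moreover have "(- \<i> / 2) \<cdot> (- exp_phi M (1 + 1) k v - (- exp_phi M (-1 + -1) k v)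
        - of_int (k + 1) \<cdot> act M (A (- (k + 1) - 1)) v)
      = (\<i> / 2) \<cdot> (exp_phi M 2 k v - exp_phi M (-2) k v + of_int (k + 1) \<cdot> act M (A (- k - 2)) v)"
  proof -
    have e: "- (k + 1) - 1 = - k - 2" by simp
    show ?thesis unfolding e by (simp add: vs.scale_right_distrib vs.scale_right_diff_distrib)
  qed
  ultimately show ?thesis by simp
qed

section \<open>Truncation bounds and the product of the fermion with G\<close>

lemma exp_phi_bounded: "\<exists>B. \<forall>j<B. exp_phi M k j v = 0"
proof (induction v rule: charge_induct)
  case (charge m v)
  obtain N where N: "N \<ge> 0" "\<And>k i. i > N \<Longrightarrow> osc 1 k i v = 0"
    by (rule osc_bounded[of v]) blast
  have "exp_phi M k j v = 0" if "j < k * m - N" for j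
  proof -
    have "osc (-1) k (j - k * m + i) (expQ M k (osc 1 k i v)) = 0" for i
      using that N(2)[of i k] by (cases "i > N") (auto simp: linop_zeros osc_neg)
    then show ?thesis using exp_phi_charge(2)[OF charge, of k j] by (simp add: has_fsum_def)
  qed
  then show ?case by blast
next
  case (add u v)
  then obtain B C where "\<forall>j<B. exp_phi M k j u = 0" "\<forall>j<C. exp_phi M k j v = 0" by blast
  then show ?case by (intro exI[of _ "min B C"]) (simp add: linop_exps)
qed (simp add: linop_0[OF linop_exp_phi])

text \<open>For opposite charges only the total i + j can be bounded, since the product is a tail.
  The bound 2 B - 1 reflects that the diagonal has a + b = i + j + 1.\<close>

lemma exp_phi_exp_phi_bounded:
  assumes "k * l = 1 \<or> k * l = -1"
  shows "\<exists>B. \<forall>i j. i + j < B \<longrightarrow> exp_phi M k i (exp_phi M l j v) = 0"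
proof (induction v rule: charge_induct)
  case (charge m v)
  obtain B where B: "\<And>a b. a < B \<or> b < B \<Longrightarrow> pair_op k l m a b v = 0"
    by (rule pair_op_bounded[of k l m v]) blast
  have "exp_phi M k i (exp_phi M l j v) = 0" if "i + j < 2 * B - 1" for i j
  proof (cases "k * l = 1")
    case True
    have "i - 1 < B \<or> j < B" "i < B \<or> j - 1 < B" using that by auto
    then show ?thesis by (simp add: exp_phi_exp_phi_same[OF charge True] B)
  next
    case False
    have "a < B \<or> i + j + 1 - a < B" for a using that by auto
    then have "(if a > i then pair_op k l m a (i + j + 1 - a) v else 0) = 0" for a by (simp add: B)
    then show ?thesis
      using exp_phi_exp_phi_opposite[OF charge, of k l i j] False assms by (simp add: has_fsum_def)
  qed
  then show ?case by blast
next
  case (add u v)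
  then obtain B C where "\<forall>i j. i + j < B \<longrightarrow> exp_phi M k i (exp_phi M l j u) = 0"
    "\<forall>i j. i + j < C \<longrightarrow> exp_phi M k i (exp_phi M l j v) = 0" by blast
  then show ?case by (intro exI[of _ "min B C"]) (simp add: linop_exps)
qed (simp add: linop_0[OF linop_exp_phi])

lemma psi_bounded: "\<exists>B. \<forall>j<B. psi M j v = 0"
proof -
  obtain B C where "\<forall>j<B. exp_phi M 1 j v = 0" "\<forall>j<C. exp_phi M (-1) j v = 0"
    using exp_phi_bounded by meson
  then show ?thesis by (intro exI[of _ "min B C"]) (simp add: psi_mode)
qed

lemma psit_psi_bounded: "\<exists>B. \<forall>i j. i + j < B \<longrightarrow> psit M i (psi M j v) = 0"
proof -
  obtain B1 B2 B3 B4 where "\<forall>i j. i + j < B1 \<longrightarrow> exp_phi M 1 i (exp_phi M 1 j v) = 0"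
    "\<forall>i j. i + j < B2 \<longrightarrow> exp_phi M (-1) i (exp_phi M (-1) j v) = 0"
    "\<forall>i j. i + j < B3 \<longrightarrow> exp_phi M 1 i (exp_phi M (-1) j v) = 0"
    "\<forall>i j. i + j < B4 \<longrightarrow> exp_phi M (-1) i (exp_phi M 1 j v) = 0"
    using exp_phi_exp_phi_bounded[of 1 1 v] exp_phi_exp_phi_bounded[of "-1" "-1" v]
      exp_phi_exp_phi_bounded[of 1 "-1" v] exp_phi_exp_phi_bounded[of "-1" 1 v] by auto
  then show ?thesis
    by (intro exI[of _ "min (min B1 B2) (min B3 B4)"]) (simp add: psit_psi)
qed

lemma psi_At: "act M (At n) (psi M i v) = psi M i (act M (At n) v)"
  and psit_At: "act M (At n) (psit M i v) = psit M i (act M (At n) v)"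
  by (simp_all add: psi_mode psit_mode linop_scale[OF linop_act] linop_diff[OF linop_act] linop_add[OF linop_act] exp_phi_At)

text \<open>The coefficient of \<open>z\<^bsup>-K\<^esup>\<close> in the product of \<open>z \<phi>'(z)\<close> with its analogue with a tilde.\<close>

definition current_mixed :: "int \<Rightarrow> 'v \<Rightarrow> 'v" where
  "current_mixed K v = Sum_any (\<lambda>n. act M (At n) (act M (A (- K - n)) v))"

lemma has_fsum_current_mixed:
  "has_fsum (\<lambda>n. act M (At n) (act M (A (- K - n)) v)) (current_mixed K v)"
proof -
  have "nord M id [At n, A m] v = act M (At n) (act M (A m) v)" for n m
    by (simp add: nord_pair comm_A_At)
  then show ?thesis using nord_pair_finite[of At A "- K" v] by (simp add: has_fsum_def current_mixed_def)
qed

lemma At_bounded: "\<exists>N. \<forall>n>N. act M (At n) v = 0"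
proof -
  obtain N where N: "N \<ge> 0" "\<And>ws. \<forall>g\<in>set ws. deg g \<ge> 0 \<Longrightarrow> (\<Sum>g\<leftarrow>ws. deg g) > N \<Longrightarrow> word M ws v = 0"
    by (rule osc_bounded[of v]) blast
  have "act M (At n) v = 0" if "n > N" for n
    using N(2)[of "[At n]"] N(1) that by (simp add: word_Cons word_Nil)
  then show ?thesis by blast
qed

lemma has_fsum_dphit_psi: "has_fsum (\<lambda>n. dphit M n (psi M (k - n) v)) (fmult (dphit M) (psi M) k v)"
proof -
  obtain B where B: "\<forall>j<B. psi M j v = 0" using psi_bounded by blast
  obtain N where N: "\<forall>n>N. act M (At n) v = 0" using At_bounded by blast
  have "n \<in> {- N - 1..k - B}" if "dphit M n (psi M (k - n) v) \<noteq> 0" for n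
  proof -
    have "\<not> k - n < B" using that B by (auto simp: dphit_def linop_zeros)
    moreover have "\<not> - n - 1 > N"
      using that N by (auto simp: dphit_def psi_At linop_0[OF linop_psi])
    ultimately show ?thesis by auto
  qed
  then have "{n. dphit M n (psi M (k - n) v) \<noteq> 0} \<subseteq> {- N - 1..k - B}"
    by (intro subsetI) (simp only: mem_Collect_eq)
  then have "finite {n. dphit M n (psi M (k - n) v) \<noteq> 0}" by (rule finite_subset) simp
  then show ?thesis by (simp add: has_fsum_def fmult_def)
qed

text \<open>Tilde modes commute with both fermions. Moved to the left they leave the product of
  \<open>psit\<close> and \<open>psi\<close>, already known, and bound n from above by
  \<open>psit_psi_bounded\<close>; moved to the right they bound n from below by
  \<open>At_bounded\<close>.\<close>

lemma has_fsum_psit_dphit_psi: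
  "has_fsum (\<lambda>i. psit M i (fmult (dphit M) (psi M) (k - i) v)) (\<i> \<cdot> current_mixed (k + 2) v)"
proof -
  define \<Phi> where "\<Phi> n i = psit M i (dphit M n (psi M (k - i - n) v))" for n i
  have \<Phi>1: "\<Phi> n i = dphit M n (psit M i (psi M (k - n - i) v))" for n i
    by (simp add: \<Phi>_def dphit_def psit_At algebra_simps)
  have \<Phi>2: "\<Phi> n i = psit M i (psi M (k - n - i) (dphit M n v))" for n i
    by (simp add: \<Phi>1 dphit_def psit_At psi_At)
  have rows: "has_fsum (\<Phi> n) (dphit M n (\<i> \<cdot> act M (A (- (k - n) - 1)) v))" for n
    unfolding \<Phi>1[abs_def] dphit_def by (rule linop_has_fsum[OF linop_act has_fsum_psit_psi])
  have cols: "has_fsum (\<lambda>n. \<Phi> n i) (psit M i (fmult (dphit M) (psi M) (k - i) v))" for i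
    unfolding \<Phi>_def by (rule linop_has_fsum[OF linop_psit has_fsum_dphit_psi])
  obtain B where B: "\<forall>i j. i + j < B \<longrightarrow> psit M i (psi M j v) = 0" using psit_psi_bounded by blast
  obtain N where N: "\<forall>n>N. act M (At n) v = 0" using At_bounded by blast
  have n: "n \<in> {- N - 1..k - B}" if "\<Phi> n i \<noteq> 0" for n i
  proof -
    have "\<not> k - n < B" using that B by (auto simp: \<Phi>1 dphit_def linop_zeros)
    moreover have "\<not> - n - 1 > N"
      using that N by (auto simp: \<Phi>2 dphit_def linop_0[OF linop_psi] linop_0[OF linop_psit])
    ultimately show ?thesis by auto
  qed
  have "finite (Sigma {- N - 1..k - B} (\<lambda>n. {i. \<Phi> n i \<noteq> 0}))"
    using rows by (intro finite_SigmaI) (auto simp: has_fsum_def)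
  moreover have "{(n, i). \<Phi> n i \<noteq> 0} \<subseteq> Sigma {- N - 1..k - B} (\<lambda>n. {i. \<Phi> n i \<noteq> 0})"
    using n by (intro subrelI) (simp only: mem_Sigma_iff mem_Collect_eq prod.case simp_thms)
  ultimately have fin: "finite {(n, i). \<Phi> n i \<noteq> 0}" by (rule rev_finite_subset)
  \<comment> \<open>The coefficient of z^n in \<open>dphit\<close> is the mode -n - 1, hence the
    reflection at -1.\<close>
  have e: "- 1 - x = - x - 1" "- (k + 2) - (- x - 1) = - (k - x) - 1" for x by simp_all
  have "has_fsum (\<lambda>n. dphit M n (\<i> \<cdot> act M (A (- (k - n) - 1)) v)) (\<i> \<cdot> current_mixed (k + 2) v)"
    using has_fsum_reflect[OF smul_has_fsum[OF has_fsum_current_mixed[of "k + 2" v], of "\<i>"], of "-1"]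
    by (simp only: dphit_def linop_scale[OF linop_act] e)
  from has_fsum_swap[OF fin rows this cols] show ?thesis .
qed

lemma psit_Gfield: "fmult (psit M) (Gfield M \<beta> s) k v = \<i> \<cdot> current_mixed (k + 2) v
    + (2 * sigma \<beta> s) \<cdot> (\<i> / 2) \<cdot> (exp_phi M 2 k v - exp_phi M (-2) k v + of_int (k + 1) \<cdot> act M (A (- k - 2)) v)"
proof -
  have "psit M i (Gfield M \<beta> s (k - i) v) = psit M i (fmult (dphit M) (psi M) (k - i) v)
      + (2 * sigma \<beta> s) \<cdot> psit M i (fderiv M (psi M) (k - i) v)" for i
    by (simp add: Gfield_def fadd_def fsmul_def linop_add[OF linop_psit] linop_scale[OF linop_psit])
  then show ?thesis unfolding fmult_def[of "psit M"]
    using has_fsum_Sum_any[OF has_fsum_add[OF has_fsum_psit_dphit_psi[of k v]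
      smul_has_fsum[OF has_fsum_psit_dpsi[of k v], of "2 * sigma \<beta> s"]]] by simp
qed

end

lemma has_fsum_image:
  assumes "has_fsum h s" "inj g" "\<And>x. f (g x) = h x" "\<And>y. y \<notin> range g \<Longrightarrow> f y = 0"
  shows "has_fsum f s"
proof -
  obtain S where S: "finite S" "\<And>x. x \<notin> S \<Longrightarrow> h x = 0" "sum h S = s"
    by (rule has_fsumE[OF assms(1)]) blast
  show ?thesis
  proof (rule has_fsumI[of "g ` S"])
    show "f y = 0" if "y \<notin> g ` S" for y
    proof (cases "y \<in> range g")
      case True
      then obtain x where y: "y = g x" by blast
      with that have "x \<notin> S" by blast
      then show ?thesis unfolding y assms(3) by (rule S(2))
    qed (rule assms(4))
    show "sum f (g ` S) = s"
      using S(3) assms(3) inj_on_subset[OF assms(2)] by (simp add: sum.reindex)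
  qed (use S(1) in simp)
qed

section \<open>Exponentials to second order in \<open>\<hbar>\<close>\<close>

lemma fps_nth_1_mult: "fps_nth a 0 = 0 \<Longrightarrow> fps_nth (a * b) 1 = fps_nth a 1 * fps_nth (b :: complex fps) 0"
  by (simp add: fps_mult_nth_1)

lemma fps_nth_2_mult:
  "fps_nth a 0 = 0 \<Longrightarrow> fps_nth b 0 = 0 \<Longrightarrow> fps_nth (a * b) 2 = fps_nth a 1 * fps_nth (b :: complex fps) 1"
  by (simp add: fps_mult_nth numeral_2_eq_2)

text \<open>Every factor is divisible by the parameter, so at order r only words of length at most r
  survive.\<close>

lemma fps_nth_prod_list:
  fixes E :: "'b \<Rightarrow> complex fps"
  assumes "\<And>g. fps_nth (E g) 0 = 0"
  shows "r < length ws \<Longrightarrow> fps_nth (\<Prod>g\<leftarrow>ws. E g) r = 0"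
proof (induction ws arbitrary: r)
  case (Cons g ws)
  have "fps_nth (E g) i * fps_nth (\<Prod>g\<leftarrow>ws. E g) (r - i) = 0" if "i \<le> r" for i
    using Cons assms[of g] that by (cases "i = 0") auto
  then show ?case unfolding list.map prod_list.Cons fps_mult_nth by (intro sum.neutral) simp
qed simp

lemma fps_nth_0_prod_list: "fps_nth (\<Prod>g\<leftarrow>ws. E g) 0 = (\<Prod>g\<leftarrow>ws. fps_nth (E g :: complex fps) 0)"
  by (induction ws) auto

context heisenberg_module
begin

text \<open>At order 0 the exponential sees only the constant terms of the exponent, so any
  deformation of k \<phi> has the same leading term.\<close>

lemma nexp_0:
  assumes "fst E = k" "\<And>g. fps_nth (snd E g) 0 = cphi k g"
  shows "nexp M E 0 j v = exp_phi M k j v"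
  unfolding exp_phi_def nexp_def fps_nth_0_prod_list assms(1)
  by (simp add: assms(2) cphi_def phi_exponent_def)

lemma nexp_charge_0:
  assumes "fst E = 0"
  shows "nexp M E r j v = Sum_any (\<lambda>ws. if (\<Sum>g\<leftarrow>ws. deg g) = - j
    then (fps_nth (\<Prod>g\<leftarrow>ws. snd E g) r / fact (length ws)) \<cdot> nord M id ws v else 0)"
proof -
  have "nord M (expQ M 0 \<circ> zpow M 0 (j + (\<Sum>g\<leftarrow>ws. deg g))) ws v
      = (if (\<Sum>g\<leftarrow>ws. deg g) = - j then nord M id ws v else 0)" for ws
    by (auto simp: nord_def zpow_0 expQ_0 linop_0[OF linop_word])
  then show ?thesis unfolding nexp_def assms by (intro arg_cong[where f = Sum_any] ext) simp
qed

lemma nord_single: "nord M id [g] v = act M g v"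
  by (simp add: nord_def word_Cons word_Nil)

lemma nord_Nil: "nord M id [] v = v"
  by (simp add: nord_def word_Nil)

context
  fixes E :: exponent
  assumes E0: "fst E = 0" "\<And>g. fps_nth (snd E g) 0 = 0"
begin

lemma nexp_order_0: "nexp M E 0 j v = (if j = 0 then v else 0)"
proof -
  have "has_fsum (\<lambda>ws. if (\<Sum>g\<leftarrow>ws. deg g) = - j
    then (fps_nth (\<Prod>g\<leftarrow>ws. snd E g) 0 / fact (length ws)) \<cdot> nord M id ws v else 0) (if j = 0 then v else 0)"
    by (rule has_fsum_single[of "[]"]) (auto simp: nord_Nil fps_nth_prod_list[OF E0(2)])
  then show ?thesis unfolding nexp_charge_0[OF E0(1)] by (rule has_fsum_Sum_any)
qed

lemma linear_terms:
  "has_fsum (\<lambda>ws. if length ws = 1 \<and> (\<Sum>g\<leftarrow>ws. deg g) = - j then f (hd ws) \<cdot> act M (hd ws) v else 0)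
    (f (A (- j)) \<cdot> act M (A (- j)) v + f (At (- j)) \<cdot> act M (At (- j)) v)"
proof (rule has_fsumI[of "{[A (- j)], [At (- j)]}"])
  fix ws assume ws: "ws \<notin> {[A (- j)], [At (- j)]}"
  have "ws = [g] \<Longrightarrow> deg g \<noteq> - j" for g using ws by (cases g) auto
  then show "(if length ws = 1 \<and> (\<Sum>g\<leftarrow>ws. deg g) = - j then f (hd ws) \<cdot> act M (hd ws) v else 0) = 0"
    by (auto simp: length_Suc_conv)
qed auto

lemma nexp_order_1: "nexp M E 1 j v = fps_nth (snd E (A (- j))) 1 \<cdot> act M (A (- j)) v
    + fps_nth (snd E (At (- j))) 1 \<cdot> act M (At (- j)) v"
proof -
  have eq: "(if (\<Sum>g\<leftarrow>ws. deg g) = - j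
      then (fps_nth (\<Prod>g\<leftarrow>ws. snd E g) 1 / fact (length ws)) \<cdot> nord M id ws v else 0)
    = (if length ws = 1 \<and> (\<Sum>g\<leftarrow>ws. deg g) = - j then fps_nth (snd E (hd ws)) 1 \<cdot> act M (hd ws) v else 0)" for ws
  proof (cases "length ws > 1")
    case False
    then consider "ws = []" | g where "ws = [g]" by (cases ws) auto
    then show ?thesis by cases (auto simp: nord_single)
  qed (auto simp: fps_nth_prod_list[OF E0(2)])
  show ?thesis unfolding nexp_charge_0[OF E0(1)] eq by (rule has_fsum_Sum_any[OF linear_terms])
qed

text \<open>Words of length one carry the second order of the exponent, words of length two half the
  square of its first order. As the first order coefficients do not depend on n, that square is
  formed from the full currents; mixed words occur in both orders, which doubles their half.\<close>

lemma nexp_order_2: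
  assumes E1: "\<And>n. fps_nth (snd E (A n)) 1 = x" "\<And>n. fps_nth (snd E (At n)) 1 = y"
  shows "nexp M E 2 j v = fps_nth (snd E (A (- j))) 2 \<cdot> act M (A (- j)) v
    + fps_nth (snd E (At (- j))) 2 \<cdot> act M (At (- j)) v
    + ((x * x / 2) \<cdot> current_sq j v + (x * y) \<cdot> current_mixed j v + (y * y / 2) \<cdot> nord_dphit_sq M (j - 2) v)"
proof -
  \<comment> \<open>With \<open>T\<close> and \<open>U\<close> taken as constructors, each word of
    length two and total degree -j belongs to exactly one of the four families.\<close>
  define P where "P T U c ws = (if (\<exists>n. ws = [T n, U (- j - n)]) then (c / 2) \<cdot> nord M id ws v else 0)"
    for T U :: "int \<Rightarrow> mode" and c ws
  have P: "has_fsum (P T U c) ((c / 2) \<cdot> t)" if "has_fsum (\<lambda>n. nord M id [T n, U (- j - n)] v) t"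
    "\<And>n. deg (T n) = n" for T U c t
  proof (rule has_fsum_image[OF smul_has_fsum[OF that(1)], where g = "\<lambda>n. [T n, U (- j - n)]"])
    show "inj (\<lambda>n. [T n, U (- j - n)])" by (rule injI) (metis list.inject that(2))
  qed (auto simp: P_def)
  have m1: "has_fsum (\<lambda>n. nord M id [At n, A (- j - n)] v) (current_mixed j v)"
    using has_fsum_current_mixed[of j v] by (rule has_fsum_cong) (simp_all add: nord_pair comm_A_At)
  have m2: "has_fsum (\<lambda>n. nord M id [A n, At (- j - n)] v) (current_mixed j v)"
    using has_fsum_reflect[OF has_fsum_current_mixed[of j v], of "- j"]
    by (rule has_fsum_cong) (simp_all add: nord_pair comm_A_At)
  have m3: "has_fsum (\<lambda>n. nord M id [At n, At (- j - n)] v) (nord_dphit_sq M (j - 2) v)"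
    using nord_pair_finite[of At At "- j" v] by (simp add: has_fsum_def nord_dphit_sq_def)
  have eq: "(if (\<Sum>g\<leftarrow>ws. deg g) = - j
      then (fps_nth (\<Prod>g\<leftarrow>ws. snd E g) 2 / fact (length ws)) \<cdot> nord M id ws v else 0)
    = (if length ws = 1 \<and> (\<Sum>g\<leftarrow>ws. deg g) = - j then fps_nth (snd E (hd ws)) 2 \<cdot> act M (hd ws) v else 0)
      + ((P A A (x * x) ws + P At A (x * y) ws) + (P A At (x * y) ws + P At At (y * y) ws))" for ws
  proof (cases "length ws > 2")
    case True
    then show ?thesis by (auto simp: fps_nth_prod_list[OF E0(2)] P_def)
  next
    case False
    then consider "ws = []" | g where "ws = [g]" | g h where "ws = [g, h]"
      by (cases ws; cases "tl ws"; cases "tl (tl ws)") auto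
    then show ?thesis
    proof cases
      case (3 g h)
      have "fps_nth (snd E g * snd E h) 2 = fps_nth (snd E g) 1 * fps_nth (snd E h) 1"
        by (rule fps_nth_2_mult[OF E0(2) E0(2)])
      then show ?thesis using 3 E1 by (cases g; cases h) (auto simp: P_def mult.commute)
    qed (auto simp: P_def nord_single)
  qed
  have "nexp M E 2 j v = (fps_nth (snd E (A (- j))) 2 \<cdot> act M (A (- j)) v
      + fps_nth (snd E (At (- j))) 2 \<cdot> act M (At (- j)) v)
    + (((x * x / 2) \<cdot> current_sq j v + (x * y / 2) \<cdot> current_mixed j v)
      + ((x * y / 2) \<cdot> current_mixed j v + (y * y / 2) \<cdot> nord_dphit_sq M (j - 2) v))"
    unfolding nexp_charge_0[OF E0(1)] eq
    by (rule has_fsum_Sum_any) (intro has_fsum_add linear_terms P has_fsum_current_sq m1 m2 m3 deg.simps)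
  also have "(x * y) \<cdot> current_mixed j v = (x * y / 2) \<cdot> current_mixed j v + (x * y / 2) \<cdot> current_mixed j v"
    by (simp flip: vs.scale_left_distrib)
  then have "((x * x / 2) \<cdot> current_sq j v + (x * y / 2) \<cdot> current_mixed j v)
      + ((x * y / 2) \<cdot> current_mixed j v + (y * y / 2) \<cdot> nord_dphit_sq M (j - 2) v)
    = (x * x / 2) \<cdot> current_sq j v + (x * y) \<cdot> current_mixed j v + (y * y / 2) \<cdot> nord_dphit_sq M (j - 2) v"
    by simp
  finally show ?thesis .
qed

end

end

section \<open>The exponents\<close>

lemma fps_exp_powi: "fps_exp (c :: complex) powi n = fps_exp (of_int n * c)"
  by (cases "n \<ge> 0") (simp_all add: power_int_def fps_exp_power_mult fps_exp_neg[symmetric])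

definition alpha :: "complex \<Rightarrow> int \<Rightarrow> complex fps" where
  "alpha \<beta> n = (if n > 0 then (1 + q1 powi n) * (1 + q3 \<beta> powi n) / (2 * (1 + q2 \<beta> powi (- n))) else 1)"

definition gam :: "complex \<Rightarrow> complex \<Rightarrow> int \<Rightarrow> complex fps" where
  "gam \<beta> s n = (if n > 0 then fps_const (s / 2) * (1 - q1 powi n)
     else (1 - q3 \<beta> powi (- n)) / (fps_const s * (1 + q2 \<beta> powi n)))"

lemma hperp_alpha: "n \<noteq> 0 \<Longrightarrow> hperp \<beta> s i n (A n) = of_int (sg i) * alpha \<beta> n"
  and hperp_gam: "n \<noteq> 0 \<Longrightarrow> hperp \<beta> s i n (At n) = gam \<beta> s n"
  and hperp_0: "hperp \<beta> s i 0 (A 0) = of_int (sg i)" "hperp \<beta> s i 0 (At 0) = 0"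
  by (auto simp: hperp_def lin_def alpha_def gam_def Let_def sg_def fps_divide_unit q2_def fps_exp_powi)

lemma alpha_nth_0: "fps_nth (alpha \<beta> n) 0 = 1"
  by (simp add: alpha_def fps_divide_unit q1_def q2_def q3_def fps_exp_powi)

text \<open>The branches for positive and negative n are normalized differently, but \<beta> / s = s
  makes their first orders agree. This uniformity is what \<open>nexp_order_2\<close>
  demands.\<close>

lemma gam_nth:
  assumes "\<beta> \<noteq> 0" "s\<^sup>2 = \<beta>" "n \<noteq> 0"
  shows "fps_nth (gam \<beta> s n) 0 = 0" "fps_nth (gam \<beta> s n) 1 = - (s / 2) * of_int n"
proof -
  have s: "s \<noteq> 0" using assms by auto
  show "fps_nth (gam \<beta> s n) 0 = 0"
    using s by (simp add: gam_def fps_divide_unit q1_def q2_def q3_def fps_exp_powi)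
  have "\<beta> / s = s" using s assms(2) by (simp add: power2_eq_square field_simps)
  show "fps_nth (gam \<beta> s n) 1 = - (s / 2) * of_int n"
  proof (cases "n > 0")
    case True
    then show ?thesis by (simp add: gam_def q1_def fps_exp_powi)
  next
    case False
    then have "fps_nth (gam \<beta> s n) 1 = - (of_int n * \<beta>) * inverse (s * 2)"
      using s by (simp add: gam_def fps_divide_unit q2_def q3_def fps_exp_powi fps_nth_1_mult del: One_nat_def)
    also have "\<dots> = - (\<beta> / s) / 2 * of_int n" by (simp add: field_simps)
    finally show ?thesis using \<open>\<beta> / s = s\<close> by simp
  qed
qed

text \<open>The exponents of the four terms of \<open>\<T>\<close>, named by the signs of the two factors.\<close>

definition exp_pp where "exp_pp \<beta> s x = exponent_add (at_xi x (Lambda_plus \<beta> s 1)) (Lambda_plus \<beta> s 2)"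
definition exp_mm where "exp_mm \<beta> s x = exponent_add (at_xi x (Lambda_minus \<beta> s 1)) (Lambda_minus \<beta> s 2)"
definition exp_pm where "exp_pm \<beta> s x = exponent_add (at_xi x (Lambda_plus \<beta> s 1)) (Lambda_minus \<beta> s 2)"
definition exp_mp where "exp_mp \<beta> s x = exponent_add (at_xi x (Lambda_minus \<beta> s 1)) (Lambda_plus \<beta> s 2)"

lemmas exponent_defs = exp_pp_def exp_mm_def exp_pm_def exp_mp_def exponent_add_def at_xi_def Lambda_plus_def Lambda_minus_def Let_def sg_def

lemma fst_exponents: "fst (exp_pp \<beta> s x) = 0" "fst (exp_mm \<beta> s x) = 0" "fst (exp_pm \<beta> s x) = 2" "fst (exp_mp \<beta> s x) = -2"
  by (simp_all add: exponent_defs)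

text \<open>The two factors have opposite coefficients at a_n and equal ones at the tilde mode,
  whence a difference and a sum of powers of \<open>xi\<close>. The first is divisible by the
  parameter through this difference, the second through \<open>gam\<close>.\<close>

lemma exp_pp_nonzero:
  assumes "n \<noteq> 0"
  shows "snd (exp_pp \<beta> s x) (A n) = - ((xi x powi (- n) - 1) * (qq \<beta> powi n * fps_const (1 / of_int n) * alpha \<beta> n))"
    "snd (exp_pp \<beta> s x) (At n) = - (gam \<beta> s n * (qq \<beta> powi n * fps_const (1 / of_int n) * (xi x powi (- n) + 1)))"
    "snd (exp_mm \<beta> s x) (A n) = (xi x powi (- n) - 1) * (qq \<beta> powi (- n) * fps_const (1 / of_int n) * alpha \<beta> n)"
    "snd (exp_mm \<beta> s x) (At n) = gam \<beta> s n * (qq \<beta> powi (- n) * fps_const (1 / of_int n) * (xi x powi (- n) + 1))"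
  using assms by (simp_all add: exponent_defs hperp_alpha hperp_gam) (simp_all add: algebra_simps)

text \<open>The powers of q from h_0 cancel between the factors; what remains is log
  \<open>xi\<close> at a_0 and twice s/2 at the tilde zero mode.\<close>

lemma exp_pp_zero:
  "snd (exp_pp \<beta> s x) (A 0) = fps_const x * fps_X" "snd (exp_pp \<beta> s x) (At 0) = fps_const s * fps_X"
  "snd (exp_mm \<beta> s x) (A 0) = - (fps_const x * fps_X)" "snd (exp_mm \<beta> s x) (At 0) = - (fps_const s * fps_X)"
proof -
  have "fps_X * fps_const (s / 2) + fps_X * fps_const (s / 2) = fps_const s * fps_X"
    by (simp add: mult.commute[of fps_X] distrib_right[symmetric])
  then show "snd (exp_pp \<beta> s x) (A 0) = fps_const x * fps_X" "snd (exp_pp \<beta> s x) (At 0) = fps_const s * fps_X"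
    "snd (exp_mm \<beta> s x) (A 0) = - (fps_const x * fps_X)" "snd (exp_mm \<beta> s x) (At 0) = - (fps_const s * fps_X)"
    by (simp_all add: exponent_defs hperp_0 lin_def) (simp flip: fps_const_neg)
qed

lemma qq_xi_nth:
  "fps_nth (qq \<beta> powi n) 0 = 1" "fps_nth (qq \<beta> powi n) 1 = of_int n * (\<beta> - 1) / 2"
  "fps_nth (xi x powi n) 0 = 1" "fps_nth (xi x powi n) 1 = of_int n * x"
  by (simp_all add: qq_def xi_def fps_exp_powi)

text \<open>At second order only the sum of the two exponents is determined. For n different from 0
  it is a product of two series without constant term, one of them containing the difference of the
  powers of \<open>qq\<close>, so it follows from first orders.\<close>

lemma exponents_nth:
  assumes "\<beta> \<noteq> 0" "s\<^sup>2 = \<beta>"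
  shows "fps_nth (snd (exp_pp \<beta> s x) g) 0 = 0" "fps_nth (snd (exp_mm \<beta> s x) g) 0 = 0"
    "fps_nth (snd (exp_pp \<beta> s x) (A n)) 1 = x" "fps_nth (snd (exp_pp \<beta> s x) (At n)) 1 = s"
    "fps_nth (snd (exp_mm \<beta> s x) (A n)) 1 = - x" "fps_nth (snd (exp_mm \<beta> s x) (At n)) 1 = - s"
    "fps_nth (snd (exp_pp \<beta> s x) (A n)) 2 + fps_nth (snd (exp_mm \<beta> s x) (A n)) 2 = of_int n * (\<beta> - 1) * x"
    "fps_nth (snd (exp_pp \<beta> s x) (At n)) 2 + fps_nth (snd (exp_mm \<beta> s x) (At n)) 2 = of_int n * (\<beta> - 1) * s"
proof -
  note g = gam_nth[OF assms]
  have comb: "- (a * (p * c * d)) + a * (p' * c * d) = a * ((p' - p) * (c * d))" for a p p' c d :: "complex fps"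
    by (simp add: algebra_simps)
  show "fps_nth (snd (exp_pp \<beta> s x) g) 0 = 0" "fps_nth (snd (exp_mm \<beta> s x) g) 0 = 0"
    by (cases g; cases "deg g = 0"; simp add: exp_pp_nonzero exp_pp_zero qq_xi_nth g)+
  show "fps_nth (snd (exp_pp \<beta> s x) (A n)) 1 = x" "fps_nth (snd (exp_pp \<beta> s x) (At n)) 1 = s"
    "fps_nth (snd (exp_mm \<beta> s x) (A n)) 1 = - x" "fps_nth (snd (exp_mm \<beta> s x) (At n)) 1 = - s"
    by (cases "n = 0"; simp add: exp_pp_nonzero exp_pp_zero fps_nth_1_mult qq_xi_nth g alpha_nth_0 del: One_nat_def)+
  show "fps_nth (snd (exp_pp \<beta> s x) (A n)) 2 + fps_nth (snd (exp_mm \<beta> s x) (A n)) 2 = of_int n * (\<beta> - 1) * x"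
  proof (cases "n = 0")
    case False
    have "snd (exp_pp \<beta> s x) (A n) + snd (exp_mm \<beta> s x) (A n)
        = (xi x powi (- n) - 1) * ((qq \<beta> powi (- n) - qq \<beta> powi n) * (fps_const (1 / of_int n) * alpha \<beta> n))"
      unfolding exp_pp_nonzero[OF False] by (rule comb)
    then have "fps_nth (snd (exp_pp \<beta> s x) (A n) + snd (exp_mm \<beta> s x) (A n)) 2 = (- of_int n * x)
        * ((of_int (- n) * (\<beta> - 1) / 2 - of_int n * (\<beta> - 1) / 2) * (1 / of_int n))"
      by (simp add: fps_nth_2_mult fps_nth_1_mult qq_xi_nth alpha_nth_0 del: One_nat_def)
    also have "\<dots> = of_int n * (\<beta> - 1) * x" using False by (simp add: field_simps)
    finally show ?thesis by simp
  qed (simp add: exp_pp_zero)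
  show "fps_nth (snd (exp_pp \<beta> s x) (At n)) 2 + fps_nth (snd (exp_mm \<beta> s x) (At n)) 2 = of_int n * (\<beta> - 1) * s"
  proof (cases "n = 0")
    case False
    have "snd (exp_pp \<beta> s x) (At n) + snd (exp_mm \<beta> s x) (At n)
        = gam \<beta> s n * ((qq \<beta> powi (- n) - qq \<beta> powi n) * (fps_const (1 / of_int n) * (xi x powi (- n) + 1)))"
      unfolding exp_pp_nonzero[OF False] by (rule comb)
    then have "fps_nth (snd (exp_pp \<beta> s x) (At n) + snd (exp_mm \<beta> s x) (At n)) 2 = (- (s / 2) * of_int n)
        * ((of_int (- n) * (\<beta> - 1) / 2 - of_int n * (\<beta> - 1) / 2) * (1 / of_int n * 2))"
      using False by (simp add: fps_nth_2_mult fps_nth_1_mult qq_xi_nth g del: One_nat_def)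
    also have "\<dots> = of_int n * (\<beta> - 1) * s" using False by (simp add: field_simps)
    finally show ?thesis by simp
  qed (simp add: exp_pp_zero)
qed

text \<open>For opposite signs the coefficients of a_n add up instead of cancelling, and the tilde
  part is divisible by the parameter: the limits are 2 \<phi> and -2 \<phi>.\<close>

lemma exponents_pm_nth:
  assumes "\<beta> \<noteq> 0" "s\<^sup>2 = \<beta>"
  shows "fps_nth (snd (exp_pm \<beta> s x) g) 0 = cphi 2 g" "fps_nth (snd (exp_mp \<beta> s x) g) 0 = cphi (-2) g"
proof -
  note g = gam_nth[OF assms]
  have "fps_nth (log_q \<beta>) 0 = 0" by (simp add: log_q_def)
  then show "fps_nth (snd (exp_pm \<beta> s x) g) 0 = cphi 2 g" "fps_nth (snd (exp_mp \<beta> s x) g) 0 = cphi (-2) g"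
    by (cases g; cases "deg g = 0"; simp add: exponent_defs hperp_alpha hperp_gam hperp_0 lin_def qq_xi_nth g alpha_nth_0)+
qed

text \<open>Both brackets have the form 1 - \<open>fps_exp\<close>, with exponents 1 + x and x -
  \<beta>, respectively x - 1 and x + \<beta>. The lowest coefficient is the product of the two
  exponents.\<close>

lemma prefactor_nth:
  "fps_nth (qq \<beta> * (1 - q1 * xi x) * (1 - q3 \<beta> * xi x)) 0 = 0"
  "fps_nth (qq \<beta> * (1 - q1 * xi x) * (1 - q3 \<beta> * xi x)) 1 = 0"
  "fps_nth (qq \<beta> * (1 - q1 * xi x) * (1 - q3 \<beta> * xi x)) 2 = (1 + x) * (x - \<beta>)"
  "fps_nth (inverse (qq \<beta>) * (1 - inverse q1 * xi x) * (1 - inverse (q3 \<beta>) * xi x)) 0 = 0"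
  "fps_nth (inverse (qq \<beta>) * (1 - inverse q1 * xi x) * (1 - inverse (q3 \<beta>) * xi x)) 1 = 0"
  "fps_nth (inverse (qq \<beta>) * (1 - inverse q1 * xi x) * (1 - inverse (q3 \<beta>) * xi x)) 2 = (x - 1) * (x + \<beta>)"
proof -
  have *: "fps_nth (u * (1 - fps_exp a) * (1 - fps_exp b)) 0 = 0" "fps_nth (u * (1 - fps_exp a) * (1 - fps_exp b)) 1 = 0"
    "fps_nth (u * (1 - fps_exp a) * (1 - fps_exp b)) 2 = fps_nth u 0 * a * b" for u :: "complex fps" and a b
  proof -
    have e: "u * (1 - fps_exp a) * (1 - fps_exp b) = (1 - fps_exp a) * ((1 - fps_exp b) * u)" by simp
    show "fps_nth (u * (1 - fps_exp a) * (1 - fps_exp b)) 0 = 0" "fps_nth (u * (1 - fps_exp a) * (1 - fps_exp b)) 1 = 0"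
      "fps_nth (u * (1 - fps_exp a) * (1 - fps_exp b)) 2 = fps_nth u 0 * a * b"
      unfolding e by (simp_all add: fps_nth_1_mult fps_nth_2_mult del: One_nat_def)
  qed
  show "fps_nth (qq \<beta> * (1 - q1 * xi x) * (1 - q3 \<beta> * xi x)) 0 = 0"
    "fps_nth (qq \<beta> * (1 - q1 * xi x) * (1 - q3 \<beta> * xi x)) 1 = 0"
    "fps_nth (qq \<beta> * (1 - q1 * xi x) * (1 - q3 \<beta> * xi x)) 2 = (1 + x) * (x - \<beta>)"
    "fps_nth (inverse (qq \<beta>) * (1 - inverse q1 * xi x) * (1 - inverse (q3 \<beta>) * xi x)) 0 = 0"
    "fps_nth (inverse (qq \<beta>) * (1 - inverse q1 * xi x) * (1 - inverse (q3 \<beta>) * xi x)) 1 = 0"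
    "fps_nth (inverse (qq \<beta>) * (1 - inverse q1 * xi x) * (1 - inverse (q3 \<beta>) * xi x)) 2 = (x - 1) * (x + \<beta>)"
    unfolding q1_def q3_def xi_def qq_def fps_exp_neg[symmetric] fps_exp_add_mult[symmetric] *
    by (simp_all add: algebra_simps)
qed

section \<open>The coefficients of the operator up to second order\<close>

context heisenberg_module
begin

lemma hscale_order:
  "hscale M p F 0 k v = fps_nth p 0 \<cdot> F 0 k v"
  "hscale M p F 1 k v = fps_nth p 0 \<cdot> F 1 k v + fps_nth p 1 \<cdot> F 0 k v"
  "hscale M p F 2 k v = fps_nth p 0 \<cdot> F 2 k v + fps_nth p 1 \<cdot> F 1 k v + fps_nth p 2 \<cdot> F 0 k v"
  by (simp_all add: hscale_def numeral_2_eq_2)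

context
  fixes \<beta> s x :: complex
  assumes \<beta>: "\<beta> \<noteq> 0" and s: "s\<^sup>2 = \<beta>"
begin

lemma TT_unfold: "TT M \<beta> s x r k v
    = hscale M (qq \<beta>) (nexp M (exp_pp \<beta> s x)) r k v + (hscale M (inverse (qq \<beta>)) (nexp M (exp_mm \<beta> s x)) r k v
    + (hscale M (qq \<beta> * (1 - q1 * xi x) * (1 - q3 \<beta> * xi x)) (nexp M (exp_pm \<beta> s x)) r (k - 2) v
    + hscale M (inverse (qq \<beta>) * (1 - inverse q1 * xi x) * (1 - inverse (q3 \<beta>) * xi x)) (nexp M (exp_mp \<beta> s x)) r (k - 2) v))"
  by (simp add: TT_def exp_pp_def exp_mm_def exp_pm_def exp_mp_def hadd_def fadd_def hshift_def fshift_def)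

lemma qq_nth:
  "fps_nth (qq \<beta>) 0 = 1" "fps_nth (qq \<beta>) 1 = (\<beta> - 1) / 2" "fps_nth (qq \<beta>) 2 = (\<beta> - 1)\<^sup>2 / 8"
  "fps_nth (inverse (qq \<beta>)) 0 = 1" "fps_nth (inverse (qq \<beta>)) 1 = - ((\<beta> - 1) / 2)"
  "fps_nth (inverse (qq \<beta>)) 2 = (\<beta> - 1)\<^sup>2 / 8"
  unfolding qq_def fps_exp_neg[symmetric] by (simp_all add: power_divide)

lemma scale_two: "2 \<cdot> v = v + v"
  using vs.scale_left_distrib[of 1 1 v] by simp

lemmas exponent_facts = fst_exponents exponents_nth[OF \<beta> s] exponents_pm_nth[OF \<beta> s]

lemma TT_0: "TT M \<beta> s x 0 k v = 2 \<cdot> (if k = 0 then v else 0)"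
  unfolding TT_unfold hscale_order prefactor_nth qq_nth
  by (simp add: nexp_order_0 exponent_facts scale_two)

lemma TT_1: "TT M \<beta> s x 1 k v = 0"
  unfolding TT_unfold hscale_order prefactor_nth qq_nth
  by (simp add: nexp_order_0 nexp_order_1 exponent_facts del: One_nat_def)

text \<open>In the factor 1 - k, the part -k comes from the second order of the exponents and 1 from
  the first order of \<open>qq\<close> times that of the exponential. The scalar term is twice the
  second coefficient of \<open>qq\<close>.\<close>

lemma TT_2: "TT M \<beta> s x 2 k v
    = ((\<beta> - 1) * x * of_int (1 - k)) \<cdot> act M (A (- k)) v + (((\<beta> - 1) * s * of_int (1 - k)) \<cdot> act M (At (- k)) v
    + (((\<beta> - 1)\<^sup>2 / 4) \<cdot> (if k = 0 then v else 0)
    + (((1 + x) * (x - \<beta>)) \<cdot> exp_phi M 2 (k - 2) v + (((x - 1) * (x + \<beta>)) \<cdot> exp_phi M (-2) (k - 2) v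
    + ((x * x) \<cdot> current_sq k v + ((2 * x * s) \<cdot> current_mixed k v + (s * s) \<cdot> nord_dphit_sq M (k - 2) v))))))"
proof -
  let ?\<delta> = "if k = 0 then v else 0"
  let ?a = "act M (A (- k)) v" and ?b = "act M (At (- k)) v"
  \<comment> \<open>Stated for arbitrary scalars and vectors, so that collecting terms stays
    independent of the concrete coefficients.\<close>
  have *: "1 \<cdot> (pa \<cdot> a + pb \<cdot> b + (j \<cdot> J + y \<cdot> X + t \<cdot> T)) + h \<cdot> (x \<cdot> a + s \<cdot> b) + d \<cdot> D
      + (1 \<cdot> (ma \<cdot> a + mb \<cdot> b + (j \<cdot> J + y \<cdot> X + t \<cdot> T)) + (- h) \<cdot> ((- x) \<cdot> a + (- s) \<cdot> b) + d \<cdot> D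
      + (0 \<cdot> z1 + 0 \<cdot> z2 + f \<cdot> e + (0 \<cdot> z3 + 0 \<cdot> z4 + g \<cdot> e')))
    = ((pa + ma) + 2 * h * x) \<cdot> a + (((pb + mb) + 2 * h * s) \<cdot> b + ((2 * d) \<cdot> D + (f \<cdot> e + (g \<cdot> e'
      + ((2 * j) \<cdot> J + ((2 * y) \<cdot> X + (2 * t) \<cdot> T))))))"
    for pa pb ma mb j y t h d f g a b J X T D e e' z1 z2 z3 z4
  proof -
    have two: "(2 * c) \<cdot> w = c \<cdot> w + c \<cdot> w" for c w
      using vs.scale_left_distrib[of c c w] by (simp only: mult_2)
    show ?thesis
      by (simp add: vs.scale_left_distrib vs.scale_right_distrib vs.scale_right_diff_distrib mult.assoc two
          add.assoc add.commute add.left_commute)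
  qed
  show ?thesis
    unfolding TT_unfold hscale_order prefactor_nth qq_nth
      nexp_order_0[OF fst_exponents(1) exponents_nth(1)[OF \<beta> s]] nexp_order_0[OF fst_exponents(2) exponents_nth(2)[OF \<beta> s]]
      nexp_order_1[OF fst_exponents(1) exponents_nth(1)[OF \<beta> s]] nexp_order_1[OF fst_exponents(2) exponents_nth(2)[OF \<beta> s]]
      nexp_order_2[OF fst_exponents(1) exponents_nth(1)[OF \<beta> s] exponents_nth(3,4)[OF \<beta> s]]
      nexp_order_2[OF fst_exponents(2) exponents_nth(2)[OF \<beta> s] exponents_nth(5,6)[OF \<beta> s]]
      nexp_0[OF fst_exponents(3) exponents_pm_nth(1)[OF \<beta> s]] nexp_0[OF fst_exponents(4) exponents_pm_nth(2)[OF \<beta> s]]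
      exponents_nth(3-6)[OF \<beta> s] minus_mult_minus * exponents_nth(7,8)[OF \<beta> s]
    by (intro arg_cong2[where f = "(+)"] arg_cong2[where f = "smul M"] refl) (simp_all add: field_simps)
qed

lemma sfT_eq: "fshift 2 (sfT M \<beta> s x) k v
  = (1 / 2) \<cdot> nord_dphit_sq M (k - 2) v + (sigma \<beta> s \<cdot> of_int (k - 1) \<cdot> act M (At (- k)) v
      + (1 / 2) \<cdot> (- 1 / 2) \<cdot> (exp_phi M 2 (k - 2) v + exp_phi M (-2) (k - 2) v - current_sq k v))
    + ((x\<^sup>2 / \<beta> - 1 / 2) \<cdot> (1 / 2) \<cdot> (exp_phi M 2 (k - 2) v + exp_phi M (-2) (k - 2) v + current_sq k v)
      + (x / (\<i> * s)) \<cdot> (\<i> \<cdot> current_mixed k v + (2 * sigma \<beta> s) \<cdot> (\<i> / 2) \<cdot>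
          (exp_phi M 2 (k - 2) v - exp_phi M (-2) (k - 2) v + of_int (k - 1) \<cdot> act M (A (- k)) v)))"
proof -
  have e: "k - 2 + 2 = k" "k - 2 + 1 = k - 1" "- (k - 2) - 2 = - k" "- (k - 1) - 1 = - k" by simp_all
  show ?thesis
    unfolding fshift_def sfT_def Tfield_def fadd_def fsmul_def fderiv_def dphit_def fermion_nord_deriv_psi
      fermion_nord_deriv_psit psit_Gfield e ..
qed

text \<open>Both sides are combinations of the same eight vectors and agree coefficient by
  coefficient. For \<open>exp_phi\<close> of charge 2 and -2 the right side gives x^2 - \<beta> plus
  or minus x (1 - \<beta>), which factors as in \<open>prefactor_nth\<close>. The constant -1/2
  beside x^2 / \<beta> cancels the contribution of \<open>psi\<close> to \<open>current_sq\<close>,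
  leaving x^2.\<close>

lemma TT_2_sfT: "TT M \<beta> s x 2 k v
  = (2 * \<beta>) \<cdot> fshift 2 (sfT M \<beta> s x) k v + ((\<beta> - 1)\<^sup>2 / 4) \<cdot> (if k = 0 then v else 0)"
proof -
  have *: "B \<cdot> (r \<cdot> T + (\<sigma> \<cdot> n \<cdot> b + r \<cdot> r' \<cdot> (e + e' - J)) + (u \<cdot> r \<cdot> (e + e' + J)
      + w \<cdot> (i \<cdot> X + \<tau> \<cdot> i' \<cdot> (e - e' + n \<cdot> a)))) + d \<cdot> D
    = (B * w * \<tau> * i' * n) \<cdot> a + ((B * \<sigma> * n) \<cdot> b + (d \<cdot> D + ((B * r * r' + B * u * r + B * w * \<tau> * i') \<cdot> e
      + ((B * r * r' + B * u * r - B * w * \<tau> * i') \<cdot> e' + ((B * u * r - B * r * r') \<cdot> J + ((B * w * i) \<cdot> X + (B * r) \<cdot> T))))))"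
    for B r r' \<sigma> n u w i i' \<tau> d T b e e' J X a D
    by (simp add: vs.scale_left_distrib vs.scale_left_diff_distrib vs.scale_right_distrib vs.scale_right_diff_distrib
        algebra_simps)
  have s0: "s \<noteq> 0" using \<beta> s by auto
  have b: "\<beta> = s * s" using s by (simp add: power2_eq_square)
  show ?thesis
    unfolding TT_2 sfT_eq *
    by (intro arg_cong2[where f = "(+)"] arg_cong2[where f = "smul M"] refl)
      (use s0 in \<open>simp_all add: b sigma_def power2_eq_square field_simps\<close>)
qed

end

end

theorem proposition5p7:
  fixes M :: "'v::ab_group_add heis" and \<beta> s x :: complex
  assumes "heisenberg_module M" and "\<beta> \<noteq> 0" and "s\<^sup>2 = \<beta>"
  shows "TT M \<beta> s x 0 = fsmul M 2 fone \<and>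
         TT M \<beta> s x 1 = (\<lambda>k v. 0) \<and>
         TT M \<beta> s x 2 = fadd (fsmul M (2 * \<beta>) (fshift 2 (sfT M \<beta> s x)))
                             (fsmul M ((\<beta> - 1)\<^sup>2 / 4) fone)"
proof -
  interpret heisenberg_module M by (rule assms(1))
  show ?thesis
    unfolding fun_eq_iff fadd_def fsmul_def fone_def
    using TT_0[OF assms(2,3)] TT_1[OF assms(2,3)] TT_2_sfT[OF assms(2,3)] by blast
qed

end
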